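(* Let $n\ge1$, $\lambda>1$ and $s>0$. The logarithmic Bessel kernel $K_{s+\ln}^{\lambda}$ has the following behaviour at the origin. (i) If $n>2s$, then $$\lim_{|x|\to0}K_{s+\ln}^{\lambda}(x)\,\frac{\ln\bigl(\frac{1}{|x|^2}\bigr)}{|x|^{2s-n}}=\frac{\Gamma(\frac n2-s)}{\pi^{n/2}\,2^{2s}\,\Gamma(s)}.$$ In particular, the limit constant coincides with the normalization constant of the classical Riesz potential kernel of order $2s$. (ii) If $n=2s$, then $$\lim_{|x|\to0}K_{\frac n2+\ln}^{\lambda}(x)\,\frac{1}{\ln\bigl(\ln\bigl(\tfrac{1}{|x|}\bigr)\bigr)}=\frac{1}{(4\pi)^{\frac n2}\,\Gamma(\frac n2)}.$$ (iii) If $n<2s$, then the kernel extends continuously to the origin and remains bounded: $$\lim_{|x|\to0}K_{s+\ln}^{\lambda}(x)=\frac{1}{(4\pi)^{\frac n2}}\int_0^\infty\frac{\Gamma\bigl(s+p-\frac n2\bigr)}{\Gamma(s+p)}\,\lambda^{\frac n2-s-p}\,dp<\infty .$$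
   Context: The Fourier transform on $\mathbb{R}^n$ is $\widehat f(\xi)=\int_{\mathbb{R}^n}f(x)e^{-2\pi i x\cdot\xi}\,dx$, extended to tempered distributions. For $s>0$, $\lambda>1$, the logarithmic Bessel kernel $K_{s+\ln}^{\lambda}$ is the tempered distribution whose Fourier transform is $\dfrac{1}{(\lambda+4\pi^2|\xi|^2)^s\,\ln(\lambda+4\pi^2|\xi|^2)}$. It is an $L^1(\mathbb R^n)$ function, and its pointwise values for $x\ne0$ are those of the representative $$K_{s+\ln}^{\lambda}(x)=\int_s^\infty \frac{1}{\Gamma(\alpha)}\int_0^\infty e^{-\lambda t}\,t^{\alpha-1}\,p_t(x)\,dt\,d\alpha,\qquad p_t(x)=(4\pi t)^{-n/2}e^{-|x|^2/(4t)}.$$ For $0<2s<n$, the classical Riesz potential kernel of order $2s$ is the function $c\,|x|^{2s-n}$ whose Fourier transform is $(4\pi^2|\xi|^2)^{-s}$; $c$ is its normalization constant. *)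

theory Defs
  imports "HOL-Probability.Probability"
begin

section \<open>Fourier transform and tempered distributions given by functions\<close>

definition fourier :: "('a::euclidean_space \<Rightarrow> complex) \<Rightarrow> 'a \<Rightarrow> complex" where
  "fourier f \<xi> = (LINT x|lborel. f x * cis (- 2 * pi * (x \<bullet> \<xi>)))"

primrec iter_deriv :: "'a list \<Rightarrow> ('a::euclidean_space \<Rightarrow> complex) \<Rightarrow> 'a \<Rightarrow> complex" where
  "iter_deriv [] f = f"
| "iter_deriv (b # bs) f = (\<lambda>x. frechet_derivative (iter_deriv bs f) (at x) b)"

text \<open>Schwartz functions: all iterated partial derivatives exist, are again (Frechet)
  differentiable, and decay faster than any polynomial.\<close>

definition schwartz :: "('a::euclidean_space \<Rightarrow> complex) set" where
  "schwartz = {\<phi>. \<forall>bs. set bs \<subseteq> Basis \<longrightarrow>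
     (\<forall>x. iter_deriv bs \<phi> differentiable (at x)) \<and>
     (\<forall>k::nat. \<exists>C. \<forall>x. norm x ^ k * norm (iter_deriv bs \<phi> x) \<le> C)}"

text \<open>The usual condition for the functional \<open>\<phi> \<mapsto> \<integral> f \<phi>\<close> to be a tempered distribution:
  absolute convergence and continuity on Schwartz functions are immediate from it.\<close>

definition tempered :: "('a::euclidean_space \<Rightarrow> complex) \<Rightarrow> bool" where
  "tempered f \<longleftrightarrow> (\<exists>N::nat. integrable lborel (\<lambda>x. f x / of_real ((1 + norm x) ^ N)))"

text \<open>The tempered distribution \<open>f\<close> has Fourier transform (the tempered distribution) \<open>g\<close>.\<close>

definition has_fourier_transform ::
    "('a::euclidean_space \<Rightarrow> complex) \<Rightarrow> ('a \<Rightarrow> complex) \<Rightarrow> bool" where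
  "has_fourier_transform f g \<longleftrightarrow> tempered f \<and> tempered g \<and>
     (\<forall>\<phi>\<in>schwartz. (LINT x|lborel. f x * fourier \<phi> x) = (LINT \<xi>|lborel. g \<xi> * \<phi> \<xi>))"

section \<open>The kernels\<close>

definition heat_kernel :: "real \<Rightarrow> 'a::euclidean_space \<Rightarrow> real" where
  "heat_kernel t x =
     (4 * pi * t) powr (- real DIM('a) / 2) * exp (- (norm x)\<^sup>2 / (4 * t))"

definition log_bessel_symbol :: "real \<Rightarrow> real \<Rightarrow> 'a::euclidean_space \<Rightarrow> real" where
  "log_bessel_symbol s lam \<xi> =
     1 / ((lam + 4 * pi\<^sup>2 * (norm \<xi>)\<^sup>2) powr s * ln (lam + 4 * pi\<^sup>2 * (norm \<xi>)\<^sup>2))"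

text \<open>The pointwise representative of the logarithmic Bessel kernel; only its values at
  \<open>x \<noteq> 0\<close> matter. The lemma \<open>log_bessel_kernel_fourier\<close> below shows that it is
  an integrable function representing the tempered distribution whose
  Fourier transform is \<open>log_bessel_symbol s lam\<close>.\<close>

definition log_bessel_kernel :: "real \<Rightarrow> real \<Rightarrow> 'a::euclidean_space \<Rightarrow> real" where
  "log_bessel_kernel s lam x =
     (LBINT \<alpha>:{s<..}. 1 / Gamma \<alpha> *
        (LBINT t:{0<..}. exp (- lam * t) * t powr (\<alpha> - 1) * heat_kernel t x))"

text \<open>\<open>c\<close> normalizes the Riesz potential kernel of order \<open>2 s\<close> on the space \<open>'a\<close>.\<close>

definition riesz_normalization :: "'a::euclidean_space itself \<Rightarrow> real \<Rightarrow> real \<Rightarrow> bool" where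
  "riesz_normalization T s c \<longleftrightarrow>
     has_fourier_transform
       (\<lambda>x::'a. of_real (c * norm x powr (2 * s - real DIM('a))))
       (\<lambda>\<xi>::'a. of_real ((4 * pi\<^sup>2 * (norm \<xi>)\<^sup>2) powr (- s)))"


section \<open>The representative is the logarithmic Bessel kernel\<close>

lemma lborel_integral_prod_inner:
  fixes f :: "'a::euclidean_space \<Rightarrow> real \<Rightarrow> complex"
  assumes f: "\<And>b. b \<in> Basis \<Longrightarrow> integrable lborel (f b)"
  shows "integrable lborel (\<lambda>x::'a. \<Prod>b\<in>Basis. f b (x \<bullet> b))"
    and "(LINT x|lborel. (\<Prod>b\<in>Basis. f b ((x::'a) \<bullet> b))) = (\<Prod>b\<in>Basis. LINT u|lborel. f b u)"
proof -
  interpret product_sigma_finite "\<lambda>b::'a. lborel :: real measure" ..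
  have [measurable]: "f b \<in> borel_measurable borel" if "b \<in> Basis" for b
    using borel_measurable_integrable[OF f[OF that]] by simp
  have eq: "(\<Prod>b\<in>Basis. f b ((\<Sum>c\<in>Basis. g c *\<^sub>R c) \<bullet> b)) = (\<Prod>b\<in>Basis. f b (g b))" for g :: "'a \<Rightarrow> real"
    by (intro prod.cong refl) simp
  have m: "(\<lambda>g. \<Sum>c\<in>Basis. g c *\<^sub>R c) \<in> measurable (\<Pi>\<^sub>M b\<in>(Basis::'a set). (lborel::real measure)) (borel :: 'a measure)"
    by measurable
  have m2: "(\<lambda>x::'a. \<Prod>b\<in>Basis. f b (x \<bullet> b)) \<in> borel_measurable borel"
    by measurable
  show "integrable lborel (\<lambda>x::'a. \<Prod>b\<in>Basis. f b (x \<bullet> b))"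
    by (subst lborel_eq, subst integrable_distr_eq[OF m m2])
       (simp only: eq, rule product_integrable_prod[OF finite_Basis f])
  show "(LINT x|lborel. (\<Prod>b\<in>Basis. f b ((x::'a) \<bullet> b))) = (\<Prod>b\<in>Basis. LINT u|lborel. f b u)"
    by (subst lborel_eq, subst integral_distr[OF m m2])
       (simp only: eq, rule product_integral_prod[OF finite_Basis f])
qed

lemma gauss_fourier_1d:
  fixes t v :: real
  assumes t: "t > 0"
  defines "h \<equiv> \<lambda>u::real. complex_of_real ((4 * pi * t) powr (- 1 / 2) * exp (- u\<^sup>2 / (4 * t))) * cis (- 2 * pi * (u * v))"
  shows "has_bochner_integral lborel h (of_real (exp (- 4 * pi\<^sup>2 * t * v\<^sup>2)))"
proof -
  define \<sigma> where "\<sigma> = sqrt (2 * t)"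
  have s: "\<sigma> > 0" "\<sigma>\<^sup>2 = 2 * t" using t by (auto simp: \<sigma>_def)
  define c where "c = - 2 * pi * \<sigma> * v"
  let ?g = "\<lambda>x. std_normal_density x *\<^sub>R iexp (c * x)"
  have "integrable lborel ?g"
    by (rule Bochner_Integration.integrable_bound[where f = std_normal_density])
       (auto simp: integrable_normal_density)
  moreover have "(LINT x|lborel. ?g x) = char std_normal_distribution c"
    unfolding char_def by (subst integral_density) auto
  ultimately have 1: "has_bochner_integral lborel ?g (of_real (exp (- c\<^sup>2 / 2)))"
    by (simp add: has_bochner_integral_iff char_std_normal_distribution)
  have 2: "c\<^sup>2 / 2 = 4 * pi\<^sup>2 * t * v\<^sup>2"
    using s by (simp add: c_def power_mult_distrib)
  have sq: "(4 * pi * t) powr (- 1 / 2) = 1 / (sqrt (2 * pi) * \<sigma>)"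
  proof -
    have "(4 * pi * t) powr (- 1 / 2) = inverse (sqrt (4 * pi * t))"
      using t powr_minus[of "4 * pi * t" "1/2"] by (simp add: powr_half_sqrt)
    also have "sqrt (4 * pi * t) = sqrt (2 * pi) * \<sigma>"
      by (simp add: \<sigma>_def flip: real_sqrt_mult)
    finally show ?thesis by (simp only: inverse_eq_divide)
  qed
  have "\<sigma> *\<^sub>R h (\<sigma> * x) = ?g x" for x
  proof -
    have e: "exp (- (\<sigma> * x)\<^sup>2 / (4 * t)) = exp (- x\<^sup>2 / 2)"
      using s t by (simp add: power_mult_distrib field_simps)
    have "cis (- 2 * pi * (\<sigma> * x * v)) = iexp (c * x)"
      unfolding cis_conv_exp c_def by (simp add: mult_ac)
    moreover have "\<sigma> * (1 / (sqrt (2 * pi) * \<sigma>) * exp (- x\<^sup>2 / 2)) = std_normal_density x"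
      using s by (simp add: std_normal_density_def)
    ultimately show ?thesis
      unfolding h_def e sq by (metis (no_types) mult.assoc of_real_mult scaleR_conv_of_real)
  qed
  then have "has_bochner_integral lborel (\<lambda>x. \<sigma> *\<^sub>R h (0 + \<sigma> * x)) (of_real (exp (- c\<^sup>2 / 2)))"
    using 1 by simp
  then have "has_bochner_integral lborel (\<lambda>x. h (0 + \<sigma> * x)) (inverse \<sigma> *\<^sub>R of_real (exp (- c\<^sup>2 / 2)))"
    using has_bochner_integral_scaleR_right[of "inverse \<sigma>" lborel "\<lambda>x. \<sigma> *\<^sub>R h (0 + \<sigma> * x)"] s by simp
  then have "has_bochner_integral lborel h (of_real (exp (- c\<^sup>2 / 2)))"
    using lborel_has_bochner_integral_real_affine_iff[of \<sigma> h "of_real (exp (- c\<^sup>2 / 2))" 0] s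
    by simp
  then show ?thesis using 2 by simp
qed

lemma cis_sum: "cis (sum f A) = (\<Prod>x\<in>A. cis (f x))"
  by (induction A rule: infinite_finite_induct) (auto simp flip: cis_mult)

lemma heat_kernel_fourier:
  fixes \<xi> :: "'a::euclidean_space"
  assumes t: "t > 0"
  shows "has_bochner_integral lborel (\<lambda>x::'a. of_real (heat_kernel t x) * cis (- 2 * pi * (x \<bullet> \<xi>)))
           (of_real (exp (- 4 * pi\<^sup>2 * t * (norm \<xi>)\<^sup>2)))"
proof -
  let ?h = "\<lambda>b u. complex_of_real ((4 * pi * t) powr (- 1 / 2) * exp (- u\<^sup>2 / (4 * t))) * cis (- 2 * pi * (u * (\<xi> \<bullet> b)))"
  note H = gauss_fourier_1d[OF t]
  have n: "(norm x)\<^sup>2 = (\<Sum>b\<in>Basis. (x \<bullet> b)\<^sup>2)" for x :: 'a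
    by (subst norm_eq_sqrt_inner, subst euclidean_inner) (simp add: sum_nonneg power2_eq_square)
  have eq: "of_real (heat_kernel t x) * cis (- 2 * pi * (x \<bullet> \<xi>)) = (\<Prod>b\<in>Basis. ?h b (x \<bullet> b))" for x :: 'a
  proof -
    have "exp (- (norm x)\<^sup>2 / (4 * t)) = (\<Prod>b\<in>Basis. exp (- (x \<bullet> b)\<^sup>2 / (4 * t)))"
      by (simp add: n sum_negf sum_divide_distrib flip: exp_sum)
    moreover have "(4 * pi * t) powr (- real DIM('a) / 2) = (\<Prod>b\<in>(Basis::'a set). (4 * pi * t) powr (- 1 / 2))"
      using t by (simp add: powr_realpow[symmetric] powr_powr)
    moreover have "cis (- 2 * pi * (x \<bullet> \<xi>)) = (\<Prod>b\<in>Basis. cis (- 2 * pi * ((x \<bullet> b) * (\<xi> \<bullet> b))))"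
      by (subst euclidean_inner) (simp only: cis_sum sum_distrib_left)
    ultimately show ?thesis
      by (simp add: heat_kernel_def prod.distrib)
  qed
  have "exp (- 4 * pi\<^sup>2 * t * (norm \<xi>)\<^sup>2) = (\<Prod>b\<in>Basis. exp (- 4 * pi\<^sup>2 * t * (\<xi> \<bullet> b)\<^sup>2))"
    unfolding n by (simp add: sum_distrib_left sum_negf flip: exp_sum)
  then have "complex_of_real (exp (- 4 * pi\<^sup>2 * t * (norm \<xi>)\<^sup>2)) = (\<Prod>b\<in>Basis. LINT u|lborel. ?h b u)"
    by (simp only: has_bochner_integral_integral_eq[OF H] of_real_prod)
  then show ?thesis
    using lborel_integral_prod_inner[of ?h, OF has_bochner_integral_iff[THEN iffD1, THEN conjunct1, OF H]]
    by (simp only: eq has_bochner_integral_iff simp_thms)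
qed

lemma has_bochner_integral_Gamma:
  assumes "\<mu> > (0::real)" "\<alpha> > 0"
  shows "has_bochner_integral lborel (\<lambda>t. indicator {0<..} t * (exp (- \<mu> * t) * t powr (\<alpha> - 1)))
           (Gamma \<alpha> * \<mu> powr (- \<alpha>))"
proof -
  define g :: "real \<Rightarrow> real" where "g = (\<lambda>t. indicator {0..} t * (t powr (\<alpha> - 1) / exp t))"
  have "has_bochner_integral lborel g (Gamma \<alpha>)"
  proof (rule has_bochner_integral_nn_integral)
    show "g \<in> borel_measurable lborel" unfolding g_def by measurable
    show "AE x in lborel. 0 \<le> g x" by (auto simp: g_def)
    show "0 \<le> Gamma \<alpha>" using assms Gamma_real_pos[of \<alpha>] by simp
    show "(\<integral>\<^sup>+ x. ennreal (g x) \<partial>lborel) = ennreal (Gamma \<alpha>)"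
      using Gamma_conv_nn_integral_real[of \<alpha>] assms by (simp add: g_def)
  qed
  then have "has_bochner_integral lborel (\<lambda>t. g (0 + \<mu> * t)) (Gamma \<alpha> /\<^sub>R \<bar>\<mu>\<bar>)"
    using lborel_has_bochner_integral_real_affine_iff[of \<mu> g "Gamma \<alpha>" 0] assms by simp
  then have "has_bochner_integral lborel (\<lambda>t. \<mu> powr (1 - \<alpha>) * g (0 + \<mu> * t))
      (\<mu> powr (1 - \<alpha>) * (Gamma \<alpha> /\<^sub>R \<bar>\<mu>\<bar>))"
    by (rule has_bochner_integral_mult_right)
  moreover have "\<mu> powr (1 - \<alpha>) * g (0 + \<mu> * t)
      = indicator {0<..} t * (exp (- \<mu> * t) * t powr (\<alpha> - 1))" for t
  proof (cases "t > 0")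
    case True
    then have "\<mu> powr (1 - \<alpha>) * (\<mu> * t) powr (\<alpha> - 1) = t powr (\<alpha> - 1)"
      using assms by (simp add: powr_mult flip: powr_add mult.assoc)
    then show ?thesis using True assms
      by (simp add: g_def exp_minus field_simps)
  next
    case False
    then show ?thesis using assms
      by (cases "t = 0") (auto simp: g_def zero_le_mult_iff)
  qed
  moreover have "\<mu> powr (1 - \<alpha>) * (Gamma \<alpha> /\<^sub>R \<bar>\<mu>\<bar>) = Gamma \<alpha> * \<mu> powr (- \<alpha>)"
    using assms by (simp add: powr_diff powr_minus field_simps)
  ultimately show ?thesis by (simp only:)
qed

lemma has_bochner_integral_powr_tail:
  assumes "\<mu> > (1::real)"
  shows "has_bochner_integral lborel (\<lambda>\<alpha>. indicator {s<..} \<alpha> * \<mu> powr (- \<alpha>)) (\<mu> powr (- s) / ln \<mu>)"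
proof -
  have l: "ln \<mu> > 0" using assms by simp
  have "has_bochner_integral lborel (\<lambda>\<alpha>. indicator {s..} \<alpha> * exp (- ln \<mu> * \<alpha>)) (exp (- ln \<mu> * s) / ln \<mu>)"
  proof (rule has_bochner_integral_nn_integral)
    show "(\<lambda>\<alpha>. indicator {s..} \<alpha> * exp (- ln \<mu> * \<alpha>)) \<in> borel_measurable lborel" by measurable
    show "0 \<le> exp (- ln \<mu> * s) / ln \<mu>" using l by simp
    show "(\<integral>\<^sup>+ x. ennreal (indicator {s..} x * exp (- ln \<mu> * x)) \<partial>lborel) = ennreal (exp (- ln \<mu> * s) / ln \<mu>)"
      by (rule nn_integral_has_integral_lebesgue[OF _ has_integral_exp_minus_to_infinity[OF l]]) simp
  qed auto
  moreover have "AE \<alpha> in lborel. indicator {s..} \<alpha> * exp (- ln \<mu> * \<alpha>) = indicator {s<..} \<alpha> * \<mu> powr (- \<alpha>)"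
    using AE_lborel_singleton[of s]
    by eventually_elim (use assms in \<open>auto simp: powr_def indicator_def mult_ac\<close>)
  ultimately have "has_bochner_integral lborel (\<lambda>\<alpha>. indicator {s<..} \<alpha> * \<mu> powr (- \<alpha>)) (exp (- ln \<mu> * s) / ln \<mu>)"
    by (subst (asm) has_bochner_integral_cong_AE[where g = "\<lambda>\<alpha>. indicator {s<..} \<alpha> * \<mu> powr (- \<alpha>)"]) auto
  then show ?thesis using assms by (simp add: powr_def mult_ac)
qed

definition log_bessel_weight :: "real \<Rightarrow> real \<Rightarrow> real \<times> real \<Rightarrow> real" where
  "log_bessel_weight s \<mu> = (\<lambda>(\<alpha>, t). indicator {s<..} \<alpha> * rGamma \<alpha> *
     (indicator {0<..} t * (exp (- \<mu> * t) * t powr (\<alpha> - 1))))"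

lemma measurable_rGamma [measurable]: "(rGamma :: real \<Rightarrow> real) \<in> borel_measurable borel"
  by (intro borel_measurable_continuous_onI continuous_on_rGamma)

lemma measurable_log_bessel_weight [measurable]:
  "log_bessel_weight s \<mu> \<in> borel_measurable (borel :: (real \<times> real) measure)"
  unfolding log_bessel_weight_def borel_prod[symmetric] by measurable

lemma measurable_cis [measurable]: "cis \<in> borel_measurable borel"
  by (intro borel_measurable_continuous_onI continuous_intros)

lemma measurable_heat_kernel [measurable (raw)]:
  fixes g :: "'b \<Rightarrow> 'a::euclidean_space"
  assumes [measurable]: "f \<in> borel_measurable M" "g \<in> borel_measurable M"
  shows "(\<lambda>w. heat_kernel (f w) (g w)) \<in> borel_measurable M"
  unfolding heat_kernel_def by measurable

lemma log_bessel_weight_nonneg: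
  assumes "s > 0"
  shows "log_bessel_weight s \<mu> y \<ge> 0"
proof (cases y)
  case (Pair \<alpha> t)
  have "rGamma \<alpha> \<ge> 0" if "\<alpha> > s"
    using that assms Gamma_real_pos[of \<alpha>] by (simp add: Gamma_def)
  then show ?thesis by (auto simp: Pair log_bessel_weight_def indicator_def)
qed

lemma has_bochner_integral_log_bessel_weight:
  assumes "\<mu> > 1" "s > 0"
  shows "has_bochner_integral lborel (log_bessel_weight s \<mu>) (\<mu> powr (- s) / ln \<mu>)"
proof -
  have in1: "has_bochner_integral lborel (\<lambda>t. log_bessel_weight s \<mu> (\<alpha>, t)) (indicator {s<..} \<alpha> * \<mu> powr (- \<alpha>))" for \<alpha>
  proof (cases "\<alpha> > s")
    case True
    then have "Gamma \<alpha> > 0" using assms by (intro Gamma_real_pos) simp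
    then have "rGamma \<alpha> * (Gamma \<alpha> * \<mu> powr (- \<alpha>)) = \<mu> powr (- \<alpha>)"
      by (simp add: Gamma_def)
    note e = this
    show ?thesis
      using has_bochner_integral_mult_right[OF has_bochner_integral_Gamma[of \<mu> \<alpha>], of "rGamma \<alpha>"] True assms
      unfolding e by (simp add: log_bessel_weight_def)
  next
    case False
    then show ?thesis by (simp add: log_bessel_weight_def has_bochner_integral_zero)
  qed
  note out = has_bochner_integral_powr_tail[OF assms(1), of s]
  have int: "integrable (lborel \<Otimes>\<^sub>M lborel) (log_bessel_weight s \<mu>)"
  proof (rule lborel_pair.Fubini_integrable)
    show "log_bessel_weight s \<mu> \<in> borel_measurable (lborel \<Otimes>\<^sub>M lborel)"
      by (simp add: lborel_prod)
    show "integrable lborel (\<lambda>x. LINT y|lborel. norm (log_bessel_weight s \<mu> (x, y)))"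
      using out assms by (simp add: log_bessel_weight_nonneg has_bochner_integral_integral_eq[OF in1] has_bochner_integral_iff)
    show "AE x in lborel. integrable lborel (\<lambda>y. log_bessel_weight s \<mu> (x, y))"
      using in1 by (simp add: has_bochner_integral_iff)
  qed
  have "integral\<^sup>L (lborel \<Otimes>\<^sub>M lborel) (log_bessel_weight s \<mu>) = \<mu> powr (- s) / ln \<mu>"
    using lborel_pair.integral_fst'[OF int] out
    by (simp add: has_bochner_integral_integral_eq[OF in1] has_bochner_integral_iff)
  with int show ?thesis by (simp add: lborel_prod has_bochner_integral_iff)
qed

lemma log_bessel_kernel_iterated:
  "log_bessel_kernel s lam x =
     (LINT \<alpha>|lborel. LINT t|lborel. log_bessel_weight s lam (\<alpha>, t) * heat_kernel t x)"
proof -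
  have "indicator {s<..} \<alpha> *\<^sub>R (1 / Gamma \<alpha> *
        (LINT t|lborel. indicator {0<..} t *\<^sub>R (exp (- lam * t) * t powr (\<alpha> - 1) * heat_kernel t x)))
      = (LINT t|lborel. log_bessel_weight s lam (\<alpha>, t) * heat_kernel t x)" for \<alpha>
    unfolding real_scaleR_def mult.assoc[symmetric]
    by (subst integral_mult_right_zero[symmetric], rule Bochner_Integration.integral_cong)
       (simp_all add: log_bessel_weight_def Gamma_def divide_inverse mult_ac)
  then show ?thesis
    unfolding log_bessel_kernel_def set_lebesgue_integral_def by (simp only:)
qed

lemma log_bessel_kernel_fourier_integral:
  fixes \<xi> :: "'a::euclidean_space"
  assumes "lam > 1" "s > 0"
  shows "integrable lborel (log_bessel_kernel s lam :: 'a \<Rightarrow> real)"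
    and "fourier (\<lambda>x. of_real (log_bessel_kernel s lam x)) \<xi> = of_real (log_bessel_symbol s lam \<xi>)"
proof -
  define F where "F = (\<lambda>\<xi> (y::real\<times>real) (x::'a).
    complex_of_real (log_bessel_weight s lam y * heat_kernel (snd y) x) * cis (- 2 * pi * (x \<bullet> \<xi>)))"
  have [measurable]: "(snd :: real \<times> real \<Rightarrow> real) \<in> borel_measurable borel"
    by (intro borel_measurable_continuous_onI continuous_intros)
  have Fm [measurable]: "case_prod (F \<xi>) \<in> borel_measurable (borel \<Otimes>\<^sub>M borel)" for \<xi>
    unfolding F_def by measurable
  have inner: "has_bochner_integral lborel (F \<xi> y)
      (of_real (log_bessel_weight s (lam + 4 * pi\<^sup>2 * (norm \<xi>)\<^sup>2) y))" for \<xi> y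
  proof (cases "snd y > 0")
    case True
    obtain \<alpha> t where y: "y = (\<alpha>, t)" by (cases y)
    have e: "log_bessel_weight s lam y * exp (- 4 * pi\<^sup>2 * t * (norm \<xi>)\<^sup>2)
        = log_bessel_weight s (lam + 4 * pi\<^sup>2 * (norm \<xi>)\<^sup>2) y"
      by (simp add: y log_bessel_weight_def algebra_simps flip: exp_add)
    show ?thesis
      using has_bochner_integral_mult_right[OF heat_kernel_fourier[OF True, of \<xi>], of "of_real (log_bessel_weight s lam y)"]
      unfolding F_def e[symmetric] by (simp add: y mult.assoc)
  next
    case False
    then have "log_bessel_weight s \<mu> y = 0" for \<mu>
      by (cases y) (simp add: log_bessel_weight_def)
    then show ?thesis by (simp add: F_def has_bochner_integral_zero)
  qed
  have nrm: "norm (F \<xi> y x) = Re (F 0 y x)" for \<xi> y x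
    using assms by (simp add: F_def norm_mult log_bessel_weight_nonneg heat_kernel_def abs_mult)
  have int: "integrable (lborel \<Otimes>\<^sub>M lborel) (case_prod (F \<xi>))" for \<xi>
  proof (rule lborel_pair.Fubini_integrable)
    show "case_prod (F \<xi>) \<in> borel_measurable (lborel \<Otimes>\<^sub>M lborel)"
      using Fm by simp
    show "AE y in lborel. integrable lborel (\<lambda>x. case_prod (F \<xi>) (y, x))"
      using inner by (simp add: has_bochner_integral_iff)
    have "(LINT x|lborel. Re (F 0 y x)) = log_bessel_weight s lam y" for y
      using has_bochner_integral_Re[OF inner[of 0 y]] by (simp add: has_bochner_integral_iff)
    then show "integrable lborel (\<lambda>y. LINT x|lborel. norm (case_prod (F \<xi>) (y, x)))"
      using has_bochner_integral_log_bessel_weight[OF assms] by (simp add: nrm has_bochner_integral_iff)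
  qed
  have K: "AE x in lborel. (LINT y|lborel. F \<xi> y x) = of_real (log_bessel_kernel s lam x) * cis (- 2 * pi * (x \<bullet> \<xi>))" for \<xi>
  proof (rule eventually_mono[OF lborel_pair.AE_integrable_snd[OF int[of 0]]])
    fix x :: 'a
    assume elim: "integrable lborel (\<lambda>y. F 0 y x)"
    have i: "integrable (lborel \<Otimes>\<^sub>M lborel) (\<lambda>y. log_bessel_weight s lam y * heat_kernel (snd y) x)"
      using integrable_Re[OF elim] by (simp add: F_def lborel_prod)
    have "(LINT y|lborel. log_bessel_weight s lam y * heat_kernel (snd y) x) = log_bessel_kernel s lam x"
      using lborel_pair.integral_fst'[OF i] by (simp add: log_bessel_kernel_iterated lborel_prod)
    then show "(LINT y|lborel. F \<xi> y x) = of_real (log_bessel_kernel s lam x) * cis (- 2 * pi * (x \<bullet> \<xi>))"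
      unfolding F_def by (simp del: of_real_mult)
  qed
  have meas: "(log_bessel_kernel s lam :: 'a \<Rightarrow> real) \<in> borel_measurable borel"
    unfolding log_bessel_kernel_iterated by measurable
  have *: "integrable lborel (\<lambda>x. of_real (log_bessel_kernel s lam x) * cis (- 2 * pi * (x \<bullet> \<xi>)))" for \<xi> :: 'a
  proof (rule integrable_cong_AE_imp[OF lborel_pair.integrable_snd[OF int[of \<xi>]]])
    show "(\<lambda>x. complex_of_real (log_bessel_kernel s lam x) * cis (- 2 * pi * (x \<bullet> \<xi>))) \<in> borel_measurable lborel"
      using meas by measurable
    show "AE x in lborel. (LINT y|lborel. F \<xi> y x) = of_real (log_bessel_kernel s lam x) * cis (- 2 * pi * (x \<bullet> \<xi>))"
      by (rule K)
  qed
  show "integrable lborel (log_bessel_kernel s lam :: 'a \<Rightarrow> real)"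
    using integrable_Re[OF *[of 0]] by simp
  define \<mu> where "\<mu> = lam + 4 * pi\<^sup>2 * (norm \<xi>)\<^sup>2"
  have mu: "\<mu> > 1" using assms by (auto simp: \<mu>_def intro: add_pos_nonneg less_le_trans)
  have "fourier (\<lambda>x. of_real (log_bessel_kernel s lam x)) \<xi> = (LINT x|lborel. LINT y|lborel. F \<xi> y x)"
    unfolding fourier_def
  proof (rule integral_cong_AE)
    show "(\<lambda>x. complex_of_real (log_bessel_kernel s lam x) * cis (- 2 * pi * (x \<bullet> \<xi>))) \<in> borel_measurable lborel"
      using meas by measurable
    show "(\<lambda>x. LINT y|lborel. F \<xi> y x) \<in> borel_measurable lborel"
      using lborel_pair.integrable_snd[OF int[of \<xi>]] by (rule borel_measurable_integrable)
    show "AE x in lborel. of_real (log_bessel_kernel s lam x) * cis (- 2 * pi * (x \<bullet> \<xi>)) = (LINT y|lborel. F \<xi> y x)"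
      using K[of \<xi>] by eventually_elim simp
  qed
  also have "\<dots> = (LINT y|lborel. LINT x|lborel. F \<xi> y x)"
    using lborel_pair.integral_snd[OF int[of \<xi>]] lborel_pair.integral_fst[OF int[of \<xi>]] by simp
  also have "\<dots> = of_real (\<mu> powr (- s) / ln \<mu>)"
    using has_bochner_integral_log_bessel_weight[OF mu assms(2)]
    by (simp add: has_bochner_integral_integral_eq[OF inner] has_bochner_integral_iff \<mu>_def)
  also have "\<mu> powr (- s) / ln \<mu> = log_bessel_symbol s lam \<xi>"
    by (simp add: log_bessel_symbol_def \<mu>_def powr_minus field_simps)
  finally show "fourier (\<lambda>x. of_real (log_bessel_kernel s lam x)) \<xi> = of_real (log_bessel_symbol s lam \<xi>)" .
qed

lemma integrable_polynomial_weight: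
  "integrable lborel (\<lambda>x::'a::euclidean_space. 1 / (1 + norm x) ^ (2 * DIM('a)))"
proof -
  have "integrable lborel (\<lambda>u::real. inverse (1 + u\<^sup>2))"
    using integrable_inverse_1_plus_square by (simp add: set_integrable_def einterval_def)
  then have "integrable lborel (\<lambda>u::real. complex_of_real (inverse (1 + u\<^sup>2)))"
    by (rule integrable_of_real)
  then have "integrable lborel (\<lambda>x::'a. \<Prod>b\<in>Basis. complex_of_real (inverse (1 + (x \<bullet> b)\<^sup>2)))"
    by (intro lborel_integral_prod_inner)
  then show ?thesis
  proof (rule Bochner_Integration.integrable_bound)
    show "(\<lambda>x::'a. 1 / (1 + norm x) ^ (2 * DIM('a))) \<in> borel_measurable lborel" by measurable
    show "AE x in lborel. norm (1 / (1 + norm (x::'a)) ^ (2 * DIM('a)))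
        \<le> norm (\<Prod>b\<in>Basis. complex_of_real (inverse (1 + (x \<bullet> b)\<^sup>2)))"
    proof (intro AE_I2)
      fix x :: 'a
      have "inverse ((1 + norm x)\<^sup>2) \<le> inverse (1 + (x \<bullet> b)\<^sup>2)" if "b \<in> Basis" for b
      proof (rule le_imp_inverse_le)
        have "(x \<bullet> b)\<^sup>2 \<le> (norm x)\<^sup>2"
          using Basis_le_norm[OF that, of x] by (metis abs_le_square_iff abs_norm_cancel)
        then show "1 + (x \<bullet> b)\<^sup>2 \<le> (1 + norm x)\<^sup>2"
          by (simp add: power2_sum add_increasing2)
      qed (simp add: add_pos_nonneg)
      then have "(\<Prod>b\<in>(Basis::'a set). inverse ((1 + norm x)\<^sup>2)) \<le> (\<Prod>b\<in>Basis. inverse (1 + (x \<bullet> b)\<^sup>2))"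
        by (intro prod_mono) auto
      then have "1 / (1 + norm x) ^ (2 * DIM('a)) \<le> (\<Prod>b\<in>Basis. inverse (1 + (x \<bullet> b)\<^sup>2))"
        by (simp add: power_mult inverse_eq_divide power_one_over)
      moreover have "norm (\<Prod>b\<in>Basis. complex_of_real (inverse (1 + (x \<bullet> b)\<^sup>2))) = (\<Prod>b\<in>Basis. inverse (1 + (x \<bullet> b)\<^sup>2))"
        unfolding of_real_prod[symmetric] norm_of_real by (intro abs_of_nonneg prod_nonneg) auto
      ultimately show "norm (1 / (1 + norm x) ^ (2 * DIM('a)))
        \<le> norm (\<Prod>b\<in>Basis. complex_of_real (inverse (1 + (x \<bullet> b)\<^sup>2)))" by simp
    qed
  qed
qed

lemma integrable_schwartz:
  fixes \<phi> :: "'a::euclidean_space \<Rightarrow> complex"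
  assumes "\<phi> \<in> schwartz"
  shows "integrable lborel \<phi>"
proof -
  let ?N = "2 * DIM('a)"
  have d: "\<phi> differentiable (at x)" and b: "\<exists>C. \<forall>x. norm x ^ k * norm (\<phi> x) \<le> C" for x and k :: nat
    using assms unfolding schwartz_def by (auto dest: spec[of _ "[]"])
  have "continuous_on UNIV \<phi>"
    using d by (auto intro!: continuous_at_imp_continuous_on differentiable_imp_continuous_within)
  then have m: "\<phi> \<in> borel_measurable borel" by (rule borel_measurable_continuous_onI)
  from b[of 0] obtain C0 where C0: "norm (\<phi> x) \<le> C0" for x by auto
  from b[of ?N] obtain C1 where C1: "norm x ^ ?N * norm (\<phi> x) \<le> C1" for x by auto
  have "norm (\<phi> x) \<le> 2 ^ ?N * (C0 + C1) * (1 / (1 + norm x) ^ ?N)" for x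
  proof -
    have "(1 + norm x) ^ ?N \<le> (2 * max 1 (norm x)) ^ ?N"
      by (intro power_mono) auto
    also have "\<dots> \<le> 2 ^ ?N * (1 + norm x ^ ?N)"
      by (auto simp: power_mult_distrib max_def)
    finally have "(1 + norm x) ^ ?N * norm (\<phi> x) \<le> 2 ^ ?N * (1 + norm x ^ ?N) * norm (\<phi> x)"
      by (rule mult_right_mono) simp
    also have "\<dots> \<le> 2 ^ ?N * (C0 + C1)"
      using C0[of x] C1[of x] by (simp add: algebra_simps add_mono)
    finally show ?thesis by (simp add: field_simps add_pos_nonneg)
  qed
  then have "norm (\<phi> x) \<le> norm (2 ^ ?N * (C0 + C1) * (1 / (1 + norm x) ^ ?N))" for x
    by (rule order_trans) (simp only: real_norm_def abs_ge_self)
  then show ?thesis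
    using m by (intro Bochner_Integration.integrable_bound[OF integrable_mult_right[OF
          integrable_polynomial_weight, of "2 ^ ?N * (C0 + C1)"]]) auto
qed

lemma fourier_multiplication:
  fixes f g :: "'a::euclidean_space \<Rightarrow> complex"
  assumes f: "integrable lborel f" and g: "integrable lborel g"
  shows "(LINT x|lborel. f x * fourier g x) = (LINT \<xi>|lborel. fourier f \<xi> * g \<xi>)"
proof -
  have [measurable]: "f \<in> borel_measurable borel" "g \<in> borel_measurable borel"
    using borel_measurable_integrable[OF f] borel_measurable_integrable[OF g] by auto
  let ?F = "\<lambda>x \<xi>. f x * g \<xi> * cis (- 2 * pi * (x \<bullet> \<xi>))"
  have i: "integrable (lborel \<Otimes>\<^sub>M lborel) (case_prod ?F)"
  proof (rule lborel_pair.Fubini_integrable)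
    show "case_prod ?F \<in> borel_measurable (lborel \<Otimes>\<^sub>M lborel)" by measurable
    show "integrable lborel (\<lambda>x. LINT y|lborel. norm (case_prod ?F (x, y)))"
      using f by (simp add: norm_mult)
    show "AE x in lborel. integrable lborel (\<lambda>y. case_prod ?F (x, y))"
      by (intro AE_I2 Bochner_Integration.integrable_bound[OF integrable_mult_right[OF g]])
         (auto simp: norm_mult)
  qed
  have "(LINT x|lborel. f x * fourier g x) = (LINT x|lborel. LINT \<xi>|lborel. ?F x \<xi>)"
    unfolding fourier_def
    by (subst integral_mult_right_zero[symmetric]) (simp add: inner_commute mult.assoc)
  also have "\<dots> = (LINT \<xi>|lborel. LINT x|lborel. ?F x \<xi>)"
    using lborel_pair.integral_snd[OF i] lborel_pair.integral_fst[OF i] by simp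
  also have "\<dots> = (LINT \<xi>|lborel. fourier f \<xi> * g \<xi>)"
    unfolding fourier_def
    by (subst integral_mult_left_zero[symmetric]) (simp add: mult_ac)
  finally show ?thesis .
qed

lemma log_bessel_kernel_fourier:
  assumes "lam > 1" "s > 0"
  shows "integrable lborel (log_bessel_kernel s lam :: 'a::euclidean_space \<Rightarrow> real)"
    and "has_fourier_transform (\<lambda>x::'a. of_real (log_bessel_kernel s lam x))
           (\<lambda>\<xi>. of_real (log_bessel_symbol s lam \<xi>))"
proof -
  show K: "integrable lborel (log_bessel_kernel s lam :: 'a \<Rightarrow> real)"
    by (rule log_bessel_kernel_fourier_integral[OF assms])
  have "tempered (\<lambda>x::'a. complex_of_real (log_bessel_kernel s lam x))"
    unfolding tempered_def using K by (intro exI[of _ 0]) simp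
  moreover have "tempered (\<lambda>\<xi>::'a. complex_of_real (log_bessel_symbol s lam \<xi>))"
    unfolding tempered_def
  proof (intro exI)
    let ?N = "2 * DIM('a)" and ?C = "1 / ln lam"
    show "integrable lborel (\<lambda>\<xi>::'a. complex_of_real (log_bessel_symbol s lam \<xi>) / of_real ((1 + norm \<xi>) ^ ?N))"
    proof (rule Bochner_Integration.integrable_bound[OF integrable_mult_right[OF integrable_polynomial_weight, of ?C]])
      show "(\<lambda>\<xi>::'a. complex_of_real (log_bessel_symbol s lam \<xi>) / of_real ((1 + norm \<xi>) ^ ?N)) \<in> borel_measurable lborel"
        unfolding log_bessel_symbol_def by measurable
      have "\<bar>log_bessel_symbol s lam \<xi>\<bar> \<le> ?C" for \<xi> :: 'a
      proof -
        define \<mu> where "\<mu> = lam + 4 * pi\<^sup>2 * (norm \<xi>)\<^sup>2"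
        have mu: "\<mu> \<ge> lam" by (simp add: \<mu>_def)
        have "1 * ln lam \<le> \<mu> powr s * ln \<mu>"
          using mu assms by (intro mult_mono) (auto intro: ge_one_powr_ge_zero)
        then have "1 / (\<mu> powr s * ln \<mu>) \<le> ?C"
          using assms mu by (intro divide_left_mono) auto
        moreover have "1 / (\<mu> powr s * ln \<mu>) \<ge> 0"
          using mu assms by simp
        ultimately show ?thesis
          unfolding log_bessel_symbol_def \<mu>_def[symmetric] by simp
      qed
      then have "\<bar>log_bessel_symbol s lam \<xi>\<bar> / (1 + norm \<xi>) ^ ?N \<le> ?C / (1 + norm \<xi>) ^ ?N" for \<xi> :: 'a
        by (intro divide_right_mono) auto
      then show "AE \<xi> in lborel. norm (complex_of_real (log_bessel_symbol s lam (\<xi>::'a)) / of_real ((1 + norm \<xi>) ^ ?N))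
          \<le> norm (?C * (1 / (1 + norm \<xi>) ^ ?N))"
        using assms by (intro AE_I2) (simp add: norm_divide norm_power abs_mult del: of_real_add of_real_power)
    qed
  qed
  moreover have "(LINT x|lborel. of_real (log_bessel_kernel s lam x) * fourier \<phi> x)
      = (LINT \<xi>|lborel. of_real (log_bessel_symbol s lam \<xi>) * \<phi> \<xi>)" if "\<phi> \<in> schwartz" for \<phi> :: "'a \<Rightarrow> complex"
    using fourier_multiplication[OF integrable_of_real[OF K] integrable_schwartz[OF that]]
    by (simp add: log_bessel_kernel_fourier_integral(2)[OF assms])
  ultimately show "has_fourier_transform (\<lambda>x::'a. of_real (log_bessel_kernel s lam x))
           (\<lambda>\<xi>. of_real (log_bessel_symbol s lam \<xi>))"
    unfolding has_fourier_transform_def by blast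
qed

end

theory Submission
  imports Defs "HOL-Real_Asymp.Real_Asymp"
begin

text \<open>
  Put \<open>\<nu> = n/2\<close> and \<open>\<rho> = |x|^2/4\<close>. Integrating the heat kernel in time first, the kernel
  becomes \<open>(4\<pi>)^(-\<nu>)\<close> times the integral over \<open>\<alpha> > s\<close> of \<open>M(\<alpha> - \<nu>, \<rho>) / \<Gamma>(\<alpha>)\<close>, where
  \<open>M(b, \<rho>)\<close> is the integral of \<open>t^(b-1) e^(-\<lambda>t - \<rho>/t)\<close> over \<open>t > 0\<close> (\<open>macdonald\<close> below). The
  three regimes reflect the three regimes of \<open>M(b, \<rho>)\<close> as \<open>\<rho>\<close> tends to 0: it tends to
  \<open>\<Gamma>(b) \<lambda>^(-b)\<close> for \<open>b > 0\<close>, it is asymptotic to \<open>\<rho>^b \<Gamma>(-b)\<close> for \<open>b < 0\<close> (by the inversion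
  \<open>t \<mapsto> \<rho>/t\<close>), and for small \<open>b > 0\<close> it has the size of the smaller of \<open>1/b\<close> and \<open>ln (1/\<rho>)\<close>.
  All estimates of \<open>M\<close> come from comparing \<open>e^(-z)\<close> and \<open>1 - e^(-z)\<close> with powers of \<open>z\<close>, which
  turns the integrals into values of the Gamma function.

  Write \<open>L = ln (1/|x|^2)\<close>, so that \<open>\<rho> = e^(-L)/4\<close> and \<open>x \<rightarrow> 0\<close> means \<open>L \<rightarrow> \<infinity>\<close>.

  For \<open>\<nu> < s\<close> only \<open>b > 0\<close> occurs, and \<open>\<Gamma>(\<alpha>-\<nu>)/\<Gamma>(\<alpha>) \<lambda>^(\<nu>-\<alpha>)\<close> is an integrable majorant because
  a Beta function decreases in its arguments; dominated convergence gives the limit.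

  For \<open>\<nu> > s\<close> the factor \<open>\<rho>^(\<alpha>-\<nu>)\<close> is a constant power times \<open>e^(L(\<nu>-\<alpha>))\<close>, so the mass sits at
  \<open>\<alpha> = s\<close> on the scale \<open>1/L\<close>. With \<open>\<alpha> = s + q/L\<close> the integral becomes \<open>e^(L(\<nu>-s))/L\<close> times an
  integral that tends to a multiple of that of \<open>e^(-q)\<close>.

  For \<open>\<nu> = s\<close> the integrand behaves like \<open>1/(\<Gamma>(\<nu>) (\<alpha>-\<nu>))\<close> for \<open>1/L < \<alpha> - \<nu> < 1\<close> and is harmless
  elsewhere, whence the growth \<open>ln L\<close>. The substitution \<open>\<alpha> = \<nu> + L^(-y)\<close> extracts the factor
  \<open>ln L\<close>, and what remains converges to the integral of \<open>1/\<Gamma>(\<nu>)\<close> over \<open>0 < y < 1\<close>.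

  The constant in the first case is that of the Riesz potential because the integrals of
  \<open>t^(s-1) p_t(x)\<close> and of \<open>t^(s-1) e^(-4\<pi>^2 t |\<xi>|^2)\<close> over \<open>t > 0\<close> are \<open>\<Gamma>(s)\<close> times
  \<open>c |x|^(2s-n)\<close> and \<open>\<Gamma>(s)\<close> times \<open>(4\<pi>^2|\<xi>|^2)^(-s)\<close>: both sides of the duality formula that
  defines the distributional transform are time integrals of the duality formula for the heat
  kernel. The exchange of integrals uses that transforms of Schwartz functions are integrable,
  which follows from the rule for the transform of a derivative. That no other constant
  works is seen by testing against a Gaussian, which has to be shown to be a Schwartz function.
\<close>


section \<open>Elementary tools\<close>

lemma exp_minus_le_powr:
  fixes z \<theta> :: real
  assumes "z > 0" "\<theta> > 0"
  shows "exp (- z) \<le> \<theta> powr \<theta> * z powr (- \<theta>)"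
proof -
  have "ln (z / \<theta>) \<le> z / \<theta> - 1"
    using assms by (intro ln_le_minus_one) simp
  then have "\<theta> * (ln z - ln \<theta>) \<le> \<theta> * (z / \<theta> - 1)"
    using assms by (intro mult_left_mono) (auto simp: ln_div)
  also have "\<dots> \<le> z"
    using assms by (simp add: algebra_simps)
  finally have "- z \<le> \<theta> * ln \<theta> + (- \<theta>) * ln z"
    by (simp add: algebra_simps)
  then have "exp (- z) \<le> exp (\<theta> * ln \<theta> + (- \<theta>) * ln z)"
    by (simp only: exp_le_cancel_iff)
  then show ?thesis
    using assms by (simp add: powr_def flip: exp_add)
qed

lemma one_minus_exp_le_powr:
  fixes z \<theta> :: real
  assumes "z \<ge> 0" "0 < \<theta>" "\<theta> \<le> 1"
  shows "1 - exp (- z) \<le> z powr \<theta>"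
proof (cases "z \<le> 1")
  case True
  have "1 - exp (- z) \<le> z powr 1"
    using exp_ge_add_one_self[of "- z"] assms by simp
  also have "\<dots> \<le> z powr \<theta>"
    using True assms by (intro powr_mono') auto
  finally show ?thesis .
next
  case False
  then have "1 \<le> z powr \<theta>"
    using assms by (intro ge_one_powr_ge_zero) auto
  then show ?thesis
    using exp_gt_zero[of "- z"] by linarith
qed

text \<open>
  The change of variables for absolutely integrable functions, in a form that transports
  integrability and value together between Bochner integrals for Borel functions.
\<close>

lemma has_bochner_integral_change_of_variables:
  fixes f g g' :: "real \<Rightarrow> real"
  assumes S: "S \<in> sets borel" and T: "g ` S \<in> sets borel"
    and der: "\<And>x. x \<in> S \<Longrightarrow> (g has_field_derivative g' x) (at x within S)"
    and inj: "inj_on g S"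
    and [measurable]: "f \<in> borel_measurable borel" "g \<in> borel_measurable borel" "g' \<in> borel_measurable borel"
  shows "has_bochner_integral lborel (\<lambda>x. indicator S x * (\<bar>g' x\<bar> * f (g x))) b \<longleftrightarrow>
         has_bochner_integral lborel (\<lambda>y. indicator (g ` S) y * f y) b"
proof -
  have *: "(h absolutely_integrable_on A \<and> integral A h = b) \<longleftrightarrow>
      has_bochner_integral lborel (\<lambda>x. indicator A x * h x) b"
    if [measurable]: "A \<in> sets borel" "h \<in> borel_measurable borel" for A and h :: "real \<Rightarrow> real"
  proof -
    have "h absolutely_integrable_on A \<longleftrightarrow> integrable lborel (\<lambda>x. indicator A x * h x)"
      unfolding set_integrable_def by (simp add: integrable_completion)
    moreover have "integral A h = (LINT x|lborel. indicator A x * h x)"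
      if "h absolutely_integrable_on A"
      using set_lebesgue_integral_eq_integral(2)[OF that]
      unfolding set_lebesgue_integral_def by (simp add: integral_completion)
    ultimately show ?thesis
      by (auto simp: has_bochner_integral_iff)
  qed
  have "S \<in> sets lebesgue" using S by simp
  from has_absolute_integral_change_of_variables_1'[OF this der inj, of f b]
  show ?thesis
    using S T by (simp add: *)
qed

section \<open>The Macdonald integral\<close>

definition macdonald_integrand :: "real \<Rightarrow> real \<Rightarrow> real \<Rightarrow> real \<Rightarrow> real" where
  "macdonald_integrand b \<mu> \<rho> t = indicator {0<..} t * (exp (- \<mu> * t - \<rho> / t) * t powr (b - 1))"

text \<open>
  For positive \<open>\<mu>\<close> and \<open>\<rho>\<close> this is \<open>2 (\<rho>/\<mu>)^(b/2) K_b(2 sqrt (\<mu>\<rho>))\<close> with the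
  modified Bessel function \<open>K_b\<close>. At \<open>\<rho> = 0\<close> it degenerates to Euler's integral for
  \<open>\<Gamma>(b) \<mu>^(-b)\<close>, and letting \<open>\<mu> = 0\<close> gives the time integrals of the Riesz kernel.
\<close>

definition macdonald :: "real \<Rightarrow> real \<Rightarrow> real \<Rightarrow> real" where
  "macdonald b \<mu> \<rho> = (LINT t|lborel. macdonald_integrand b \<mu> \<rho> t)"

lemma macdonald_integrand_measurable [measurable (raw)]:
  assumes [measurable]: "f \<in> borel_measurable M" "g \<in> borel_measurable M" "h \<in> borel_measurable M" "k \<in> borel_measurable M"
  shows "(\<lambda>x. macdonald_integrand (f x) (g x) (h x) (k x)) \<in> borel_measurable M"
  unfolding macdonald_integrand_def by measurable

lemma macdonald_measurable [measurable (raw)]: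
  assumes [measurable]: "f \<in> borel_measurable M" "g \<in> borel_measurable M" "h \<in> borel_measurable M"
  shows "(\<lambda>x. macdonald (f x) (g x) (h x)) \<in> borel_measurable M"
  unfolding macdonald_def by measurable

lemma macdonald_integrand_nonneg: "macdonald_integrand b \<mu> \<rho> t \<ge> 0"
  by (simp add: macdonald_integrand_def)

lemma macdonald_nonneg: "macdonald b \<mu> \<rho> \<ge> 0"
  unfolding macdonald_def by (intro Bochner_Integration.integral_nonneg) (simp add: macdonald_integrand_nonneg)

lemma has_bochner_integral_macdonald_0:
  assumes "\<mu> > 0" "b > 0"
  shows "has_bochner_integral lborel (macdonald_integrand b \<mu> 0) (Gamma b * \<mu> powr (- b))"
  using has_bochner_integral_Gamma[OF assms] by (simp add: macdonald_integrand_def[abs_def])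

lemma macdonald_0:
  assumes "\<mu> > 0" "b > 0"
  shows "macdonald b \<mu> 0 = Gamma b * \<mu> powr (- b)"
  using has_bochner_integral_macdonald_0[OF assms] by (simp add: macdonald_def has_bochner_integral_iff)

text \<open>
  Spending a factor \<open>(\<rho>/t)^(-\<theta>)\<close> of the decay of \<open>exp (-\<rho>/t)\<close> raises the exponent of
  \<open>t\<close> by \<open>\<theta>\<close>. This makes every exponent \<open>b\<close> integrable at 0, at the price \<open>\<rho>^(-\<theta>)\<close>.
\<close>

lemma macdonald_integrand_le_shift:
  assumes "\<rho> > 0" "\<theta> > 0"
  shows "macdonald_integrand b \<mu> \<rho> t \<le> \<theta> powr \<theta> * \<rho> powr (- \<theta>) * macdonald_integrand (b + \<theta>) \<mu> 0 t"
proof (cases "t > 0")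
  case True
  have "exp (- (\<rho> / t)) \<le> \<theta> powr \<theta> * (\<rho> / t) powr (- \<theta>)"
    using assms True by (intro exp_minus_le_powr) auto
  also have "(\<rho> / t) powr (- \<theta>) = \<rho> powr (- \<theta>) * t powr \<theta>"
    using assms True by (simp add: powr_divide powr_minus field_simps)
  finally have "exp (- (\<rho> / t)) * (exp (- \<mu> * t) * t powr (b - 1))
      \<le> \<theta> powr \<theta> * (\<rho> powr (- \<theta>) * t powr \<theta>) * (exp (- \<mu> * t) * t powr (b - 1))"
    by (intro mult_right_mono) auto
  moreover have "exp (- \<mu> * t - \<rho> / t) = exp (- (\<rho> / t)) * exp (- \<mu> * t)"
    by (simp flip: exp_add)
  moreover have "t powr (b + \<theta> - 1) = t powr \<theta> * t powr (b - 1)"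
    by (simp flip: powr_add add: algebra_simps)
  ultimately show ?thesis
    using True by (simp add: macdonald_integrand_def mult_ac)
qed (simp add: macdonald_integrand_def)

lemma macdonald_integrand_mono:
  assumes "\<rho> \<ge> 0"
  shows "macdonald_integrand b \<mu> \<rho> t \<le> macdonald_integrand b \<mu> 0 t"
  using assms by (auto simp: macdonald_integrand_def indicator_def intro!: mult_right_mono)

lemma integrable_macdonald_integrand:
  assumes "\<mu> > 0" "\<rho> > 0 \<or> \<rho> = 0 \<and> b > 0"
  shows "integrable lborel (macdonald_integrand b \<mu> \<rho>)"
proof (cases "\<rho> = 0")
  case True
  with assms have "b > 0" by simp
  then show ?thesis
    using has_bochner_integral_macdonald_0[OF assms(1)] True by (simp add: has_bochner_integral_iff)
next
  case False
  with assms have \<rho>: "\<rho> > 0" by simp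
  \<comment> \<open>any shift that makes the exponent positive will do\<close>
  define \<theta> where "\<theta> = \<bar>b\<bar> + 1"
  have \<theta>: "\<theta> > 0" "b + \<theta> > 0" by (auto simp: \<theta>_def)
  have "integrable lborel (\<lambda>t. \<theta> powr \<theta> * \<rho> powr (- \<theta>) * macdonald_integrand (b + \<theta>) \<mu> 0 t)"
    using has_bochner_integral_macdonald_0[OF assms(1) \<theta>(2)] by (simp add: has_bochner_integral_iff)
  then show ?thesis
  proof (rule Bochner_Integration.integrable_bound)
    show "AE t in lborel. norm (macdonald_integrand b \<mu> \<rho> t)
        \<le> norm (\<theta> powr \<theta> * \<rho> powr (- \<theta>) * macdonald_integrand (b + \<theta>) \<mu> 0 t)"
      using macdonald_integrand_le_shift[OF \<rho> \<theta>(1), of b \<mu>]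
      by (auto simp: macdonald_integrand_nonneg abs_mult intro!: AE_I2)
  qed measurable
qed

lemma macdonald_le_shift:
  assumes "\<mu> > 0" "\<rho> > 0" "\<theta> > 0" "b + \<theta> > 0"
  shows "macdonald b \<mu> \<rho> \<le> \<theta> powr \<theta> * \<rho> powr (- \<theta>) * (Gamma (b + \<theta>) * \<mu> powr (- (b + \<theta>)))"
proof -
  have "macdonald b \<mu> \<rho> \<le> (LINT t|lborel. \<theta> powr \<theta> * \<rho> powr (- \<theta>) * macdonald_integrand (b + \<theta>) \<mu> 0 t)"
    unfolding macdonald_def using assms
    by (intro integral_mono integrable_mult_right integrable_macdonald_integrand macdonald_integrand_le_shift) auto
  also have "\<dots> = \<theta> powr \<theta> * \<rho> powr (- \<theta>) * macdonald (b + \<theta>) \<mu> 0"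
    by (simp add: macdonald_def)
  finally show ?thesis using assms by (simp add: macdonald_0)
qed

lemma macdonald_le_Gamma:
  assumes "\<mu> > 0" "\<rho> \<ge> 0" "b > 0"
  shows "macdonald b \<mu> \<rho> \<le> Gamma b * \<mu> powr (- b)"
  unfolding macdonald_0[OF assms(1,3), symmetric] macdonald_def using assms
  by (intro integral_mono integrable_macdonald_integrand macdonald_integrand_mono) auto

text \<open>
  The error of replacing \<open>exp (-\<rho>/t)\<close> by 1 is at most \<open>(\<rho>/t)^\<theta>\<close>, which lowers the exponent
  of \<open>t\<close> by \<open>\<theta>\<close> and leaves another Gamma integral.
\<close>

lemma macdonald_ge_Gamma:
  assumes "\<mu> > 0" "\<rho> \<ge> 0" "0 < \<theta>" "\<theta> \<le> 1" "\<theta> < b"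
  shows "Gamma b * \<mu> powr (- b) - \<rho> powr \<theta> * (Gamma (b - \<theta>) * \<mu> powr (- (b - \<theta>))) \<le> macdonald b \<mu> \<rho>"
proof -
  have "Gamma b * \<mu> powr (- b) - \<rho> powr \<theta> * (Gamma (b - \<theta>) * \<mu> powr (- (b - \<theta>)))
     = macdonald b \<mu> 0 - \<rho> powr \<theta> * macdonald (b - \<theta>) \<mu> 0"
    using assms by (simp add: macdonald_0)
  also have "\<dots> = (LINT t|lborel. macdonald_integrand b \<mu> 0 t - \<rho> powr \<theta> * macdonald_integrand (b - \<theta>) \<mu> 0 t)"
    using assms by (simp add: macdonald_def integrable_macdonald_integrand)
  also have "\<dots> \<le> macdonald b \<mu> \<rho>"
    unfolding macdonald_def
  proof (rule integral_mono)
    show "integrable lborel (\<lambda>t. macdonald_integrand b \<mu> 0 t - \<rho> powr \<theta> * macdonald_integrand (b - \<theta>) \<mu> 0 t)"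
      using assms
      by (intro Bochner_Integration.integrable_diff integrable_mult_right integrable_macdonald_integrand) auto
    show "integrable lborel (macdonald_integrand b \<mu> \<rho>)"
      using assms by (intro integrable_macdonald_integrand) auto
    show "macdonald_integrand b \<mu> 0 t - \<rho> powr \<theta> * macdonald_integrand (b - \<theta>) \<mu> 0 t \<le> macdonald_integrand b \<mu> \<rho> t" for t
    proof (cases "t > 0")
      case True
      have "1 - exp (- (\<rho> / t)) \<le> (\<rho> / t) powr \<theta>"
        using assms True by (intro one_minus_exp_le_powr) auto
      also have "\<dots> = \<rho> powr \<theta> * t powr (- \<theta>)"
        using assms True by (simp add: powr_divide powr_minus field_simps)
      finally have "(1 - exp (- (\<rho> / t))) * (exp (- \<mu> * t) * t powr (b - 1))
          \<le> (\<rho> powr \<theta> * t powr (- \<theta>)) * (exp (- \<mu> * t) * t powr (b - 1))"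
        by (intro mult_right_mono) auto
      moreover have "exp (- \<mu> * t - \<rho> / t) = exp (- (\<rho> / t)) * exp (- \<mu> * t)"
        by (simp flip: exp_add)
      moreover have "t powr (b - \<theta> - 1) = t powr (- \<theta>) * t powr (b - 1)"
        by (simp flip: powr_add add: algebra_simps)
      ultimately show ?thesis
        using True by (simp add: macdonald_integrand_def algebra_simps)
    qed (simp add: macdonald_integrand_def)
  qed
  finally show ?thesis .
qed

text \<open>
  The substitution \<open>t \<mapsto> \<rho>/t\<close> exchanges the two exponential factors. It is the symmetry
  \<open>K_b = K_(-b)\<close>, and it reduces negative \<open>b\<close> to positive ones. Stated for all \<open>\<mu>\<close>, since the
  Riesz kernel needs \<open>\<mu> = 0\<close>.
\<close>

lemma has_bochner_integral_macdonald_inversion: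
  assumes "\<rho> > 0"
  shows "has_bochner_integral lborel (macdonald_integrand (- b) 1 (\<mu> * \<rho>)) I \<longleftrightarrow>
         has_bochner_integral lborel (macdonald_integrand b \<mu> \<rho>) (\<rho> powr b * I)"
proof -
  have img: "(\<lambda>t. \<rho> / t) ` {0<..} = {0<..}"
  proof (intro equalityI subsetI)
    fix y :: real assume "y \<in> {0<..}"
    then have "y = \<rho> / (\<rho> / y)" "\<rho> / y \<in> {0<..}" using assms by auto
    then show "y \<in> (\<lambda>t. \<rho> / t) ` {0<..}" by blast
  qed (use assms in auto)
  let ?f = "\<lambda>t. exp (- \<mu> * t - \<rho> / t) * t powr (b - 1)"
  have "has_bochner_integral lborel (\<lambda>t. indicator {0<..} t * (\<bar>- \<rho> / t\<^sup>2\<bar> * ?f (\<rho> / t))) (\<rho> powr b * I) \<longleftrightarrow>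
        has_bochner_integral lborel (\<lambda>t. indicator ((\<lambda>t. \<rho> / t) ` {0<..}) t * ?f t) (\<rho> powr b * I)"
  proof (rule has_bochner_integral_change_of_variables)
    show "((\<lambda>t. \<rho> / t) has_field_derivative - \<rho> / x\<^sup>2) (at x within {0<..})" if "x \<in> {0<..}" for x
      using that by (auto intro!: derivative_eq_intros simp: power2_eq_square)
    show "inj_on (\<lambda>t. \<rho> / t) {0<..}"
      using assms by (auto intro!: inj_onI)
  qed (simp_all add: img)
  also have "(\<lambda>t. indicator {0<..} t * (\<bar>- \<rho> / t\<^sup>2\<bar> * ?f (\<rho> / t)))
      = (\<lambda>t. \<rho> powr b * macdonald_integrand (- b) 1 (\<mu> * \<rho>) t)"
  proof
    fix t
    show "indicator {0<..} t * (\<bar>- \<rho> / t\<^sup>2\<bar> * ?f (\<rho> / t)) = \<rho> powr b * macdonald_integrand (- b) 1 (\<mu> * \<rho>) t"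
    proof (cases "t > 0")
      case True
      have 1: "\<bar>- \<rho> / t\<^sup>2\<bar> * (\<rho> / t) powr (b - 1) = \<rho> powr b * t powr (- b - 1)"
        using True assms by (simp add: powr_divide powr_diff powr_minus power2_eq_square field_simps)
      have 2: "exp (- \<mu> * (\<rho> / t) - \<rho> / (\<rho> / t)) = exp (- 1 * t - \<mu> * \<rho> / t)"
        using assms True by simp
      have "\<bar>- \<rho> / t\<^sup>2\<bar> * ?f (\<rho> / t)
          = exp (- 1 * t - \<mu> * \<rho> / t) * (\<rho> powr b * t powr (- b - 1))"
        unfolding 2 1[symmetric] by (simp only: mult_ac)
      then show ?thesis
        using True by (simp add: macdonald_integrand_def)
    qed (simp add: macdonald_integrand_def)
  qed
  also have "has_bochner_integral lborel (\<lambda>t. \<rho> powr b * macdonald_integrand (- b) 1 (\<mu> * \<rho>) t) (\<rho> powr b * I)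
      \<longleftrightarrow> has_bochner_integral lborel (macdonald_integrand (- b) 1 (\<mu> * \<rho>)) I"
    using assms by (simp add: has_bochner_integral_iff)
  finally show ?thesis
    by (simp add: img macdonald_integrand_def[abs_def])
qed

lemma macdonald_inversion:
  assumes "\<mu> > 0" "\<rho> > 0"
  shows "macdonald b \<mu> \<rho> = \<rho> powr b * macdonald (- b) 1 (\<mu> * \<rho>)"
proof -
  have "has_bochner_integral lborel (macdonald_integrand (- b) 1 (\<mu> * \<rho>)) (macdonald (- b) 1 (\<mu> * \<rho>))"
    unfolding macdonald_def using assms
    by (intro has_bochner_integral_integrable integrable_macdonald_integrand) simp_all
  then show ?thesis
    unfolding has_bochner_integral_macdonald_inversion[OF assms(2)]
    by (simp only: macdonald_def[of b] has_bochner_integral_integral_eq)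
qed


text \<open>
  Joint continuity at \<open>\<rho> = 0\<close>: the exponent may move with \<open>\<rho>\<close>, as it does after the
  rescaling \<open>\<alpha> = s + q/L\<close>.
\<close>

lemma tendsto_macdonald:
  assumes b: "(b \<longlongrightarrow> b0) F" "b0 > 0" and \<rho>: "(\<rho> \<longlongrightarrow> 0) F" "\<forall>\<^sub>F x in F. \<rho> x \<ge> 0" and \<mu>: "\<mu> > 0"
  shows "((\<lambda>x. macdonald (b x) \<mu> (\<rho> x)) \<longlongrightarrow> Gamma b0 * \<mu> powr (- b0)) F"
proof -
  \<comment> \<open>a fixed shift that stays below the moving exponent and keeps the error term bounded\<close>
  define \<theta> where "\<theta> = min 1 (b0 / 2)"
  have \<theta>: "0 < \<theta>" "\<theta> \<le> 1" "\<theta> < b0" using assms by (auto simp: \<theta>_def)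
  have nonpos: "z \<notin> \<int>\<^sub>\<le>\<^sub>0" if "z > 0" for z :: real using that by auto
  have ev: "\<forall>\<^sub>F x in F. b x > \<theta>" using b \<theta> by (intro order_tendstoD(1)[OF b(1)]) auto
  have pw: "((\<lambda>x. \<rho> x powr \<theta>) \<longlongrightarrow> 0 powr \<theta>) F"
    using \<theta> \<rho> by (intro tendsto_powr') auto
  show ?thesis
  proof (rule tendsto_sandwich)
    show "\<forall>\<^sub>F x in F. Gamma (b x) * \<mu> powr (- b x) - \<rho> x powr \<theta> * (Gamma (b x - \<theta>) * \<mu> powr (- (b x - \<theta>))) \<le> macdonald (b x) \<mu> (\<rho> x)"
      using ev \<rho>(2) by eventually_elim (rule macdonald_ge_Gamma; use \<theta> \<mu> in simp)
    show "\<forall>\<^sub>F x in F. macdonald (b x) \<mu> (\<rho> x) \<le> Gamma (b x) * \<mu> powr (- b x)"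
      using ev \<rho>(2) by eventually_elim (rule macdonald_le_Gamma; use \<theta> \<mu> in simp)
    show "((\<lambda>x. Gamma (b x) * \<mu> powr (- b x)) \<longlongrightarrow> Gamma b0 * \<mu> powr (- b0)) F"
      using b \<mu> by (intro tendsto_intros nonpos) auto
    have "((\<lambda>x. Gamma (b x) * \<mu> powr (- b x) - \<rho> x powr \<theta> * (Gamma (b x - \<theta>) * \<mu> powr (- (b x - \<theta>))))
       \<longlongrightarrow> Gamma b0 * \<mu> powr (- b0) - 0 powr \<theta> * (Gamma (b0 - \<theta>) * \<mu> powr (- (b0 - \<theta>)))) F"
      using b \<mu> \<theta> by (intro tendsto_intros pw nonpos) auto
    then show "((\<lambda>x. Gamma (b x) * \<mu> powr (- b x) - \<rho> x powr \<theta> * (Gamma (b x - \<theta>) * \<mu> powr (- (b x - \<theta>))))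
       \<longlongrightarrow> Gamma b0 * \<mu> powr (- b0)) F"
      by simp
  qed
qed

section \<open>The kernel as an integral over orders\<close>

lemma rGamma_pos: "x > (0::real) \<Longrightarrow> rGamma x > 0"
  using Gamma_real_pos[of x] by (simp add: Gamma_def)

lemma measurable_Gamma [measurable]: "(Gamma :: real \<Rightarrow> real) \<in> borel_measurable borel"
  unfolding Gamma_def[abs_def] by measurable

text \<open>
  \<open>\<Gamma>(\<alpha>-\<sigma>)/\<Gamma>(\<alpha>) \<mu>^(\<sigma>-\<alpha>)\<close>, which for \<open>\<sigma> = n/2\<close> is the integrand of the limit in the case
  \<open>n < 2s\<close>. For other \<open>\<sigma>\<close> it serves as a majorant.
\<close>

definition Gamma_quotient :: "real \<Rightarrow> real \<Rightarrow> real \<Rightarrow> real" where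
  "Gamma_quotient \<sigma> \<mu> \<alpha> = rGamma \<alpha> * (Gamma (\<alpha> - \<sigma>) * \<mu> powr (- (\<alpha> - \<sigma>)))"

lemma Gamma_quotient_measurable [measurable]: "Gamma_quotient \<sigma> \<mu> \<in> borel_measurable borel"
  unfolding Gamma_quotient_def[abs_def] by measurable

lemma Gamma_quotient_nonneg: "0 < \<sigma> \<Longrightarrow> \<sigma> < \<alpha> \<Longrightarrow> 0 \<le> Gamma_quotient \<sigma> \<mu> \<alpha>"
  using rGamma_pos[of \<alpha>] Gamma_real_pos[of "\<alpha> - \<sigma>"] by (auto simp: Gamma_quotient_def)

text \<open>
  \<open>\<Gamma>(\<alpha>-\<sigma>)/\<Gamma>(\<alpha>)\<close> is \<open>Beta (\<alpha>-\<sigma>) \<sigma> / \<Gamma>(\<sigma>)\<close> and hence decreases in \<open>\<alpha>\<close>; the exponential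
  \<open>\<mu>^(-\<alpha>)\<close> with \<open>\<mu> > 1\<close> does the rest.
\<close>

lemma integrable_Gamma_quotient:
  assumes "\<mu> > 1" "0 < \<sigma>" "\<sigma> < a"
  shows "integrable lborel (\<lambda>\<alpha>. indicator {a<..} \<alpha> * Gamma_quotient \<sigma> \<mu> \<alpha>)"
proof -
  define C where "C = Beta (a - \<sigma>) \<sigma> * rGamma \<sigma> * \<mu> powr \<sigma>"
  have "integrable lborel (\<lambda>\<alpha>. C * (indicator {a<..} \<alpha> * \<mu> powr (- \<alpha>)))"
    using has_bochner_integral_powr_tail[OF assms(1), of a] by (simp add: has_bochner_integral_iff)
  then show ?thesis
  proof (rule Bochner_Integration.integrable_bound)
    show "AE \<alpha> in lborel. norm (indicator {a<..} \<alpha> * Gamma_quotient \<sigma> \<mu> \<alpha>)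
       \<le> norm (C * (indicator {a<..} \<alpha> * \<mu> powr (- \<alpha>)))"
    proof (intro AE_I2)
      fix \<alpha> :: real
      show "norm (indicator {a<..} \<alpha> * Gamma_quotient \<sigma> \<mu> \<alpha>)
       \<le> norm (C * (indicator {a<..} \<alpha> * \<mu> powr (- \<alpha>)))"
      proof (cases "\<alpha> > a")
        case True
        have pos: "rGamma \<sigma> > 0" using assms by (intro rGamma_pos) auto
        have "Gamma (\<alpha> - \<sigma>) * rGamma \<alpha> = Beta (\<alpha> - \<sigma>) \<sigma> * rGamma \<sigma>"
          using pos by (simp add: Beta_altdef Gamma_def)
        also have "\<dots> \<le> Beta (a - \<sigma>) \<sigma> * rGamma \<sigma>"
          using assms True pos by (intro mult_right_mono Beta_real_mono) auto
        finally have "Gamma (\<alpha> - \<sigma>) * rGamma \<alpha> * (\<mu> powr \<sigma> * \<mu> powr (- \<alpha>)) \<le> Beta (a - \<sigma>) \<sigma> * rGamma \<sigma> * (\<mu> powr \<sigma> * \<mu> powr (- \<alpha>))"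
          by (intro mult_right_mono) auto
        moreover have "\<mu> powr (- (\<alpha> - \<sigma>)) = \<mu> powr \<sigma> * \<mu> powr (- \<alpha>)"
          by (simp flip: powr_add)
        ultimately have "Gamma_quotient \<sigma> \<mu> \<alpha> \<le> C * \<mu> powr (- \<alpha>)"
          by (simp add: Gamma_quotient_def C_def mult_ac)
        then show ?thesis
          using True Gamma_quotient_nonneg[of \<sigma> \<alpha> \<mu>] assms by simp
      qed simp
    qed
  qed measurable
qed

text \<open>
  Up to the factor \<open>(4\<pi>)^(-\<nu>)\<close>, the Bessel kernel of order \<open>2\<alpha>\<close> in dimension \<open>2\<nu>\<close> as a
  function of \<open>\<rho> = |x|^2/4\<close>; the logarithmic kernel is its integral over \<open>\<alpha> > s\<close>.
\<close>

definition bessel_density :: "real \<Rightarrow> real \<Rightarrow> real \<Rightarrow> real \<Rightarrow> real" where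
  "bessel_density \<nu> \<mu> \<rho> \<alpha> = rGamma \<alpha> * macdonald (\<alpha> - \<nu>) \<mu> \<rho>"

definition log_bessel_profile :: "real \<Rightarrow> real \<Rightarrow> real \<Rightarrow> real \<Rightarrow> real" where
  "log_bessel_profile \<nu> s \<mu> \<rho> = (LINT \<alpha>|lborel. indicator {s<..} \<alpha> * bessel_density \<nu> \<mu> \<rho> \<alpha>)"

lemma bessel_density_measurable [measurable]: "bessel_density \<nu> \<mu> \<rho> \<in> borel_measurable borel"
  unfolding bessel_density_def[abs_def] by measurable

lemma bessel_density_nonneg: "\<alpha> > 0 \<Longrightarrow> bessel_density \<nu> \<mu> \<rho> \<alpha> \<ge> 0"
  using rGamma_pos[of \<alpha>] by (simp add: bessel_density_def macdonald_nonneg)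

lemma log_bessel_kernel_eq_profile:
  fixes x :: "'a::euclidean_space"
  shows "log_bessel_kernel s lam x =
    (4 * pi) powr (- real DIM('a) / 2) * log_bessel_profile (real DIM('a) / 2) s lam ((norm x)\<^sup>2 / 4)"
proof -
  let ?\<nu> = "real DIM('a) / 2" and ?\<rho> = "(norm x)\<^sup>2 / 4"
  have "indicator {0<..} t *\<^sub>R (exp (- lam * t) * t powr (\<alpha> - 1) * heat_kernel t x)
      = (4 * pi) powr (- ?\<nu>) * macdonald_integrand (\<alpha> - ?\<nu>) lam ?\<rho> t" for \<alpha> t
  proof (cases "t > 0")
    case True
    have 1: "t powr (\<alpha> - ?\<nu> - 1) = t powr (\<alpha> - 1) * t powr (- ?\<nu>)"
      by (simp flip: powr_add add: algebra_simps)
    have 2: "exp (- lam * t - ?\<rho> / t) = exp (- lam * t) * exp (- (norm x)\<^sup>2 / (4 * t))"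
      by (simp flip: exp_add)
    have "heat_kernel t x = (4 * pi) powr (- ?\<nu>) * t powr (- ?\<nu>) * exp (- (norm x)\<^sup>2 / (4 * t))"
      using True by (simp add: heat_kernel_def powr_mult)
    then show ?thesis
      unfolding macdonald_integrand_def 1 2 using True by (simp add: mult_ac)
  qed (simp add: macdonald_integrand_def)
  then have inner: "(LBINT t:{0<..}. exp (- lam * t) * t powr (\<alpha> - 1) * heat_kernel t x)
      = (4 * pi) powr (- ?\<nu>) * macdonald (\<alpha> - ?\<nu>) lam ?\<rho>" for \<alpha>
    unfolding set_lebesgue_integral_def macdonald_def by simp
  have "indicator {s<..} \<alpha> *\<^sub>R (1 / Gamma \<alpha> * ((4 * pi) powr (- ?\<nu>) * macdonald (\<alpha> - ?\<nu>) lam ?\<rho>))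
      = (4 * pi) powr (- ?\<nu>) * (indicator {s<..} \<alpha> * bessel_density ?\<nu> lam ?\<rho> \<alpha>)" for \<alpha>
  proof -
    have "1 / Gamma \<alpha> = rGamma \<alpha>"
      by (simp add: Gamma_def inverse_eq_divide)
    then show ?thesis
      by (simp only: bessel_density_def real_scaleR_def mult_ac)
  qed
  then show ?thesis
    unfolding log_bessel_kernel_def inner log_bessel_profile_def unfolding set_lebesgue_integral_def
    by (simp only: integral_mult_right_zero minus_divide_left)
qed

text \<open>
  The majorant for orders \<open>\<alpha>\<close> below or across \<open>\<nu>\<close>: \<open>\<sigma>\<close> takes over the role of \<open>\<nu>\<close>. Compared
  with \<open>\<rho>^(s-\<nu>)\<close>, the size of the kernel for \<open>s < \<nu>\<close> up to a logarithm, the power \<open>\<rho>^(\<sigma>-\<nu>)\<close> is negligible as soon as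
  \<open>\<sigma> > s\<close>, which disposes of the orders away from \<open>s\<close>.
\<close>

lemma bessel_density_le_shift:
  assumes "\<mu> > 0" "\<rho> > 0" "0 < \<sigma>" "\<sigma> < \<nu>" "\<sigma> < \<alpha>"
  shows "bessel_density \<nu> \<mu> \<rho> \<alpha> \<le> (\<nu> - \<sigma>) powr (\<nu> - \<sigma>) * \<rho> powr (\<sigma> - \<nu>) * Gamma_quotient \<sigma> \<mu> \<alpha>"
proof -
  have "macdonald (\<alpha> - \<nu>) \<mu> \<rho> \<le> (\<nu> - \<sigma>) powr (\<nu> - \<sigma>) * \<rho> powr (\<sigma> - \<nu>) * (Gamma (\<alpha> - \<sigma>) * \<mu> powr (- (\<alpha> - \<sigma>)))"
    using macdonald_le_shift[of \<mu> \<rho> "\<nu> - \<sigma>" "\<alpha> - \<nu>"] assms by simp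
  then have "rGamma \<alpha> * macdonald (\<alpha> - \<nu>) \<mu> \<rho> \<le> rGamma \<alpha> * ((\<nu> - \<sigma>) powr (\<nu> - \<sigma>) * \<rho> powr (\<sigma> - \<nu>) * (Gamma (\<alpha> - \<sigma>) * \<mu> powr (- (\<alpha> - \<sigma>))))"
    using rGamma_pos[of \<alpha>] assms by (intro mult_left_mono) auto
  then show ?thesis by (simp add: bessel_density_def Gamma_quotient_def mult_ac)
qed

lemma bessel_density_le_Gamma_quotient:
  assumes "\<mu> > 0" "\<rho> \<ge> 0" "0 < \<nu>" "\<nu> < \<alpha>"
  shows "bessel_density \<nu> \<mu> \<rho> \<alpha> \<le> Gamma_quotient \<nu> \<mu> \<alpha>"
  unfolding bessel_density_def Gamma_quotient_def
  using rGamma_pos[of \<alpha>] assms by (intro mult_left_mono macdonald_le_Gamma) auto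

lemma integrable_bessel_density:
  assumes "\<mu> > 1" "\<rho> > 0" "s > 0" "\<nu> > 0"
  shows "integrable lborel (\<lambda>\<alpha>. indicator {s<..} \<alpha> * bessel_density \<nu> \<mu> \<rho> \<alpha>)"
proof -
  \<comment> \<open>the shifted majorant with any \<open>\<sigma>\<close> below \<open>s\<close> and \<open>\<nu>\<close> suffices for fixed \<open>\<rho>\<close>\<close>
  define \<sigma> where "\<sigma> = min s \<nu> / 2"
  have \<sigma>: "0 < \<sigma>" "\<sigma> < s" "\<sigma> < \<nu>" using assms by (auto simp: \<sigma>_def)
  have "integrable lborel (\<lambda>\<alpha>. (\<nu> - \<sigma>) powr (\<nu> - \<sigma>) * \<rho> powr (\<sigma> - \<nu>) * (indicator {s<..} \<alpha> * Gamma_quotient \<sigma> \<mu> \<alpha>))"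
    using integrable_Gamma_quotient[OF assms(1) \<sigma>(1,2)] by simp
  then show ?thesis
  proof (rule Bochner_Integration.integrable_bound)
    have "norm (indicator {s<..} \<alpha> * bessel_density \<nu> \<mu> \<rho> \<alpha>)
      \<le> (\<nu> - \<sigma>) powr (\<nu> - \<sigma>) * \<rho> powr (\<sigma> - \<nu>) * (indicator {s<..} \<alpha> * Gamma_quotient \<sigma> \<mu> \<alpha>)" for \<alpha>
      using bessel_density_le_shift[of \<mu> \<rho> \<sigma> \<nu> \<alpha>] bessel_density_nonneg[of \<alpha> \<nu> \<mu> \<rho>] assms \<sigma>
      by (cases "\<alpha> > s") auto
    then show "AE \<alpha> in lborel. norm (indicator {s<..} \<alpha> * bessel_density \<nu> \<mu> \<rho> \<alpha>)
      \<le> norm ((\<nu> - \<sigma>) powr (\<nu> - \<sigma>) * \<rho> powr (\<sigma> - \<nu>) * (indicator {s<..} \<alpha> * Gamma_quotient \<sigma> \<mu> \<alpha>))"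
      unfolding real_norm_def by (intro AE_I2) (rule order_trans[OF _ abs_ge_self])
  qed measurable
qed

lemma log_bessel_profile_nonneg: "s \<ge> 0 \<Longrightarrow> log_bessel_profile \<nu> s \<mu> \<rho> \<ge> 0"
  unfolding log_bessel_profile_def
  by (intro Bochner_Integration.integral_nonneg) (auto simp: indicator_def bessel_density_nonneg)

lemma log_bessel_profile_split:
  assumes "\<mu> > 1" "\<rho> > 0" "0 < s" "s \<le> a" "\<nu> > 0"
  shows "log_bessel_profile \<nu> s \<mu> \<rho> =
    (LINT \<alpha>|lborel. indicator {s<..a} \<alpha> * bessel_density \<nu> \<mu> \<rho> \<alpha>) + log_bessel_profile \<nu> a \<mu> \<rho>"
proof -
  have 1: "integrable lborel (\<lambda>\<alpha>. indicator {s<..} \<alpha> * bessel_density \<nu> \<mu> \<rho> \<alpha>)"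
    "integrable lborel (\<lambda>\<alpha>. indicator {a<..} \<alpha> * bessel_density \<nu> \<mu> \<rho> \<alpha>)"
    using assms by (auto intro!: integrable_bessel_density)
  have eq: "indicator {s<..a} \<alpha> * bessel_density \<nu> \<mu> \<rho> \<alpha>
    = indicator {s<..} \<alpha> * bessel_density \<nu> \<mu> \<rho> \<alpha> - indicator {a<..} \<alpha> * bessel_density \<nu> \<mu> \<rho> \<alpha>" for \<alpha>
    using assms by (auto simp: indicator_def)
  show ?thesis
    unfolding eq log_bessel_profile_def using 1 by simp
qed

lemma log_bessel_profile_le_shift:
  assumes "\<mu> > 1" "\<rho> > 0" "0 < \<sigma>" "\<sigma> < \<nu>" "\<sigma> < a"
  shows "log_bessel_profile \<nu> a \<mu> \<rho> \<le> (\<nu> - \<sigma>) powr (\<nu> - \<sigma>) * \<rho> powr (\<sigma> - \<nu>) *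
     (LINT \<alpha>|lborel. indicator {a<..} \<alpha> * Gamma_quotient \<sigma> \<mu> \<alpha>)"
proof -
  have "indicator {a<..} \<alpha> * bessel_density \<nu> \<mu> \<rho> \<alpha>
      \<le> (\<nu> - \<sigma>) powr (\<nu> - \<sigma>) * \<rho> powr (\<sigma> - \<nu>) * (indicator {a<..} \<alpha> * Gamma_quotient \<sigma> \<mu> \<alpha>)" for \<alpha>
    using bessel_density_le_shift[of \<mu> \<rho> \<sigma> \<nu> \<alpha>] assms by (cases "\<alpha> > a") auto
  then have "log_bessel_profile \<nu> a \<mu> \<rho> \<le> (LINT \<alpha>|lborel. (\<nu> - \<sigma>) powr (\<nu> - \<sigma>) * \<rho> powr (\<sigma> - \<nu>) * (indicator {a<..} \<alpha> * Gamma_quotient \<sigma> \<mu> \<alpha>))"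
    unfolding log_bessel_profile_def using assms
    by (intro integral_mono integrable_bessel_density integrable_mult_right integrable_Gamma_quotient) simp_all
  then show ?thesis by simp
qed

lemma log_bessel_profile_le:
  assumes "\<mu> > 1" "\<rho> > 0" "0 < \<nu>" "\<nu> < a"
  shows "log_bessel_profile \<nu> a \<mu> \<rho> \<le> (LINT \<alpha>|lborel. indicator {a<..} \<alpha> * Gamma_quotient \<nu> \<mu> \<alpha>)"
proof -
  have "indicator {a<..} \<alpha> * bessel_density \<nu> \<mu> \<rho> \<alpha> \<le> indicator {a<..} \<alpha> * Gamma_quotient \<nu> \<mu> \<alpha>" for \<alpha>
    using bessel_density_le_Gamma_quotient[of \<mu> \<rho> \<nu> \<alpha>] assms by (cases "\<alpha> > a") auto
  then show ?thesis
    unfolding log_bessel_profile_def using assms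
    by (intro integral_mono integrable_bessel_density integrable_Gamma_quotient) simp_all
qed

lemma tendsto_exp_minus_div_4: "((\<lambda>L::real. exp (- L) / 4) \<longlongrightarrow> 0) at_top"
  by real_asymp

section \<open>Limits of the radial profile\<close>

lemma log_bessel_profile_limit_supercritical:
  assumes "\<mu> > 1" "0 < \<nu>" "\<nu> < s"
  shows "((\<lambda>L. log_bessel_profile \<nu> s \<mu> (exp (- L) / 4)) \<longlongrightarrow>
    (LINT \<alpha>|lborel. indicator {s<..} \<alpha> * Gamma_quotient \<nu> \<mu> \<alpha>)) at_top"
  unfolding log_bessel_profile_def
proof (rule integral_dominated_convergence_at_top)
  show "integrable lborel (\<lambda>\<alpha>. indicator {s<..} \<alpha> * Gamma_quotient \<nu> \<mu> \<alpha>)"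
    using assms by (intro integrable_Gamma_quotient) auto
  show "\<forall>\<^sub>F L in at_top. AE \<alpha> in lborel. norm (indicator {s<..} \<alpha> * bessel_density \<nu> \<mu> (exp (- L) / 4) \<alpha>)
      \<le> indicator {s<..} \<alpha> * Gamma_quotient \<nu> \<mu> \<alpha>"
    using assms by (intro always_eventually allI AE_I2)
      (auto simp: indicator_def bessel_density_nonneg intro!: bessel_density_le_Gamma_quotient)
  show "AE \<alpha> in lborel. ((\<lambda>L. indicator {s<..} \<alpha> * bessel_density \<nu> \<mu> (exp (- L) / 4) \<alpha>)
      \<longlongrightarrow> indicator {s<..} \<alpha> * Gamma_quotient \<nu> \<mu> \<alpha>) at_top"
  proof (intro AE_I2)
    fix \<alpha> :: real
    show "((\<lambda>L. indicator {s<..} \<alpha> * bessel_density \<nu> \<mu> (exp (- L) / 4) \<alpha>)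
      \<longlongrightarrow> indicator {s<..} \<alpha> * Gamma_quotient \<nu> \<mu> \<alpha>) at_top"
    proof (cases "\<alpha> > s")
      case True
      have "((\<lambda>L. macdonald (\<alpha> - \<nu>) \<mu> (exp (- L) / 4)) \<longlongrightarrow> Gamma (\<alpha> - \<nu>) * \<mu> powr (- (\<alpha> - \<nu>))) at_top"
        using assms True by (intro tendsto_macdonald tendsto_exp_minus_div_4) auto
      then show ?thesis
        unfolding bessel_density_def Gamma_quotient_def by (intro tendsto_mult tendsto_const)
    qed simp
  qed
qed measurable


lemma tendsto_rGamma:
  fixes a :: real
  assumes "(f \<longlongrightarrow> a) F"
  shows "((\<lambda>x. rGamma (f x)) \<longlongrightarrow> rGamma a) F"
  by (rule isCont_tendsto_compose[OF isCont_rGamma[OF continuous_ident] assms])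

lemma continuous_on_Icc_upper_bound:
  fixes f :: "real \<Rightarrow> real"
  assumes "continuous_on {a..b} f"
  obtains C where "C \<ge> 1" "\<And>x. x \<in> {a..b} \<Longrightarrow> f x \<le> C"
proof -
  have "bounded (f ` {a..b})"
    using assms by (intro compact_imp_bounded compact_continuous_image) auto
  then obtain B where "\<And>x. x \<in> {a..b} \<Longrightarrow> norm (f x) \<le> B"
    unfolding bounded_iff by blast
  then have "\<And>x. x \<in> {a..b} \<Longrightarrow> f x \<le> max B 1" by fastforce
  then show ?thesis using that[of "max B 1"] by simp
qed

lemma has_bochner_integral_exp_minus:
  "has_bochner_integral lborel (\<lambda>q::real. indicator {0<..} q * exp (- q)) 1"
proof -
  have "indicator {0<..} q * (exp (- 1 * q) * q powr (1 - 1)) = indicator {0<..} q * exp (- q)" for q :: real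
    by (simp add: indicator_def)
  with has_bochner_integral_Gamma[of 1 1] show ?thesis by (simp only:) simp
qed

text \<open>
  After the inversion the singular factor \<open>e^(L(\<nu>-\<alpha>))\<close> stands alone, and the remaining factor
  has a limit as \<open>L\<close> tends to infinity, locally uniformly in \<open>\<alpha> < \<nu>\<close>.
\<close>

lemma bessel_density_inversion:
  assumes "\<mu> > 0"
  shows "bessel_density \<nu> \<mu> (exp (- L) / 4) \<alpha> =
    exp (L * (\<nu> - \<alpha>)) * (rGamma \<alpha> * 4 powr (\<nu> - \<alpha>) * macdonald (\<nu> - \<alpha>) 1 (\<mu> * (exp (- L) / 4)))"
proof -
  have "(exp (- L) / 4) powr (\<alpha> - \<nu>) = exp (L * (\<nu> - \<alpha>)) * 4 powr (\<nu> - \<alpha>)"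
    by (simp add: powr_def ln_div algebra_simps flip: exp_add)
  then show ?thesis
    using macdonald_inversion[OF assms, of "exp (- L) / 4" "\<alpha> - \<nu>"]
    by (simp add: bessel_density_def mult_ac)
qed

text \<open>
  Laplace's method at the end point \<open>\<alpha> = s\<close>: only orders within \<open>O(1/L)\<close> of \<open>s\<close> contribute.
\<close>

lemma log_bessel_profile_limit_subcritical:
  assumes \<mu>: "\<mu> > 1" and s: "0 < s" "s < \<nu>"
  shows "((\<lambda>L. log_bessel_profile \<nu> s \<mu> (exp (- L) / 4) * (L * exp (- (L * (\<nu> - s))))) \<longlongrightarrow>
    rGamma s * 4 powr (\<nu> - s) * Gamma (\<nu> - s)) at_top"
proof -
  \<comment> \<open>orders beyond \<open>a\<close> are negligible; the shift \<open>\<sigma>\<close> lies above \<open>s\<close>, to beat \<open>\<rho>^(s-\<nu>)\<close>,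
    and below \<open>a\<close>, for integrability\<close>
  define a where "a = (s + \<nu>) / 2"
  define \<sigma> where "\<sigma> = (s + a) / 2"
  have a: "s < a" "a < \<nu>" and \<sigma>: "s < \<sigma>" "\<sigma> < a" "0 < \<sigma>" "\<sigma> < \<nu>"
    using s by (auto simp: a_def \<sigma>_def field_simps)
  have nonpos: "z \<notin> \<int>\<^sub>\<le>\<^sub>0" if "z > 0" for z :: real using that by auto
  define G where "G = (\<lambda>\<alpha>. rGamma \<alpha> * 4 powr (\<nu> - \<alpha>) * Gamma (\<nu> - \<alpha>))"
  have "continuous_on {s..a} G"
    unfolding G_def continuous_on_def using a s by (intro ballI tendsto_intros tendsto_rGamma nonpos) auto
  then obtain C where C: "C \<ge> 1" "\<And>\<alpha>. \<alpha> \<in> {s..a} \<Longrightarrow> G \<alpha> \<le> C"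
    by (rule continuous_on_Icc_upper_bound) blast
  define M where "M = (\<lambda>L. \<mu> * (exp (- L) / 4))"
  have M: "(M \<longlongrightarrow> 0) at_top" "M L \<ge> 0" for L
    using tendsto_mult[OF tendsto_const[of \<mu>] tendsto_exp_minus_div_4] \<mu> by (auto simp: M_def)

  \<comment> \<open>the contribution of the orders up to \<open>a\<close>, and its integrand after \<open>\<alpha> = s + q/L\<close>\<close>
  define near where "near = (\<lambda>L. (LINT \<alpha>|lborel. indicator {s<..a} \<alpha> * bessel_density \<nu> \<mu> (exp (- L) / 4) \<alpha>) * (L * exp (- (L * (\<nu> - s)))))"
  define S where "S = (\<lambda>L q. indicator {s<..a} (s + q / L) * (exp (- q) *
      (rGamma (s + q / L) * 4 powr (\<nu> - (s + q / L)) * macdonald (\<nu> - (s + q / L)) 1 (M L))))"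
  have near_eq: "near L = (LINT q|lborel. S L q)" if L: "L > 0" for L
  proof -
    have "(LINT \<alpha>|lborel. indicator {s<..a} \<alpha> * bessel_density \<nu> \<mu> (exp (- L) / 4) \<alpha>)
        = (1 / L) * (LINT q|lborel. indicator {s<..a} (s + q / L) * bessel_density \<nu> \<mu> (exp (- L) / 4) (s + q / L))"
      by (subst lborel_integral_real_affine[of "1 / L" _ s]) (use L in simp_all)
    moreover have "indicator {s<..a} (s + q / L) * bessel_density \<nu> \<mu> (exp (- L) / 4) (s + q / L) = exp (L * (\<nu> - s)) * S L q" for q
    proof -
      have "L * (\<nu> - (s + q / L)) = L * (\<nu> - s) + - q"
        using L by (simp add: field_simps)
      then have e: "exp (L * (\<nu> - (s + q / L))) = exp (L * (\<nu> - s)) * exp (- q)"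
        by (simp only: exp_add)
      show ?thesis
        unfolding S_def M_def bessel_density_inversion[OF less_trans[OF zero_less_one \<mu>]] e
        by (simp only: mult_ac)
    qed
    moreover define A where "A = L * (\<nu> - s)"
    ultimately have "near L = (1 / L * (exp A * (LINT q|lborel. S L q))) * (L * exp (- A))"
      by (simp only: near_def integral_mult_right_zero)
    then show ?thesis
      using L by (simp add: exp_minus)
  qed
  have "((\<lambda>L. LINT q|lborel. S L q) \<longlongrightarrow> (LINT q|lborel. G s * (indicator {0<..} q * exp (- q)))) at_top"
  proof (rule integral_dominated_convergence_at_top)
    show "integrable lborel (\<lambda>q. C * (indicator {0<..} q * exp (- q)))"
      using has_bochner_integral_exp_minus by (auto simp: has_bochner_integral_iff)
    show "\<forall>\<^sub>F L in at_top. AE q in lborel. norm (S L q) \<le> C * (indicator {0<..} q * exp (- q))"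
      using eventually_gt_at_top[of 0]
    proof eventually_elim
      case (elim L)
      show ?case
      proof (intro AE_I2)
        fix q
        show "norm (S L q) \<le> C * (indicator {0<..} q * exp (- q))"
        proof (cases "s + q / L \<in> {s<..a}")
          case True
          define \<alpha> where "\<alpha> = s + q / L"
          have al: "s < \<alpha>" "\<alpha> \<le> a" using True by (auto simp: \<alpha>_def)
          have q: "q > 0" using al elim by (simp add: \<alpha>_def zero_less_divide_iff)
          have r: "rGamma \<alpha> > 0" using al s by (intro rGamma_pos) simp
          have "macdonald (\<nu> - \<alpha>) 1 (M L) \<le> Gamma (\<nu> - \<alpha>)"
            using macdonald_le_Gamma[of 1 "M L" "\<nu> - \<alpha>"] al a M by simp
          then have "rGamma \<alpha> * 4 powr (\<nu> - \<alpha>) * macdonald (\<nu> - \<alpha>) 1 (M L) \<le> G \<alpha>"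
            unfolding G_def using r by (intro mult_left_mono) auto
          also have "\<dots> \<le> C" using C al by simp
          finally have "rGamma \<alpha> * 4 powr (\<nu> - \<alpha>) * macdonald (\<nu> - \<alpha>) 1 (M L) \<le> C" .
          moreover have "rGamma \<alpha> * 4 powr (\<nu> - \<alpha>) * macdonald (\<nu> - \<alpha>) 1 (M L) \<ge> 0"
            using r by (simp add: macdonald_nonneg)
          ultimately show ?thesis
            using q True unfolding S_def \<alpha>_def[symmetric] by (simp add: abs_mult)
        next
          case False
          then show ?thesis using C by (simp add: S_def)
        qed
      qed
    qed
    show "AE q in lborel. ((\<lambda>L. S L q) \<longlongrightarrow> G s * (indicator {0<..} q * exp (- q))) at_top"
    proof (intro AE_I2)
      fix q :: real
      show "((\<lambda>L. S L q) \<longlongrightarrow> G s * (indicator {0<..} q * exp (- q))) at_top"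
      proof (cases "q > 0")
        case True
        have al: "((\<lambda>L. s + q / L) \<longlongrightarrow> s) at_top"
          by real_asymp
        have "((\<lambda>L. macdonald (\<nu> - (s + q / L)) 1 (M L)) \<longlongrightarrow> Gamma (\<nu> - s) * 1 powr (- (\<nu> - s))) at_top"
          using M s by (intro tendsto_macdonald tendsto_diff al tendsto_const) auto
        then have "((\<lambda>L. exp (- q) * (rGamma (s + q / L) * 4 powr (\<nu> - (s + q / L)) * macdonald (\<nu> - (s + q / L)) 1 (M L))) \<longlongrightarrow>
            exp (- q) * (rGamma s * 4 powr (\<nu> - s) * (Gamma (\<nu> - s) * 1 powr (- (\<nu> - s))))) at_top"
          by (intro tendsto_mult tendsto_const tendsto_powr tendsto_diff al tendsto_rGamma) auto
        moreover have "\<forall>\<^sub>F L in at_top. exp (- q) * (rGamma (s + q / L) * 4 powr (\<nu> - (s + q / L)) * macdonald (\<nu> - (s + q / L)) 1 (M L)) = S L q"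
          using eventually_gt_at_top[of 0] order_tendstoD(2)[OF al a(1)]
          by eventually_elim (use True in \<open>simp add: S_def\<close>)
        ultimately show ?thesis
          using True by (auto simp: G_def mult_ac intro: Lim_transform_eventually)
      next
        case False
        have "\<forall>\<^sub>F L in at_top. 0 = S L q"
          using eventually_gt_at_top[of 0]
          by eventually_elim (use False in \<open>auto simp: S_def indicator_def zero_less_divide_iff\<close>)
        then show ?thesis
          using False by (auto intro: Lim_transform_eventually[OF tendsto_const])
      qed
    qed
  qed (unfold S_def M_def, measurable)
  moreover have "(LINT q|lborel. G s * (indicator {0<..} q * exp (- q))) = G s"
    using has_bochner_integral_integral_eq[OF has_bochner_integral_exp_minus] by simp
  moreover have "\<forall>\<^sub>F L in at_top. (LINT q|lborel. S L q) = near L"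
    using eventually_gt_at_top[of 0] by eventually_elim (simp add: near_eq)
  ultimately have near: "(near \<longlongrightarrow> G s) at_top"
    by (auto intro: Lim_transform_eventually)

  \<comment> \<open>the contribution of the orders beyond \<open>a\<close>\<close>
  define far where "far = (\<lambda>L. log_bessel_profile \<nu> a \<mu> (exp (- L) / 4) * (L * exp (- (L * (\<nu> - s)))))"
  define T where "T = (\<nu> - \<sigma>) powr (\<nu> - \<sigma>) * 4 powr (\<nu> - \<sigma>) * (LINT \<alpha>|lborel. indicator {a<..} \<alpha> * Gamma_quotient \<sigma> \<mu> \<alpha>)"
  have "(far \<longlongrightarrow> 0) at_top"
  proof (rule tendsto_sandwich[OF _ _ tendsto_const])
    show "\<forall>\<^sub>F L in at_top. 0 \<le> far L"
      using eventually_gt_at_top[of 0] by eventually_elim (use s a in \<open>simp add: far_def log_bessel_profile_nonneg\<close>)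
    show "\<forall>\<^sub>F L in at_top. far L \<le> T * (L * exp (- (L * (\<sigma> - s))))"
      using eventually_gt_at_top[of 0]
    proof eventually_elim
      case (elim L)
      have "(exp (- L) / 4) powr (\<sigma> - \<nu>) = 4 powr (\<nu> - \<sigma>) * exp (L * (\<nu> - \<sigma>))"
        by (simp add: powr_def ln_div algebra_simps flip: exp_add)
      then have "log_bessel_profile \<nu> a \<mu> (exp (- L) / 4) \<le> T * exp (L * (\<nu> - \<sigma>))"
        using log_bessel_profile_le_shift[of \<mu> "exp (- L) / 4" \<sigma> \<nu> a] \<mu> \<sigma> by (simp add: T_def mult_ac)
      then have "far L \<le> T * exp (L * (\<nu> - \<sigma>)) * (L * exp (- (L * (\<nu> - s))))"
        unfolding far_def using elim by (intro mult_right_mono) auto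
      also have "\<dots> = T * (L * (exp (L * (\<nu> - \<sigma>)) * exp (- (L * (\<nu> - s)))))"
        by (simp only: mult_ac)
      also have "exp (L * (\<nu> - \<sigma>)) * exp (- (L * (\<nu> - s))) = exp (- (L * (\<sigma> - s)))"
        by (simp flip: exp_add add: algebra_simps)
      finally show ?case .
    qed
    have "\<sigma> - s > 0" using \<sigma> by simp
    then show "((\<lambda>L. T * (L * exp (- (L * (\<sigma> - s))))) \<longlongrightarrow> 0) at_top"
      by real_asymp
  qed
  with near have "((\<lambda>L. near L + far L) \<longlongrightarrow> G s + 0) at_top"
    by (rule tendsto_add)
  moreover have "near L + far L = log_bessel_profile \<nu> s \<mu> (exp (- L) / 4) * (L * exp (- (L * (\<nu> - s))))" for L
    using log_bessel_profile_split[of \<mu> "exp (- L) / 4" s a \<nu>] \<mu> s a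
    by (simp add: near_def far_def distrib_right)
  ultimately show ?thesis by (simp add: G_def)
qed

lemma Gamma_plus_one_bound:
  obtains C where "C \<ge> (1::real)" "\<And>x. 0 < x \<Longrightarrow> x \<le> 2 \<Longrightarrow> x * Gamma x \<le> C"
proof -
  have "continuous_on {0..2::real} (\<lambda>x. Gamma (x + 1))"
    unfolding continuous_on_def by (intro ballI tendsto_intros) (auto dest: nonpos_Ints_nonpos)
  then obtain C where C: "C \<ge> 1" "\<And>x. x \<in> {0..2::real} \<Longrightarrow> Gamma (x + 1) \<le> C"
    by (rule continuous_on_Icc_upper_bound) blast
  have "x * Gamma x \<le> C" if "0 < x" "x \<le> 2" for x :: real
    using C(2)[of x] that Gamma_plus1[of x] by (fastforce dest: nonpos_Ints_nonpos)
  with C(1) show ?thesis by (rule that)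
qed

text \<open>
  The first term of the minimum is the bound by \<open>\<beta> \<Gamma>(\<beta>)\<close>. The second is the shifted bound with
  \<open>\<theta> = 1/L\<close>, for which \<open>\<rho>^(-\<theta>)\<close> stays bounded while \<open>\<Gamma>(\<beta> + \<theta>)\<close> is at most of order \<open>L\<close>.
\<close>

lemma macdonald_critical_bound:
  assumes "\<mu> > 1"
  obtains C where "C \<ge> 1" "\<And>\<beta> L. 0 < \<beta> \<Longrightarrow> \<beta> \<le> 1 \<Longrightarrow> L \<ge> 1 \<Longrightarrow>
     \<beta> * macdonald \<beta> \<mu> (exp (- L) / 4) \<le> C * min 1 (L * \<beta>)"
proof -
  obtain D where D: "D \<ge> (1::real)" "\<And>x. 0 < x \<Longrightarrow> x \<le> 2 \<Longrightarrow> x * Gamma x \<le> D"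
    by (rule Gamma_plus_one_bound) blast
  have le1: "\<mu> powr (- x) \<le> 1" if "x \<ge> 0" for x
    using powr_mono[of "- x" 0 \<mu>] assms that by simp
  have "\<beta> * macdonald \<beta> \<mu> (exp (- L) / 4) \<le> (4 * exp 1 * D) * min 1 (L * \<beta>)"
    if \<beta>: "0 < \<beta>" "\<beta> \<le> 1" and L: "L \<ge> 1" for \<beta> L
  proof -
    have "macdonald \<beta> \<mu> (exp (- L) / 4) \<le> Gamma \<beta> * \<mu> powr (- \<beta>)"
      using assms \<beta> by (intro macdonald_le_Gamma) auto
    also have "\<dots> \<le> Gamma \<beta> * 1"
      using le1[of \<beta>] \<beta> Gamma_real_pos[of \<beta>] by (intro mult_left_mono) auto
    finally have "\<beta> * macdonald \<beta> \<mu> (exp (- L) / 4) \<le> \<beta> * Gamma \<beta>"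
      using \<beta> by simp
    also have "\<dots> \<le> D" using D(2)[of \<beta>] \<beta> by simp
    also have "D \<le> 4 * exp 1 * D"
      using D(1) exp_ge_add_one_self[of 1] by simp
    finally have 1: "\<beta> * macdonald \<beta> \<mu> (exp (- L) / 4) \<le> 4 * exp 1 * D" .
    define \<theta> where "\<theta> = 1 / L"
    have \<theta>: "0 < \<theta>" "\<theta> \<le> 1" using L by (auto simp: \<theta>_def)
    have t1: "\<theta> powr \<theta> \<le> 1" using \<theta> powr_mono2[of \<theta> \<theta> 1] by simp
    have "(exp (- L) / 4) powr (- \<theta>) = exp (L * \<theta>) * 4 powr \<theta>"
      by (simp add: powr_def ln_div algebra_simps flip: exp_add)
    also have "\<dots> \<le> exp 1 * 4 powr 1"
      using L \<theta> by (intro mult_mono powr_mono) (auto simp: \<theta>_def)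
    finally have t2: "(exp (- L) / 4) powr (- \<theta>) \<le> exp 1 * 4" by simp
    have "(\<beta> + \<theta>) * Gamma (\<beta> + \<theta>) \<le> D" using \<beta> \<theta> by (intro D) auto
    moreover have "\<theta> * Gamma (\<beta> + \<theta>) \<le> (\<beta> + \<theta>) * Gamma (\<beta> + \<theta>)"
      using \<beta> \<theta> Gamma_real_pos[of "\<beta> + \<theta>"] by (intro mult_right_mono) auto
    ultimately have "Gamma (\<beta> + \<theta>) \<le> L * D"
      using L by (simp add: \<theta>_def field_simps)
    moreover have "Gamma (\<beta> + \<theta>) * \<mu> powr (- (\<beta> + \<theta>)) \<le> Gamma (\<beta> + \<theta>) * 1"
      using le1[of "\<beta> + \<theta>"] \<beta> \<theta> Gamma_real_pos[of "\<beta> + \<theta>"] by (intro mult_left_mono) auto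
    ultimately have t3: "Gamma (\<beta> + \<theta>) * \<mu> powr (- (\<beta> + \<theta>)) \<le> L * D" by simp
    have "macdonald \<beta> \<mu> (exp (- L) / 4) \<le>
        \<theta> powr \<theta> * (exp (- L) / 4) powr (- \<theta>) * (Gamma (\<beta> + \<theta>) * \<mu> powr (- (\<beta> + \<theta>)))"
      using assms \<beta> \<theta> by (intro macdonald_le_shift) auto
    also have "\<dots> \<le> 1 * (exp 1 * 4) * (L * D)"
      using Gamma_real_pos[of "\<beta> + \<theta>"] \<beta> \<theta>
      by (intro mult_mono[OF mult_mono[OF t1 t2] t3]) auto
    finally have "\<beta> * macdonald \<beta> \<mu> (exp (- L) / 4) \<le> \<beta> * (1 * (exp 1 * 4) * (L * D))"
      using \<beta> by (intro mult_left_mono) auto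
    then have 2: "\<beta> * macdonald \<beta> \<mu> (exp (- L) / 4) \<le> 4 * exp 1 * D * (L * \<beta>)"
      by (simp add: mult_ac)
    show ?thesis
      using 1 2 by (simp add: min_def)
  qed
  moreover have "4 * exp 1 * D \<ge> 1"
    using mult_mono[of 1 "4 * exp 1" 1 D] D(1) exp_ge_add_one_self[of 1] by simp
  ultimately show ?thesis by (rule that[rotated])
qed

text \<open>
  For \<open>\<beta> = L^(-y)\<close> with \<open>y < 1\<close> one has \<open>L\<beta> \<rightarrow> \<infinity>\<close>, so \<open>\<rho>^(\<beta>/2)\<close> tends to 0 although
  \<open>\<beta>\<close> does, and the lower bound with \<open>\<theta> = \<beta>/2\<close> is sharp in the limit.
\<close>

lemma tendsto_macdonald_critical:
  assumes \<mu>: "\<mu> > 1" and y: "0 < y" "y < 1"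
  shows "((\<lambda>L. L powr (- y) * macdonald (L powr (- y)) \<mu> (exp (- L) / 4)) \<longlongrightarrow> 1) at_top"
proof -
  let ?b = "\<lambda>L::real. L powr (- y)"
  have nonpos: "z \<notin> \<int>\<^sub>\<le>\<^sub>0" if "z > 0" for z :: real using that by auto
  have b: "(?b \<longlongrightarrow> 0) at_top" using y by real_asymp
  have r: "((\<lambda>L. (exp (- L) / 4) powr (?b L / 2)) \<longlongrightarrow> 0) at_top"
  proof -
    have "((\<lambda>L. exp ((- L - ln 4) * (?b L / 2))) \<longlongrightarrow> 0) at_top"
      using y by real_asymp
    then show ?thesis by (simp add: powr_def[of "exp _ / _"] ln_div mult_ac)
  qed
  have G: "x * Gamma x = Gamma (x + 1)" if "x > 0" for x :: real
    using Gamma_plus1[of x] nonpos[OF that] by simp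
  show ?thesis
  proof (rule tendsto_sandwich)
    show "\<forall>\<^sub>F L in at_top. Gamma (?b L + 1) * \<mu> powr (- ?b L)
        - (exp (- L) / 4) powr (?b L / 2) * (2 * (Gamma (?b L / 2 + 1) * \<mu> powr (- (?b L / 2))))
        \<le> ?b L * macdonald (?b L) \<mu> (exp (- L) / 4)"
      using eventually_gt_at_top[of 1]
    proof eventually_elim
      case (elim L)
      have p: "?b L > 0" "?b L \<le> 1" using elim y powr_mono[of "- y" 0 L] by auto
      have "Gamma (?b L) * \<mu> powr (- ?b L) - (exp (- L) / 4) powr (?b L / 2) *
          (Gamma (?b L - ?b L / 2) * \<mu> powr (- (?b L - ?b L / 2))) \<le> macdonald (?b L) \<mu> (exp (- L) / 4)"
        using \<mu> p by (intro macdonald_ge_Gamma) auto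
      then have "?b L * (Gamma (?b L) * \<mu> powr (- ?b L) - (exp (- L) / 4) powr (?b L / 2) *
          (Gamma (?b L / 2) * \<mu> powr (- (?b L / 2)))) \<le> ?b L * macdonald (?b L) \<mu> (exp (- L) / 4)"
        using p by (intro mult_left_mono) (auto simp: field_simps)
      moreover have "Gamma (?b L + 1) = ?b L * Gamma (?b L)"
        using p G[of "?b L"] by auto
      moreover have "r * (2 * (Gamma (?b L / 2 + 1) * m)) = ?b L * (r * (Gamma (?b L / 2) * m))" for r m
        using p G[of "?b L / 2", symmetric] by simp
      ultimately show ?case
        by (simp only: right_diff_distrib mult.assoc)
    qed
    show "\<forall>\<^sub>F L in at_top. ?b L * macdonald (?b L) \<mu> (exp (- L) / 4) \<le> Gamma (?b L + 1) * \<mu> powr (- ?b L)"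
      using eventually_gt_at_top[of 1]
    proof eventually_elim
      case (elim L)
      then have "?b L > 0" by simp
      then show ?case
        using macdonald_le_Gamma[of \<mu> "exp (- L) / 4" "?b L"] \<mu>
        by (simp add: G[symmetric] mult.assoc)
    qed
    have "((\<lambda>L. Gamma (?b L + 1) * \<mu> powr (- ?b L)
        - (exp (- L) / 4) powr (?b L / 2) * (2 * (Gamma (?b L / 2 + 1) * \<mu> powr (- (?b L / 2)))))
        \<longlongrightarrow> Gamma (0 + 1) * \<mu> powr (- 0) - 0 * (2 * (Gamma (0 / 2 + 1) * \<mu> powr (- (0 / 2))))) at_top"
      using \<mu> by (intro tendsto_intros b r nonpos) auto
    then show "((\<lambda>L. Gamma (?b L + 1) * \<mu> powr (- ?b L)
        - (exp (- L) / 4) powr (?b L / 2) * (2 * (Gamma (?b L / 2 + 1) * \<mu> powr (- (?b L / 2)))))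
        \<longlongrightarrow> 1) at_top" using \<mu> by simp
    have "((\<lambda>L. Gamma (?b L + 1) * \<mu> powr (- ?b L)) \<longlongrightarrow> Gamma (0 + 1) * \<mu> powr (- 0)) at_top"
      using \<mu> by (intro tendsto_intros b nonpos) auto
    then show "((\<lambda>L. Gamma (?b L + 1) * \<mu> powr (- ?b L)) \<longlongrightarrow> 1) at_top" using \<mu> by simp
  qed
qed


text \<open>
  In the variable \<open>y\<close> with \<open>\<alpha> - \<nu> = L^(-y)\<close> the measure \<open>d\<alpha>/(\<alpha>-\<nu>)\<close> is \<open>ln L dy\<close>. The integrand is
  \<open>\<beta> macdonald \<beta>\<close> up to \<open>1/\<Gamma>(\<nu>+\<beta>)\<close>: it tends to \<open>1/\<Gamma>(\<nu>)\<close> for \<open>0 < y < 1\<close> and is of size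
  \<open>L^(1-y)\<close> for \<open>y > 1\<close>.
\<close>

lemma log_bessel_profile_limit_critical:
  assumes \<mu>: "\<mu> > 1" and \<nu>: "0 < \<nu>"
  shows "((\<lambda>L. log_bessel_profile \<nu> \<nu> \<mu> (exp (- L) / 4) / ln L) \<longlongrightarrow> rGamma \<nu>) at_top"
proof -
  obtain C where C: "C \<ge> 1" "\<And>\<beta> L. 0 < \<beta> \<Longrightarrow> \<beta> \<le> 1 \<Longrightarrow> L \<ge> 1 \<Longrightarrow>
     \<beta> * macdonald \<beta> \<mu> (exp (- L) / 4) \<le> C * min 1 (L * \<beta>)"
    by (rule macdonald_critical_bound[OF \<mu>]) blast
  have "continuous_on {\<nu>..\<nu> + 1} (rGamma :: real \<Rightarrow> real)" by (intro continuous_intros)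
  then obtain D where D: "D \<ge> 1" "\<And>\<alpha>. \<alpha> \<in> {\<nu>..\<nu> + 1} \<Longrightarrow> rGamma \<alpha> \<le> D"
    by (rule continuous_on_Icc_upper_bound) blast
  define S where "S = (\<lambda>L y. indicator {0..} y * (L powr (- y) * bessel_density \<nu> \<mu> (exp (- L) / 4) (\<nu> + L powr (- y))))"
  \<comment> \<open>for \<open>y \<ge> 0\<close> and \<open>L \<ge> e\<close> this is dominated by a multiple of \<open>e^(1-y)\<close>\<close>
  have S_bound: "norm (S L y) \<le> D * C * (indicator {0..} y * min 1 (L powr (1 - y)))" if L: "L \<ge> 1" for L y
  proof (cases "y \<ge> 0")
    case True
    have b: "0 < L powr (- y)" "L powr (- y) \<le> 1" using L True powr_mono[of "- y" 0 L] by auto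
    have r: "0 < rGamma (\<nu> + L powr (- y))" "rGamma (\<nu> + L powr (- y)) \<le> D"
      using b \<nu> by (auto intro!: rGamma_pos D add_pos_pos)
    have "L powr (- y) * macdonald (L powr (- y)) \<mu> (exp (- L) / 4) \<le> C * min 1 (L * L powr (- y))"
      using b L by (rule C)
    also have "L * L powr (- y) = L powr (1 - y)"
      using L powr_add[of L 1 "- y"] by simp
    finally have z: "L powr (- y) * macdonald (L powr (- y)) \<mu> (exp (- L) / 4) \<le> C * min 1 (L powr (1 - y))" .
    have "rGamma (\<nu> + L powr (- y)) * (L powr (- y) * macdonald (L powr (- y)) \<mu> (exp (- L) / 4))
        \<le> D * (C * min 1 (L powr (1 - y)))"
      using D(1) b by (intro mult_mono[OF r(2) z]) (simp_all add: macdonald_nonneg)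
    moreover have "0 \<le> rGamma (\<nu> + L powr (- y)) * (L powr (- y) * macdonald (L powr (- y)) \<mu> (exp (- L) / 4))"
      using r b by (simp add: macdonald_nonneg)
    ultimately show ?thesis
      using True by (simp add: S_def bessel_density_def mult_ac)
  qed (simp add: S_def)
  have near_eq: "(LINT \<alpha>|lborel. indicator {\<nu><..\<nu> + 1} \<alpha> * bessel_density \<nu> \<mu> (exp (- L) / 4) \<alpha>)
      = ln L * (LINT y|lborel. S L y)" if L: "L > 1" for L
  proof -
    let ?g = "\<lambda>y. \<nu> + L powr (- y)"
    have img: "?g ` {0..} = {\<nu><..\<nu> + 1}"
    proof (intro equalityI subsetI)
      fix x assume "x \<in> {\<nu><..\<nu> + 1}"
      then have x: "0 < x - \<nu>" "x - \<nu> \<le> 1" by auto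
      have "?g (- log L (x - \<nu>)) = x" using x L by simp
      moreover have "- log L (x - \<nu>) \<in> {0..}" using x L by simp
      ultimately show "x \<in> ?g ` {0..}" by (metis imageI)
    qed (use L powr_mono[of _ 0 L] in auto)
    have int: "integrable lborel (\<lambda>\<alpha>. indicator {\<nu><..\<nu> + 1} \<alpha> * bessel_density \<nu> \<mu> (exp (- L) / 4) \<alpha>)"
    proof -
      have i: "integrable lborel (\<lambda>\<alpha>. indicator {\<nu><..} \<alpha> * bessel_density \<nu> \<mu> (exp (- L) / 4) \<alpha>)"
        using \<mu> \<nu> by (intro integrable_bessel_density) auto
      show ?thesis
        by (rule Bochner_Integration.integrable_bound[OF i]) (auto simp: indicator_def)
    qed
    define I where "I = (LINT \<alpha>|lborel. indicator {\<nu><..\<nu> + 1} \<alpha> * bessel_density \<nu> \<mu> (exp (- L) / 4) \<alpha>)"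
    have "has_bochner_integral lborel (\<lambda>y. indicator {0..} y * (\<bar>- (ln L * L powr (- y))\<bar> * bessel_density \<nu> \<mu> (exp (- L) / 4) (?g y))) I
      \<longleftrightarrow> has_bochner_integral lborel (\<lambda>\<alpha>. indicator (?g ` {0..}) \<alpha> * bessel_density \<nu> \<mu> (exp (- L) / 4) \<alpha>) I"
    proof (rule has_bochner_integral_change_of_variables)
      show "(?g has_field_derivative - (ln L * L powr (- y))) (at y within {0..})" for y
        using L by (auto intro!: derivative_eq_intros simp: powr_def)
      show "inj_on ?g {0..}"
        using L by (auto intro!: inj_onI simp: powr_inj)
    qed (simp_all add: img)
    moreover have "has_bochner_integral lborel (\<lambda>\<alpha>. indicator (?g ` {0..}) \<alpha> * bessel_density \<nu> \<mu> (exp (- L) / 4) \<alpha>) I"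
      unfolding img I_def using int by (rule has_bochner_integral_integrable)
    ultimately have "has_bochner_integral lborel (\<lambda>y. indicator {0..} y * (\<bar>- (ln L * L powr (- y))\<bar> * bessel_density \<nu> \<mu> (exp (- L) / 4) (?g y))) I"
      by (rule iffD2)
    then have "I = (LINT y|lborel. indicator {0..} y * (\<bar>- (ln L * L powr (- y))\<bar> * bessel_density \<nu> \<mu> (exp (- L) / 4) (?g y)))"
      by (rule has_bochner_integral_integral_eq[symmetric])
    also have "\<dots> = (LINT y|lborel. ln L * S L y)"
      using L by (intro Bochner_Integration.integral_cong refl) (simp add: S_def abs_mult mult_ac)
    finally show ?thesis by (simp add: I_def)
  qed
  have lim: "((\<lambda>L. LINT y|lborel. S L y) \<longlongrightarrow> (LINT y|lborel. rGamma \<nu> * indicator {0<..<1::real} y)) at_top"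
  proof (rule integral_dominated_convergence_at_top)
    show "integrable lborel (\<lambda>y. (D * C * exp 1) * (indicator {0<..} y * exp (- y)))"
      using has_bochner_integral_exp_minus by (auto simp: has_bochner_integral_iff)
    show "\<forall>\<^sub>F L in at_top. AE y in lborel. norm (S L y) \<le> (D * C * exp 1) * (indicator {0<..} y * exp (- y))"
      using eventually_ge_at_top[of "exp 1"]
    proof eventually_elim
      case (elim L)
      have L: "L \<ge> 1" using elim exp_ge_add_one_self[of 1] by linarith
      then have ln: "ln L \<ge> 1" using elim ln_ge_iff[of L 1] by simp
      show ?case
        using AE_lborel_singleton[of "0::real"]
      proof eventually_elim
        case (elim y)
        \<comment> \<open>only here \<open>L \<ge> e\<close> is used: then \<open>L^(1-y) \<le> e^(1-y)\<close> for \<open>y \<ge> 1\<close>\<close>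
        have "min 1 (L powr (1 - y)) \<le> exp (1 - y)"
        proof (cases "y \<le> 1")
          case False
          have "(1 - y) * ln L \<le> (1 - y) * 1" using False ln by (intro mult_left_mono_neg) auto
          then have "L powr (1 - y) \<le> exp (1 - y)" using L by (simp add: powr_def)
          then show ?thesis by (simp add: min_le_iff_disj)
        qed (simp add: min_le_iff_disj)
        also have "\<dots> = exp 1 * exp (- y)" by (simp flip: exp_add)
        finally have "D * C * (indicator {0..} y * min 1 (L powr (1 - y))) \<le> D * C * (indicator {0<..} y * (exp 1 * exp (- y)))"
          using elim C(1) D(1) by (intro mult_left_mono) (auto simp: indicator_def)
        with S_bound[OF L, of y] show ?case by (simp add: mult_ac)
      qed
    qed
    show "AE y in lborel. ((\<lambda>L. S L y) \<longlongrightarrow> rGamma \<nu> * indicator {0<..<1} y) at_top"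
      using AE_lborel_singleton[of "0::real"] AE_lborel_singleton[of "1::real"]
    proof eventually_elim
      case (elim y)
      consider "y < 0" | "0 < y" "y < 1" | "y > 1" using elim by linarith
      then show ?case
      proof cases
        case 1
        then show ?thesis by (simp add: S_def)
      next
        case 2
        have b: "((\<lambda>L::real. \<nu> + L powr (- y)) \<longlongrightarrow> \<nu>) at_top" using 2 by real_asymp
        have "((\<lambda>L. rGamma (\<nu> + L powr (- y)) * (L powr (- y) * macdonald (L powr (- y)) \<mu> (exp (- L) / 4))) \<longlongrightarrow> rGamma \<nu> * 1) at_top"
          by (intro tendsto_mult tendsto_rGamma b tendsto_macdonald_critical \<mu> 2)
        then show ?thesis using 2 by (simp add: S_def bessel_density_def mult_ac)
      next
        case 3
        have "((\<lambda>L. D * C * L powr (1 - y)) \<longlongrightarrow> 0) at_top" using 3 by real_asymp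
        moreover have "\<forall>\<^sub>F L in at_top. norm (S L y) \<le> D * C * L powr (1 - y)"
          using eventually_ge_at_top[of 1]
        proof eventually_elim
          case (elim L)
          have "D * C * (indicator {0..} y * min 1 (L powr (1 - y))) \<le> D * C * L powr (1 - y)"
            using 3 C(1) D(1) by (intro mult_left_mono) (auto simp: min_def)
          with S_bound[OF elim, of y] show ?case by simp
        qed
        ultimately have "((\<lambda>L. S L y) \<longlongrightarrow> 0) at_top" by (rule Lim_null_comparison[rotated])
        then show ?thesis using 3 by simp
      qed
    qed
  qed (unfold S_def, measurable)
  define T where "T = (LINT \<alpha>|lborel. indicator {\<nu> + 1<..} \<alpha> * Gamma_quotient \<nu> \<mu> \<alpha>)"
  have far: "((\<lambda>L. log_bessel_profile \<nu> (\<nu> + 1) \<mu> (exp (- L) / 4) / ln L) \<longlongrightarrow> 0) at_top"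
  proof (rule tendsto_sandwich[OF _ _ tendsto_const])
    show "\<forall>\<^sub>F L in at_top. 0 \<le> log_bessel_profile \<nu> (\<nu> + 1) \<mu> (exp (- L) / 4) / ln L"
      using eventually_gt_at_top[of 1] by eventually_elim (use \<nu> in \<open>simp add: log_bessel_profile_nonneg\<close>)
    show "\<forall>\<^sub>F L in at_top. log_bessel_profile \<nu> (\<nu> + 1) \<mu> (exp (- L) / 4) / ln L \<le> T / ln L"
      using eventually_gt_at_top[of 1]
      by eventually_elim (use \<nu> \<mu> log_bessel_profile_le in \<open>simp add: T_def divide_right_mono\<close>)
    show "((\<lambda>L. T / ln L) \<longlongrightarrow> 0) at_top" by real_asymp
  qed
  have "((\<lambda>L. (LINT y|lborel. S L y) + log_bessel_profile \<nu> (\<nu> + 1) \<mu> (exp (- L) / 4) / ln L) \<longlongrightarrow> rGamma \<nu> + 0) at_top"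
    using lim by (intro tendsto_add far) simp
  moreover have "\<forall>\<^sub>F L in at_top. (LINT y|lborel. S L y) + log_bessel_profile \<nu> (\<nu> + 1) \<mu> (exp (- L) / 4) / ln L
      = log_bessel_profile \<nu> \<nu> \<mu> (exp (- L) / 4) / ln L"
    using eventually_gt_at_top[of 1]
  proof eventually_elim
    case (elim L)
    have "log_bessel_profile \<nu> \<nu> \<mu> (exp (- L) / 4) = ln L * (LINT y|lborel. S L y) + log_bessel_profile \<nu> (\<nu> + 1) \<mu> (exp (- L) / 4)"
      using log_bessel_profile_split[of \<mu> "exp (- L) / 4" \<nu> "\<nu> + 1" \<nu>] near_eq[OF elim] \<mu> \<nu> by simp
    then show ?case using elim by (simp add: field_simps)
  qed
  ultimately show ?thesis by (auto intro: Lim_transform_eventually)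
qed


section \<open>The Riesz kernel as a superposition of heat kernels\<close>

lemma has_bochner_integral_heat_kernel:
  assumes "t > 0"
  shows "has_bochner_integral lborel (heat_kernel t :: 'a::euclidean_space \<Rightarrow> real) 1"
proof -
  have "has_bochner_integral lborel (\<lambda>x::'a. Re (of_real (heat_kernel t x) * cis (- 2 * pi * (x \<bullet> 0))))
      (Re (of_real (exp (- 4 * pi\<^sup>2 * t * (norm (0::'a))\<^sup>2))))"
    by (rule has_bochner_integral_Re[OF heat_kernel_fourier[OF assms]])
  then show ?thesis by simp
qed

lemma heat_kernel_nonneg: "heat_kernel t x \<ge> 0"
  by (simp add: heat_kernel_def)

lemma heat_kernel_le:
  fixes x :: "'a::euclidean_space"
  assumes "t > 0"
  shows "heat_kernel t x \<le> (4 * pi) powr (- real DIM('a) / 2) * t powr (- real DIM('a) / 2)"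
proof -
  have "heat_kernel t x \<le> (4 * pi * t) powr (- real DIM('a) / 2) * 1"
    unfolding heat_kernel_def using assms by (intro mult_left_mono) auto
  then show ?thesis using assms by (simp add: powr_mult)
qed

definition riesz_constant :: "'a::euclidean_space itself \<Rightarrow> real \<Rightarrow> real" where
  "riesz_constant T s = Gamma (real DIM('a) / 2 - s) / (pi powr (real DIM('a) / 2) * 2 powr (2 * s) * Gamma s)"

lemma riesz_constant_pos:
  assumes "0 < s" "2 * s < real DIM('a::euclidean_space)"
  shows "riesz_constant TYPE('a) s > 0"
  using assms by (simp add: riesz_constant_def Gamma_real_pos)

text \<open>
  Subordination: a Macdonald integral with \<open>\<mu> = 0\<close>, evaluated by inversion.
\<close>

lemma has_bochner_integral_riesz_subordination:
  fixes x :: "'a::euclidean_space"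
  assumes s: "0 < s" "2 * s < real DIM('a)" and x: "x \<noteq> 0"
  shows "has_bochner_integral lborel (\<lambda>t. indicator {0<..} t * (t powr (s - 1) * heat_kernel t x))
           (Gamma s * riesz_constant TYPE('a) s * norm x powr (2 * s - real DIM('a)))"
proof -
  define \<nu> where "\<nu> = real DIM('a) / 2"
  define \<rho> where "\<rho> = (norm x)\<^sup>2 / 4"
  have \<rho>: "\<rho> > 0" using x by (simp add: \<rho>_def)
  have "has_bochner_integral lborel (macdonald_integrand (- (s - \<nu>)) 1 (0 * \<rho>)) (Gamma (\<nu> - s))"
    using has_bochner_integral_macdonald_0[of 1 "\<nu> - s"] s by (simp add: \<nu>_def)
  then have "has_bochner_integral lborel (macdonald_integrand (s - \<nu>) 0 \<rho>) (\<rho> powr (s - \<nu>) * Gamma (\<nu> - s))"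
    by (simp only: has_bochner_integral_macdonald_inversion[OF \<rho>])
  then have *: "has_bochner_integral lborel (\<lambda>t. (4 * pi) powr (- \<nu>) * macdonald_integrand (s - \<nu>) 0 \<rho> t)
     ((4 * pi) powr (- \<nu>) * (\<rho> powr (s - \<nu>) * Gamma (\<nu> - s)))"
    by (rule has_bochner_integral_mult_right)
  have 1: "(4 * pi) powr (- \<nu>) * macdonald_integrand (s - \<nu>) 0 \<rho> t
      = indicator {0<..} t * (t powr (s - 1) * heat_kernel t x)" for t
  proof (cases "t > 0")
    case True
    have "t powr (s - \<nu> - 1) = t powr (s - 1) * t powr (- \<nu>)"
      by (simp flip: powr_add add: algebra_simps)
    then show ?thesis
      using True by (simp add: macdonald_integrand_def heat_kernel_def powr_mult \<nu>_def \<rho>_def)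
  qed (simp add: macdonald_integrand_def)
  have "\<rho> powr (s - \<nu>) = norm x powr (2 * s - real DIM('a)) * 4 powr (\<nu> - s)"
    using x by (simp add: \<rho>_def \<nu>_def powr_def ln_div ln_realpow algebra_simps flip: exp_add)
  note \<rho>s = this
  have G: "Gamma s \<noteq> 0" using Gamma_real_pos[OF s(1)] by (metis less_irrefl)
  have pw: "(4 * pi) powr (- \<nu>) * 4 powr (\<nu> - s) = 1 / (pi powr \<nu> * 2 powr (2 * s))"
  proof -
    have "(2::real) powr (2 * s) = 4 powr s" by (simp flip: powr_powr)
    then show ?thesis
      by (simp add: powr_mult powr_minus powr_diff field_simps)
  qed
  have "(4 * pi) powr (- \<nu>) * (\<rho> powr (s - \<nu>) * Gamma (\<nu> - s))
      = ((4 * pi) powr (- \<nu>) * 4 powr (\<nu> - s)) * (norm x powr (2 * s - real DIM('a)) * Gamma (\<nu> - s))"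
    by (simp only: \<rho>s mult_ac)
  also have "\<dots> = Gamma s * riesz_constant TYPE('a) s * norm x powr (2 * s - real DIM('a))"
    unfolding pw using G by (simp add: riesz_constant_def \<nu>_def[symmetric])
  finally have 2: "(4 * pi) powr (- \<nu>) * (\<rho> powr (s - \<nu>) * Gamma (\<nu> - s))
     = Gamma s * riesz_constant TYPE('a) s * norm x powr (2 * s - real DIM('a))" .
  show ?thesis using * by (simp only: 1 2)
qed

lemma heat_kernel_mult_integrable:
  fixes g :: "'a::euclidean_space \<Rightarrow> complex"
  assumes "t > 0" and g: "integrable lborel g"
  shows "integrable lborel (\<lambda>x. of_real (heat_kernel t x) * g x)"
proof (rule Bochner_Integration.integrable_bound)
  show "integrable lborel (\<lambda>x. (4 * pi) powr (- real DIM('a) / 2) * t powr (- real DIM('a) / 2) * norm (g x))"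
    using g by simp
  show "(\<lambda>x. of_real (heat_kernel t x) * g x) \<in> borel_measurable lborel"
    using borel_measurable_integrable[OF g] by measurable
  show "AE x in lborel. norm (of_real (heat_kernel t x) * g x)
      \<le> norm ((4 * pi) powr (- real DIM('a) / 2) * t powr (- real DIM('a) / 2) * norm (g x))"
    using heat_kernel_le[OF assms(1), where 'a='a]
    by (intro AE_I2) (auto simp: norm_mult heat_kernel_nonneg abs_mult intro!: mult_right_mono)
qed

text \<open>
  The pairing of \<open>p_t\<close> with \<open>|g|\<close> is at most \<open>B\<close>, as \<open>p_t\<close> has mass 1, and at most a multiple of
  \<open>t^(-n/2)\<close>, the supremum of \<open>p_t\<close>. The first bound makes \<open>t^(s-1)\<close> integrable near 0 because
  \<open>s > 0\<close>, the second near infinity because \<open>2s < n\<close>. In this way the local integrability of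
  \<open>|x|^(2s-n)\<close> is obtained without polar coordinates.
\<close>

lemma riesz_heat_Fubini:
  fixes g :: "'a::euclidean_space \<Rightarrow> complex"
  assumes s: "0 < s" "2 * s < real DIM('a)" and g: "integrable lborel g" and B: "\<And>x. norm (g x) \<le> B"
  shows "integrable (lborel \<Otimes>\<^sub>M lborel)
    (\<lambda>(t, x). of_real (indicator {0<..} t * (t powr (s - 1) * heat_kernel t x)) * g x)"
    (is "integrable _ ?F")
proof (rule lborel_pair.Fubini_integrable)
  have [measurable]: "g \<in> borel_measurable borel"
    using borel_measurable_integrable[OF g] by simp
  let ?\<nu> = "real DIM('a) / 2"
  define A where "A = (4 * pi) powr (- ?\<nu>) * (LINT x|lborel. norm (g x))"
  have A: "A \<ge> 0" by (simp add: A_def Bochner_Integration.integral_nonneg)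
  have B0: "B \<ge> 0" using B[of 0] norm_ge_zero order_trans by blast
  show "?F \<in> borel_measurable (lborel \<Otimes>\<^sub>M lborel)" by measurable
  show "AE t in lborel. integrable lborel (\<lambda>x. ?F (t, x))"
  proof (intro AE_I2)
    fix t :: real
    show "integrable lborel (\<lambda>x. ?F (t, x))"
    proof (cases "t > 0")
      case True
      then show ?thesis
        using integrable_mult_right[OF heat_kernel_mult_integrable[OF True g], of "of_real (t powr (s - 1))"]
        by (simp add: mult.assoc)
    qed simp
  qed
  have inner: "(LINT x|lborel. norm (?F (t, x))) = t powr (s - 1) * (LINT x|lborel. heat_kernel t x * norm (g x))"
    if "t > 0" for t
    using that by (simp add: norm_mult heat_kernel_nonneg abs_mult mult.assoc)
  have int: "integrable lborel (\<lambda>x. heat_kernel t x * norm (g x))" if "t > 0" for t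
    using integrable_norm[OF heat_kernel_mult_integrable[OF that g]] by (simp add: norm_mult heat_kernel_nonneg)
  have b1: "(LINT x|lborel. heat_kernel t x * norm (g x)) \<le> B" if "t > 0" for t
  proof -
    have "(LINT x|lborel. heat_kernel t x * norm (g x)) \<le> (LINT x|lborel. heat_kernel t (x::'a) * B)"
      using int[OF that] has_bochner_integral_heat_kernel[OF that, where 'a='a] B
      by (intro integral_mono) (auto simp: has_bochner_integral_iff heat_kernel_nonneg intro!: mult_left_mono)
    then show ?thesis
      using has_bochner_integral_heat_kernel[OF that, where 'a='a] by (simp add: has_bochner_integral_iff)
  qed
  have b2: "(LINT x|lborel. heat_kernel t x * norm (g x)) \<le> A * t powr (- ?\<nu>)" if "t > 0" for t
  proof -
    have "(LINT x|lborel. heat_kernel t x * norm (g x))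
        \<le> (LINT x|lborel. ((4 * pi) powr (- ?\<nu>) * t powr (- ?\<nu>)) * norm (g x))"
      using int[OF that] g heat_kernel_le[OF that, where 'a='a]
      by (intro integral_mono mult_right_mono integrable_mult_right integrable_norm) auto
    then show ?thesis by (simp add: A_def mult_ac)
  qed
  \<comment> \<open>\<open>e^(-t)\<close> for \<open>t \<le> 1\<close> and \<open>e^(-1/t)\<close> for \<open>t \<ge> 1\<close> are at least \<open>1/e\<close>\<close>
  let ?w = "\<lambda>t. exp 1 * (B * macdonald_integrand s 1 0 t + A * macdonald_integrand (s - ?\<nu>) 0 1 t)"
  show "integrable lborel (\<lambda>t. LINT x|lborel. norm (?F (t, x)))"
  proof (rule Bochner_Integration.integrable_bound)
    have "integrable lborel (macdonald_integrand s 1 0)"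
      using s by (intro integrable_macdonald_integrand) auto
    moreover have "integrable lborel (macdonald_integrand (s - ?\<nu>) 0 1)"
      using has_bochner_integral_macdonald_inversion[of 1 "s - ?\<nu>" 0 "Gamma (?\<nu> - s)"]
        has_bochner_integral_macdonald_0[of 1 "?\<nu> - s"] s
      by (simp add: has_bochner_integral_iff)
    ultimately show "integrable lborel ?w" by simp
    show "(\<lambda>t. LINT x|lborel. norm (?F (t, x))) \<in> borel_measurable lborel" by measurable
    show "AE t in lborel. norm (LINT x|lborel. norm (?F (t, x))) \<le> norm (?w t)"
    proof (intro AE_I2)
      fix t :: real
      have wn: "?w t \<ge> 0" using A B0 by (simp add: macdonald_integrand_nonneg)
      have "(LINT x|lborel. norm (?F (t, x))) \<le> ?w t"
      proof -
        consider "t \<le> 0" | "0 < t" "t \<le> 1" | "1 < t" by linarith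
        then show ?thesis
        proof cases
          case 1
          then show ?thesis using wn by simp
        next
          case 2
          have "exp 1 * exp (- t) \<ge> 1" using 2 by (simp flip: exp_add)
          then have "1 * t powr (s - 1) \<le> exp 1 * exp (- t) * t powr (s - 1)"
            by (intro mult_right_mono) auto
          then have "B * t powr (s - 1) \<le> exp 1 * (B * macdonald_integrand s 1 0 t)"
            using 2 B0 mult_left_mono[of "t powr (s - 1)" "exp 1 * exp (- t) * t powr (s - 1)" B]
            by (simp add: macdonald_integrand_def mult_ac)
          also have "\<dots> \<le> ?w t" using A by (simp add: macdonald_integrand_nonneg)
          finally have "B * t powr (s - 1) \<le> ?w t" .
          moreover have "t powr (s - 1) * (LINT x|lborel. heat_kernel t x * norm (g x)) \<le> t powr (s - 1) * B"
            using b1[OF 2(1)] by (intro mult_left_mono) auto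
          ultimately show ?thesis
            unfolding inner[OF 2(1)] by (simp add: mult_ac)
        next
          case 3
          have t: "t > 0" using 3 by simp
          have "exp 1 * exp (- (1 / t)) \<ge> 1" using 3 by (simp flip: exp_add)
          then have "1 * t powr (s - ?\<nu> - 1) \<le> exp 1 * exp (- (1 / t)) * t powr (s - ?\<nu> - 1)"
            by (intro mult_right_mono) auto
          then have "A * t powr (s - ?\<nu> - 1) \<le> exp 1 * (A * macdonald_integrand (s - ?\<nu>) 0 1 t)"
            using t A mult_left_mono[of "t powr (s - ?\<nu> - 1)" "exp 1 * exp (- (1 / t)) * t powr (s - ?\<nu> - 1)" A]
            by (simp add: macdonald_integrand_def mult_ac)
          also have "\<dots> \<le> ?w t" using B0 by (simp add: macdonald_integrand_nonneg)
          finally have "A * t powr (s - ?\<nu> - 1) \<le> ?w t" .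
          moreover have "t powr (s - ?\<nu> - 1) = t powr (s - 1) * t powr (- ?\<nu>)"
            by (simp flip: powr_add add: algebra_simps)
          moreover have "t powr (s - 1) * (LINT x|lborel. heat_kernel t x * norm (g x)) \<le> t powr (s - 1) * (A * t powr (- ?\<nu>))"
            using b2[OF t] by (intro mult_left_mono) auto
          ultimately show ?thesis
            unfolding inner[OF t] by (simp add: mult_ac)
        qed
      qed
      moreover have "(LINT x|lborel. norm (?F (t, x))) \<ge> 0"
        by (intro Bochner_Integration.integral_nonneg) auto
      ultimately show "norm (LINT x|lborel. norm (?F (t, x))) \<le> norm (?w t)" by simp
    qed
  qed
qed

lemma riesz_potential_pairing:
  fixes g :: "'a::euclidean_space \<Rightarrow> complex"
  assumes s: "0 < s" "2 * s < real DIM('a)" and g: "integrable lborel g" and B: "\<And>x. norm (g x) \<le> B"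
  shows "integrable lborel (\<lambda>x. of_real (norm x powr (2 * s - real DIM('a))) * g x)"
    and "of_real (Gamma s * riesz_constant TYPE('a) s) * (LINT x|lborel. of_real (norm x powr (2 * s - real DIM('a))) * g x)
      = (LINT t|lborel. of_real (indicator {0<..} t * t powr (s - 1)) * (LINT x|lborel. of_real (heat_kernel t x) * g x))"
proof -
  have [measurable]: "g \<in> borel_measurable borel"
    using borel_measurable_integrable[OF g] by simp
  define c where "c = Gamma s * riesz_constant TYPE('a) s"
  have c: "c > 0" using s by (simp add: c_def riesz_constant_pos Gamma_real_pos)
  let ?p = "\<lambda>x::'a. norm x powr (2 * s - real DIM('a))"
  let ?F = "\<lambda>t x. complex_of_real (indicator {0<..} t * (t powr (s - 1) * heat_kernel t x)) * g x"
  note int = riesz_heat_Fubini[OF s g B]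
  have inner: "(LINT t|lborel. ?F t x) = of_real c * (of_real (?p x) * g x)" if "x \<noteq> 0" for x
  proof -
    have "(LINT t|lborel. ?F t x) = (LINT t|lborel. complex_of_real (indicator {0<..} t * (t powr (s - 1) * heat_kernel t x))) * g x"
      by (rule integral_mult_left_zero)
    also have "(LINT t|lborel. complex_of_real (indicator {0<..} t * (t powr (s - 1) * heat_kernel t x))) = of_real (c * ?p x)"
      unfolding c_def has_bochner_integral_integral_eq[OF has_bochner_integral_riesz_subordination[OF s that], symmetric]
      by (rule integral_of_real)
         (use has_bochner_integral_riesz_subordination[OF s that] in \<open>simp add: has_bochner_integral_iff\<close>)
    finally show ?thesis by simp
  qed
  have ae: "AE x in lborel. (LINT t|lborel. ?F t x) = of_real c * (of_real (?p x) * g x)"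
    using AE_lborel_singleton[of "0::'a"] by eventually_elim (rule inner)
  have "integrable lborel (\<lambda>x. of_real c * (of_real (?p x) * g x))"
    by (rule integrable_cong_AE_imp[OF lborel_pair.integrable_snd[OF int] _ ae]) measurable
  then show "integrable lborel (\<lambda>x. of_real (?p x) * g x)"
    using integrable_mult_right[of "inverse (complex_of_real c)" lborel "\<lambda>x. of_real c * (of_real (?p x) * g x)"] c
    by (simp add: mult.assoc[symmetric])
  have "of_real c * (LINT x|lborel. of_real (?p x) * g x) = (LINT x|lborel. of_real c * (of_real (?p x) * g x))"
    by simp
  also have "\<dots> = (LINT x|lborel. LINT t|lborel. ?F t x)"
    by (rule integral_cong_AE[OF _ _ AE_symmetric[OF ae]]) measurable
  also have "\<dots> = (LINT t|lborel. LINT x|lborel. ?F t x)"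
    using lborel_pair.integral_snd[OF int] lborel_pair.integral_fst[OF int] by simp
  also have "\<dots> = (LINT t|lborel. of_real (indicator {0<..} t * t powr (s - 1)) * (LINT x|lborel. of_real (heat_kernel t x) * g x))"
    by (subst integral_mult_right_zero[symmetric]) (simp add: mult_ac)
  finally show "of_real (Gamma s * riesz_constant TYPE('a) s) * (LINT x|lborel. of_real (?p x) * g x)
      = (LINT t|lborel. of_real (indicator {0<..} t * t powr (s - 1)) * (LINT x|lborel. of_real (heat_kernel t x) * g x))"
    by (simp only: c_def)
qed

text \<open>
  The symbol is itself a multiple of a Riesz kernel, of order \<open>n - 2s\<close>, so its integrability needs no new
  argument.
\<close>

lemma riesz_symbol_eq:
  fixes \<xi> :: "'a::euclidean_space"
  shows "(4 * pi\<^sup>2 * (norm \<xi>)\<^sup>2) powr (- s) = (4 * pi\<^sup>2) powr (- s) * norm \<xi> powr (2 * (real DIM('a) / 2 - s) - real DIM('a))"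
proof (cases "\<xi> = 0")
  case False
  have "((norm \<xi>)\<^sup>2) powr (- s) = norm \<xi> powr (2 * (- s))"
    using False by (simp only: powr_powr[symmetric]) simp
  moreover have "2 * (- s) = 2 * (real DIM('a) / 2 - s) - real DIM('a)"
    by simp
  ultimately show ?thesis
    by (simp add: powr_mult)
qed simp

lemma riesz_symbol_pairing:
  fixes \<phi> :: "'a::euclidean_space \<Rightarrow> complex"
  assumes s: "0 < s" "2 * s < real DIM('a)" and \<phi>: "integrable lborel \<phi>" and B: "\<And>x. norm (\<phi> x) \<le> B"
  shows "integrable lborel (\<lambda>\<xi>. of_real ((4 * pi\<^sup>2 * (norm \<xi>)\<^sup>2) powr (- s)) * \<phi> \<xi>)"
    and "(LINT t|lborel. of_real (indicator {0<..} t * t powr (s - 1)) *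
            (LINT \<xi>|lborel. of_real (exp (- 4 * pi\<^sup>2 * t * (norm \<xi>)\<^sup>2)) * \<phi> \<xi>))
      = of_real (Gamma s) * (LINT \<xi>|lborel. of_real ((4 * pi\<^sup>2 * (norm \<xi>)\<^sup>2) powr (- s)) * \<phi> \<xi>)"
proof -
  have [measurable]: "\<phi> \<in> borel_measurable borel"
    using borel_measurable_integrable[OF \<phi>] by simp
  let ?m = "\<lambda>\<xi>::'a. 4 * pi\<^sup>2 * (norm \<xi>)\<^sup>2"
  let ?F = "\<lambda>\<xi> t. complex_of_real (indicator {0<..} t * (exp (- ?m \<xi> * t) * t powr (s - 1))) * \<phi> \<xi>"
  have G: "Gamma s > 0" using s by (simp add: Gamma_real_pos)
  show i: "integrable lborel (\<lambda>\<xi>. of_real (?m \<xi> powr (- s)) * \<phi> \<xi>)"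
  proof -
    have "integrable lborel (\<lambda>\<xi>. of_real (norm \<xi> powr (2 * (real DIM('a) / 2 - s) - real DIM('a))) * \<phi> \<xi>)"
      using s by (intro riesz_potential_pairing(1)[OF _ _ \<phi> B]) auto
    then have "integrable lborel (\<lambda>\<xi>. of_real ((4 * pi\<^sup>2) powr (- s)) * (of_real (norm \<xi> powr (2 * (real DIM('a) / 2 - s) - real DIM('a))) * \<phi> \<xi>))"
      by (rule integrable_mult_right)
    moreover have "of_real (?m \<xi> powr (- s)) * \<phi> \<xi> = of_real ((4 * pi\<^sup>2) powr (- s)) *
        (of_real (norm \<xi> powr (2 * (real DIM('a) / 2 - s) - real DIM('a))) * \<phi> \<xi>)" for \<xi>
      by (subst riesz_symbol_eq) (simp only: of_real_mult mult.assoc)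
    ultimately show ?thesis by (simp only:)
  qed
  have inner: "has_bochner_integral lborel (\<lambda>t. indicator {0<..} t * (exp (- ?m \<xi> * t) * t powr (s - 1))) (Gamma s * ?m \<xi> powr (- s))"
    if "\<xi> \<noteq> 0" for \<xi>
    using that s by (intro has_bochner_integral_Gamma) auto
  have int: "integrable (lborel \<Otimes>\<^sub>M lborel) (\<lambda>(\<xi>, t). ?F \<xi> t)"
  proof (rule lborel_pair.Fubini_integrable)
    show "(\<lambda>(\<xi>, t). ?F \<xi> t) \<in> borel_measurable (lborel \<Otimes>\<^sub>M lborel)" by measurable
    show "AE \<xi> in lborel. integrable lborel (\<lambda>t. case (\<xi>, t) of (\<xi>, t) \<Rightarrow> ?F \<xi> t)"
      using AE_lborel_singleton[of "0::'a"]
    proof eventually_elim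
      case (elim \<xi>)
      then show ?case
        using inner[of \<xi>] unfolding prod.case
        by (intro integrable_mult_left integrable_of_real) (simp add: has_bochner_integral_iff)
    qed
    have "AE \<xi> in lborel. norm (of_real (Gamma s) * (of_real (?m \<xi> powr (- s)) * \<phi> \<xi>)) = (LINT t|lborel. norm (?F \<xi> t))"
      using AE_lborel_singleton[of "0::'a"]
    proof eventually_elim
      case (elim \<xi>)
      have "norm (?F \<xi> t) = indicator {0<..} t * (exp (- ?m \<xi> * t) * t powr (s - 1)) * norm (\<phi> \<xi>)" for t
        by (simp add: norm_mult abs_mult)
      then show ?case
        using inner[OF elim] G by (simp add: norm_mult has_bochner_integral_iff)
    qed
    then show "integrable lborel (\<lambda>\<xi>. LINT t|lborel. norm (case (\<xi>, t) of (\<xi>, t) \<Rightarrow> ?F \<xi> t))"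
      unfolding prod.case
      by (intro integrable_cong_AE_imp[OF integrable_norm[OF integrable_mult_right[OF i]]]) measurable
  qed
  have "(LINT t|lborel. of_real (indicator {0<..} t * t powr (s - 1)) *
            (LINT \<xi>|lborel. of_real (exp (- 4 * pi\<^sup>2 * t * (norm \<xi>)\<^sup>2)) * \<phi> \<xi>)) = (LINT t|lborel. LINT \<xi>|lborel. ?F \<xi> t)"
    by (subst integral_mult_right_zero[symmetric]) (simp add: mult_ac)
  also have "\<dots> = (LINT \<xi>|lborel. LINT t|lborel. ?F \<xi> t)"
    using lborel_pair.integral_snd[OF int] lborel_pair.integral_fst[OF int] by simp
  also have "\<dots> = (LINT \<xi>|lborel. of_real (Gamma s) * (of_real (?m \<xi> powr (- s)) * \<phi> \<xi>))"
  proof (rule integral_cong_AE)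
    show "AE \<xi> in lborel. (LINT t|lborel. ?F \<xi> t) = of_real (Gamma s) * (of_real (?m \<xi> powr (- s)) * \<phi> \<xi>)"
      using AE_lborel_singleton[of "0::'a"]
    proof eventually_elim
      case (elim \<xi>)
      have "(LINT t|lborel. ?F \<xi> t) = (LINT t|lborel. complex_of_real (indicator {0<..} t * (exp (- ?m \<xi> * t) * t powr (s - 1)))) * \<phi> \<xi>"
        by (rule integral_mult_left_zero)
      also have "(LINT t|lborel. complex_of_real (indicator {0<..} t * (exp (- ?m \<xi> * t) * t powr (s - 1)))) = of_real (Gamma s * ?m \<xi> powr (- s))"
        unfolding has_bochner_integral_integral_eq[OF inner[OF elim], symmetric]
        by (rule integral_of_real) (use inner[OF elim] in \<open>simp add: has_bochner_integral_iff\<close>)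
      finally show ?case by simp
    qed
  qed measurable
  finally show "(LINT t|lborel. of_real (indicator {0<..} t * t powr (s - 1)) *
            (LINT \<xi>|lborel. of_real (exp (- 4 * pi\<^sup>2 * t * (norm \<xi>)\<^sup>2)) * \<phi> \<xi>))
      = of_real (Gamma s) * (LINT \<xi>|lborel. of_real (?m \<xi> powr (- s)) * \<phi> \<xi>)"
    by simp
qed

lemma norm_fourier_le: "norm (fourier f \<xi>) \<le> (LINT x|lborel. norm (f x))"
proof -
  have "norm (fourier f \<xi>) \<le> (LINT x|lborel. norm (f x * cis (- 2 * pi * (x \<bullet> \<xi>))))"
    unfolding fourier_def by (rule integral_norm_bound)
  then show ?thesis by (simp add: norm_mult)
qed

text \<open>
  Both sides, multiplied by \<open>\<Gamma>(s)\<close>, are the time integral of the multiplication formula for the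
  heat kernel and \<open>\<phi>\<close>.
\<close>

lemma riesz_fourier_pairing:
  fixes \<phi> :: "'a::euclidean_space \<Rightarrow> complex"
  assumes s: "0 < s" "2 * s < real DIM('a)" and \<phi>: "integrable lborel \<phi>" and B: "\<And>x. norm (\<phi> x) \<le> B"
    and \<phi>': "integrable lborel (fourier \<phi>)"
  shows "(LINT x|lborel. of_real (riesz_constant TYPE('a) s * norm x powr (2 * s - real DIM('a))) * fourier \<phi> x)
      = (LINT \<xi>|lborel. of_real ((4 * pi\<^sup>2 * (norm \<xi>)\<^sup>2) powr (- s)) * \<phi> \<xi>)"
proof -
  have G: "Gamma s \<noteq> 0" using Gamma_real_pos[OF s(1)] by (metis less_irrefl)
  have heat: "(LINT x|lborel. of_real (heat_kernel t x) * fourier \<phi> x)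
      = (LINT \<xi>|lborel. of_real (exp (- 4 * pi\<^sup>2 * t * (norm \<xi>)\<^sup>2)) * \<phi> \<xi>)" if "t > 0" for t
  proof -
    have i: "integrable lborel (\<lambda>x::'a. complex_of_real (heat_kernel t x))"
      using has_bochner_integral_heat_kernel[OF that, where 'a='a]
      by (intro integrable_of_real) (simp add: has_bochner_integral_iff)
    have "fourier (\<lambda>x::'a. of_real (heat_kernel t x)) \<xi> = of_real (exp (- 4 * pi\<^sup>2 * t * (norm \<xi>)\<^sup>2))" for \<xi>
      unfolding fourier_def by (rule has_bochner_integral_integral_eq[OF heat_kernel_fourier[OF that]])
    then show ?thesis
      using fourier_multiplication[OF i \<phi>] by simp
  qed
  have "of_real (Gamma s) * (of_real (riesz_constant TYPE('a) s) * (LINT x|lborel. of_real (norm x powr (2 * s - real DIM('a))) * fourier \<phi> x))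
      = (LINT t|lborel. of_real (indicator {0<..} t * t powr (s - 1)) * (LINT x|lborel. of_real (heat_kernel t x) * fourier \<phi> x))"
    using riesz_potential_pairing(2)[OF s \<phi>' norm_fourier_le] by (simp add: mult.assoc)
  also have "\<dots> = (LINT t|lborel. of_real (indicator {0<..} t * t powr (s - 1)) *
            (LINT \<xi>|lborel. of_real (exp (- 4 * pi\<^sup>2 * t * (norm \<xi>)\<^sup>2)) * \<phi> \<xi>))"
    by (intro Bochner_Integration.integral_cong refl) (simp add: heat indicator_def)
  also have "\<dots> = of_real (Gamma s) * (LINT \<xi>|lborel. of_real ((4 * pi\<^sup>2 * (norm \<xi>)\<^sup>2) powr (- s)) * \<phi> \<xi>)"
    by (rule riesz_symbol_pairing(2)[OF s \<phi> B])
  finally show ?thesis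
    using G by (simp add: mult.assoc)
qed


section \<open>Fourier transforms of Schwartz functions\<close>

lemma iter_deriv_append: "iter_deriv (cs @ bs) f = iter_deriv cs (iter_deriv bs f)"
  by (induction cs) auto

lemma schwartz_iter_deriv:
  assumes "\<phi> \<in> schwartz" "set bs \<subseteq> Basis"
  shows "iter_deriv bs \<phi> \<in> schwartz"
  using assms unfolding schwartz_def by (auto simp flip: iter_deriv_append)

lemma schwartz_differentiable: "\<phi> \<in> schwartz \<Longrightarrow> \<phi> differentiable (at x)"
  unfolding schwartz_def by (auto dest: spec[of _ "[]"])

lemma schwartz_decay:
  fixes \<phi> :: "'a::euclidean_space \<Rightarrow> complex"
  assumes "\<phi> \<in> schwartz"
  obtains C where "C \<ge> 0" "\<And>x. norm (\<phi> x) \<le> C / (1 + norm x) ^ N"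
proof -
  have b: "\<exists>C. \<forall>x. norm x ^ k * norm (\<phi> x) \<le> C" for k :: nat
    using assms unfolding schwartz_def by (auto dest: spec[of _ "[]"])
  from b[of 0] obtain C0 where C0: "norm (\<phi> x) \<le> C0" for x by auto
  from b[of N] obtain C1 where C1: "norm x ^ N * norm (\<phi> x) \<le> C1" for x by auto
  have bd: "norm (\<phi> x) \<le> 2 ^ N * (C0 + C1) / (1 + norm x) ^ N" for x
  proof -
    have "(1 + norm x) ^ N \<le> (2 * max 1 (norm x)) ^ N"
      by (intro power_mono) auto
    also have "\<dots> \<le> 2 ^ N * (1 + norm x ^ N)"
      by (auto simp: power_mult_distrib max_def)
    finally have "(1 + norm x) ^ N * norm (\<phi> x) \<le> 2 ^ N * (1 + norm x ^ N) * norm (\<phi> x)"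
      by (rule mult_right_mono) simp
    also have "\<dots> \<le> 2 ^ N * (C0 + C1)"
      using C0[of x] C1[of x] by (simp add: algebra_simps add_mono)
    finally show ?thesis by (simp add: field_simps add_pos_nonneg)
  qed
  have "0 \<le> C0 + C1"
    using C0[of 0] C1[of 0] order_trans[OF norm_ge_zero C0[of 0]]
      order_trans[OF mult_nonneg_nonneg[OF zero_le_power[OF norm_ge_zero] norm_ge_zero] C1[of 0]] by simp
  then show ?thesis using that[of "2 ^ N * (C0 + C1)"] bd by simp
qed

lemma schwartz_bounded:
  assumes "\<phi> \<in> schwartz"
  obtains B where "\<And>x. norm (\<phi> x) \<le> B"
  using schwartz_decay[OF assms, of 0] by auto

lemma lborel_integral_translation:
  fixes f :: "'a::euclidean_space \<Rightarrow> complex"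
  assumes [measurable]: "f \<in> borel_measurable borel"
  shows "(LINT x|lborel. f (v + x)) = (LINT x|lborel. f x)"
proof -
  have "(LINT x|lborel. f x) = (LINT x|distr lborel borel ((+) v). f x)"
    by (simp add: lborel_distr_plus)
  also have "\<dots> = (LINT x|lborel. f (v + x))"
    by (rule integral_distr) auto
  finally show ?thesis by simp
qed

lemma lborel_integrable_translation:
  fixes f :: "'a::euclidean_space \<Rightarrow> complex"
  assumes "integrable lborel f"
  shows "integrable lborel (\<lambda>x. f (v + x))"
proof -
  have [measurable]: "f \<in> borel_measurable borel" using borel_measurable_integrable[OF assms] by simp
  have "integrable (distr lborel borel ((+) v)) f"
    using assms by (simp add: lborel_distr_plus)
  then show ?thesis
    by (subst (asm) integrable_distr_eq) auto
qed

lemma has_vector_derivative_sequential_quotient: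
  fixes f :: "real \<Rightarrow> 'b::real_normed_vector"
  assumes f: "(f has_vector_derivative d) (at 0)" and h: "\<And>k. 0 < h k" "h \<longlonglongrightarrow> 0"
  shows "(\<lambda>k. (f (h k) - f 0) /\<^sub>R h k) \<longlonglongrightarrow> d"
proof -
  have "((\<lambda>u. norm (f u - f 0 - u *\<^sub>R d) / norm u) \<longlongrightarrow> 0) (at 0)"
    using f by (simp add: has_vector_derivative_def has_derivative_at)
  moreover have "filterlim h (at 0) sequentially"
    using h by (auto simp: filterlim_at less_imp_neq[symmetric] intro!: always_eventually)
  ultimately have "(\<lambda>k. norm (f (h k) - f 0 - h k *\<^sub>R d) / norm (h k)) \<longlonglongrightarrow> 0"
    by (rule filterlim_compose)
  moreover have "norm (f (h k) - f 0 - h k *\<^sub>R d) / norm (h k) = norm ((f (h k) - f 0) /\<^sub>R h k - d)" for k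
  proof -
    have "(f (h k) - f 0) /\<^sub>R h k - d = (f (h k) - f 0 - h k *\<^sub>R d) /\<^sub>R h k"
      using h(1)[of k] by (simp add: scaleR_diff_right)
    then show ?thesis using h(1)[of k] by (simp add: divide_inverse mult.commute)
  qed
  ultimately have "(\<lambda>k. norm ((f (h k) - f 0) /\<^sub>R h k - d)) \<longlonglongrightarrow> 0" by simp
  then have "(\<lambda>k. (f (h k) - f 0) /\<^sub>R h k - d) \<longlonglongrightarrow> 0" by (simp only: tendsto_norm_zero_iff)
  then show ?thesis by (rule LIM_zero_cancel)
qed

lemma has_derivative_along:
  fixes \<phi> :: "'a::euclidean_space \<Rightarrow> complex"
  assumes "\<phi> differentiable (at (u *\<^sub>R b + x))"
  shows "((\<lambda>u::real. \<phi> (u *\<^sub>R b + x)) has_derivative (\<lambda>h. h *\<^sub>R iter_deriv [b] \<phi> (u *\<^sub>R b + x))) (at u within S)"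
proof -
  let ?D = "frechet_derivative \<phi> (at (u *\<^sub>R b + x))"
  have D: "(\<phi> has_derivative ?D) (at (u *\<^sub>R b + x))"
    using assms by (simp add: frechet_derivative_works)
  have "((\<lambda>u::real. u *\<^sub>R b + x) has_derivative (\<lambda>h. h *\<^sub>R b)) (at u within S)"
    by (auto intro!: derivative_eq_intros)
  from has_derivative_compose[OF this D] have "((\<lambda>u::real. \<phi> (u *\<^sub>R b + x)) has_derivative (\<lambda>h. ?D (h *\<^sub>R b))) (at u within S)" .
  moreover have "?D (h *\<^sub>R b) = h *\<^sub>R ?D b" for h
    using linear_frechet_derivative[OF assms] by (simp add: linear_cmul)
  ultimately show ?thesis by simp
qed

text \<open>
  Difference quotients replace integration by parts: translating \<open>\<phi>\<close> multiplies its transform by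
  a character, so the transform of the quotient is explicit, and the mean value theorem
  together with the decay of the derivative provides the majorant for the limit.
\<close>

lemma fourier_deriv:
  fixes \<phi> :: "'a::euclidean_space \<Rightarrow> complex"
  assumes \<phi>: "\<phi> \<in> schwartz" and b: "b \<in> Basis"
  shows "fourier (iter_deriv [b] \<phi>) \<xi> = 2 * pi * \<i> * (\<xi> \<bullet> b) * fourier \<phi> \<xi>"
proof -
  define \<psi> where "\<psi> = iter_deriv [b] \<phi>"
  have \<psi>: "\<psi> \<in> schwartz" unfolding \<psi>_def using \<phi> b by (intro schwartz_iter_deriv) auto
  note int\<phi> = integrable_schwartz[OF \<phi>] and int\<psi> = integrable_schwartz[OF \<psi>]
  have [measurable]: "\<phi> \<in> borel_measurable borel" "\<psi> \<in> borel_measurable borel"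
    using borel_measurable_integrable[OF int\<phi>] borel_measurable_integrable[OF int\<psi>] by auto
  let ?N = "2 * DIM('a)"
  obtain C where C: "C \<ge> 0" "\<And>x. norm (\<psi> x) \<le> C / (1 + norm x) ^ ?N"
    by (rule schwartz_decay[OF \<psi>]) blast
  \<comment> \<open>step sizes of the difference quotients\<close>
  define h where "h = (\<lambda>k. 1 / real (Suc k))"
  have h: "0 < h k" "h k \<le> 1" for k by (auto simp: h_def)
  have h0: "h \<longlonglongrightarrow> 0" unfolding h_def by real_asymp
  define D where "D = (\<lambda>k x. (\<phi> (h k *\<^sub>R b + x) - \<phi> x) /\<^sub>R h k)"
  have along: "((\<lambda>u::real. \<phi> (u *\<^sub>R b + x)) has_derivative (\<lambda>h. h *\<^sub>R \<psi> (u *\<^sub>R b + x))) (at u within S)" for u x S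
    unfolding \<psi>_def using schwartz_differentiable[OF \<phi>] by (rule has_derivative_along)
  have lim: "(\<lambda>k. LINT x|lborel. D k x * cis (- 2 * pi * (x \<bullet> \<xi>))) \<longlonglongrightarrow> (LINT x|lborel. \<psi> x * cis (- 2 * pi * (x \<bullet> \<xi>)))"
  proof (rule integral_dominated_convergence)
    show "integrable lborel (\<lambda>x::'a. 2 ^ ?N * C * (1 / (1 + norm x) ^ ?N))"
      by (intro integrable_mult_right integrable_polynomial_weight)
    show "AE x in lborel. (\<lambda>k. D k x * cis (- 2 * pi * (x \<bullet> \<xi>))) \<longlonglongrightarrow> \<psi> x * cis (- 2 * pi * (x \<bullet> \<xi>))"
    proof (intro AE_I2 tendsto_mult tendsto_const)
      fix x
      have "((\<lambda>u. \<phi> (u *\<^sub>R b + x)) has_vector_derivative \<psi> x) (at 0)"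
        using along[of x 0 UNIV] by (simp add: has_vector_derivative_def)
      from has_vector_derivative_sequential_quotient[OF this h(1) h0]
      show "(\<lambda>k. D k x) \<longlonglongrightarrow> \<psi> x" by (simp add: D_def)
    qed
    show "AE x in lborel. norm (D k x * cis (- 2 * pi * (x \<bullet> \<xi>))) \<le> 2 ^ ?N * C * (1 / (1 + norm x) ^ ?N)" for k
    proof (intro AE_I2)
      fix x
      have bd: "norm (\<psi> (u *\<^sub>R b + x)) \<le> 2 ^ ?N * C * (1 / (1 + norm x) ^ ?N)" if u: "u \<in> {0..h k}" for u
      proof -
        have "norm (u *\<^sub>R b) \<le> 1" using u h(2)[of k] b by simp
        moreover have "norm x \<le> norm (u *\<^sub>R b + x) + norm (u *\<^sub>R b)"
          using norm_triangle_ineq4[of "u *\<^sub>R b + x" "u *\<^sub>R b"] by simp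
        moreover have "norm (u *\<^sub>R b + x) \<ge> 0" by simp
        moreover have "n \<le> A + B \<Longrightarrow> B \<le> 1 \<Longrightarrow> A \<ge> 0 \<Longrightarrow> 1 + n \<le> 2 * (1 + A)" for n A B :: real
          by simp
        ultimately have "1 + norm x \<le> 2 * (1 + norm (u *\<^sub>R b + x))" by blast
        then have "(1 + norm x) ^ ?N \<le> 2 ^ ?N * (1 + norm (u *\<^sub>R b + x)) ^ ?N"
          unfolding power_mult_distrib[symmetric] by (intro power_mono) auto
        then have "1 / (1 + norm (u *\<^sub>R b + x)) ^ ?N \<le> 2 ^ ?N * (1 / (1 + norm x) ^ ?N)"
          by (simp add: field_simps add_pos_nonneg)
        then have "C * (1 / (1 + norm (u *\<^sub>R b + x)) ^ ?N) \<le> C * (2 ^ ?N * (1 / (1 + norm x) ^ ?N))"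
          using C(1) by (rule mult_left_mono)
        with C(2)[of "u *\<^sub>R b + x"] show ?thesis by (simp add: mult_ac)
      qed
      have "norm (\<phi> (h k *\<^sub>R b + x) - \<phi> (0 *\<^sub>R b + x)) \<le> 2 ^ ?N * C * (1 / (1 + norm x) ^ ?N) * norm (h k - 0)"
      proof (rule differentiable_bound[where S = "{0..h k}" and f = "\<lambda>u. \<phi> (u *\<^sub>R b + x)"])
        show "((\<lambda>u. \<phi> (u *\<^sub>R b + x)) has_derivative (\<lambda>h. h *\<^sub>R \<psi> (u *\<^sub>R b + x))) (at u within {0..h k})" for u
          by (rule along)
        show "onorm (\<lambda>h. h *\<^sub>R \<psi> (u *\<^sub>R b + x)) \<le> 2 ^ ?N * C * (1 / (1 + norm x) ^ ?N)" if "u \<in> {0..h k}" for u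
        proof (rule onorm_le)
          fix v :: real
          show "norm (v *\<^sub>R \<psi> (u *\<^sub>R b + x)) \<le> 2 ^ ?N * C * (1 / (1 + norm x) ^ ?N) * norm v"
            using mult_right_mono[OF bd[OF that], of "norm v"]
            unfolding norm_scaleR real_norm_def mult.commute[of "\<bar>v\<bar>"] by simp
        qed
      qed (use h(1)[of k] in auto)
      then have "norm (\<phi> (h k *\<^sub>R b + x) - \<phi> x) / h k \<le> 2 ^ ?N * C * (1 / (1 + norm x) ^ ?N)"
        using h(1)[of k] by (simp add: divide_le_eq)
      then show "norm (D k x * cis (- 2 * pi * (x \<bullet> \<xi>))) \<le> 2 ^ ?N * C * (1 / (1 + norm x) ^ ?N)"
        using h(1)[of k] by (simp add: D_def norm_mult divide_inverse mult.commute)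
    qed
  qed (unfold D_def, measurable)
  have intc: "integrable lborel (\<lambda>x. f x * cis (- 2 * pi * (x \<bullet> \<xi>)))" if f: "integrable lborel f" for f :: "'a \<Rightarrow> complex"
    using borel_measurable_integrable[OF f]
    by (intro Bochner_Integration.integrable_bound[OF f]) (auto simp: norm_mult)
  have eq: "(LINT x|lborel. D k x * cis (- 2 * pi * (x \<bullet> \<xi>))) = (cis (2 * pi * (h k * (\<xi> \<bullet> b))) - 1) /\<^sub>R h k * fourier \<phi> \<xi>" for k
  proof -
    have "(LINT x|lborel. \<phi> (h k *\<^sub>R b + x) * cis (- 2 * pi * (x \<bullet> \<xi>)))
        = (LINT x|lborel. \<phi> (h k *\<^sub>R b + x) * (cis (2 * pi * (h k * (\<xi> \<bullet> b))) * cis (- 2 * pi * ((h k *\<^sub>R b + x) \<bullet> \<xi>))))"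
      by (intro Bochner_Integration.integral_cong refl) (simp add: cis_mult inner_commute algebra_simps)
    also have "\<dots> = (LINT x|lborel. \<phi> x * (cis (2 * pi * (h k * (\<xi> \<bullet> b))) * cis (- 2 * pi * (x \<bullet> \<xi>))))"
      by (rule lborel_integral_translation) measurable
    also have "\<dots> = cis (2 * pi * (h k * (\<xi> \<bullet> b))) * fourier \<phi> \<xi>"
      unfolding fourier_def by (subst integral_mult_right_zero[symmetric]) (simp only: mult_ac)
    finally have 1: "(LINT x|lborel. \<phi> (h k *\<^sub>R b + x) * cis (- 2 * pi * (x \<bullet> \<xi>))) = cis (2 * pi * (h k * (\<xi> \<bullet> b))) * fourier \<phi> \<xi>" .
    have "(LINT x|lborel. D k x * cis (- 2 * pi * (x \<bullet> \<xi>)))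
      = (LINT x|lborel. (\<phi> (h k *\<^sub>R b + x) * cis (- 2 * pi * (x \<bullet> \<xi>)) - \<phi> x * cis (- 2 * pi * (x \<bullet> \<xi>))) /\<^sub>R h k)"
      by (intro Bochner_Integration.integral_cong refl) (simp add: D_def left_diff_distrib)
    also have "\<dots> = ((LINT x|lborel. \<phi> (h k *\<^sub>R b + x) * cis (- 2 * pi * (x \<bullet> \<xi>))) - fourier \<phi> \<xi>) /\<^sub>R h k"
      unfolding fourier_def integral_scaleR_right
      by (subst Bochner_Integration.integral_diff) (intro intc lborel_integrable_translation int\<phi> refl)+
    finally show ?thesis unfolding 1 by (simp add: left_diff_distrib)
  qed
  have "(\<lambda>k. (cis (2 * pi * (h k * (\<xi> \<bullet> b))) - 1) /\<^sub>R h k * fourier \<phi> \<xi>) \<longlonglongrightarrow> 2 * pi * \<i> * (\<xi> \<bullet> b) * fourier \<phi> \<xi>"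
  proof (intro tendsto_mult tendsto_const)
    have "((\<lambda>z. exp (\<i> * (2 * pi * (\<xi> \<bullet> b)) * z)) has_field_derivative \<i> * (2 * pi * (\<xi> \<bullet> b))) (at (of_real 0))"
      by (auto intro!: derivative_eq_intros)
    from has_vector_derivative_real_field[OF this]
    have "((\<lambda>u. cis (2 * pi * (u * (\<xi> \<bullet> b)))) has_vector_derivative \<i> * (2 * pi * (\<xi> \<bullet> b))) (at 0)"
      by (simp add: cis_conv_exp mult_ac)
    from has_vector_derivative_sequential_quotient[OF this h(1) h0]
    show "(\<lambda>k. (cis (2 * pi * (h k * (\<xi> \<bullet> b))) - 1) /\<^sub>R h k) \<longlonglongrightarrow> 2 * pi * \<i> * (\<xi> \<bullet> b)"
      by (simp add: mult_ac)
  qed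
  with lim eq show ?thesis
    unfolding \<psi>_def[symmetric] fourier_def[of \<psi>] by (simp add: LIMSEQ_unique)
qed

lemma fourier_iter_deriv:
  fixes \<phi> :: "'a::euclidean_space \<Rightarrow> complex"
  assumes \<phi>: "\<phi> \<in> schwartz" and b: "b \<in> Basis"
  shows "fourier (iter_deriv (replicate N b) \<phi>) \<xi> = (2 * pi * \<i> * (\<xi> \<bullet> b)) ^ N * fourier \<phi> \<xi>"
proof (induction N)
  case (Suc N)
  have "iter_deriv (replicate N b) \<phi> \<in> schwartz"
    using \<phi> b by (intro schwartz_iter_deriv) auto
  from fourier_deriv[OF this b] Suc show ?case by (simp add: mult_ac)
qed simp

lemma measurable_fourier:
  assumes [measurable]: "f \<in> borel_measurable borel"
  shows "fourier f \<in> borel_measurable borel"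
  unfolding fourier_def[abs_def] by measurable

text \<open>
  Some coordinate of \<open>\<xi>\<close> is at least \<open>|\<xi>|/n\<close>; applying \<open>2n\<close> derivatives in that direction bounds
  the transform by a multiple of \<open>|\<xi>|^(-2n)\<close>.
\<close>

lemma integrable_fourier_schwartz:
  fixes \<phi> :: "'a::euclidean_space \<Rightarrow> complex"
  assumes \<phi>: "\<phi> \<in> schwartz"
  shows "integrable lborel (fourier \<phi>)"
proof -
  let ?n = "real DIM('a)" and ?N = "2 * DIM('a)"
  define A where "A = (\<lambda>b. LINT x|lborel. norm (iter_deriv (replicate ?N b) \<phi> x))"
  define A0 where "A0 = (LINT x|lborel. norm (\<phi> x))"
  have A: "A b \<ge> 0" "A0 \<ge> 0" for b by (auto simp: A_def A0_def intro!: Bochner_Integration.integral_nonneg)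
  have coord: "\<bar>\<xi> \<bullet> b\<bar> ^ ?N * norm (fourier \<phi> \<xi>) \<le> A b" if b: "b \<in> Basis" for b \<xi>
  proof -
    have "\<bar>\<xi> \<bullet> b\<bar> ^ ?N \<le> (2 * pi * \<bar>\<xi> \<bullet> b\<bar>) ^ ?N"
      using mult_right_mono[of 1 "2 * pi" "\<bar>\<xi> \<bullet> b\<bar>"] pi_ge_two by (intro power_mono) auto
    then have "\<bar>\<xi> \<bullet> b\<bar> ^ ?N * norm (fourier \<phi> \<xi>) \<le> (2 * pi * \<bar>\<xi> \<bullet> b\<bar>) ^ ?N * norm (fourier \<phi> \<xi>)"
      by (rule mult_right_mono) simp
    also have "\<dots> = norm (fourier (iter_deriv (replicate ?N b) \<phi>) \<xi>)"
      unfolding fourier_iter_deriv[OF \<phi> b] by (simp add: norm_mult norm_power)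
    also have "\<dots> \<le> A b"
      unfolding A_def by (rule norm_fourier_le)
    finally show ?thesis .
  qed
  define C where "C = (2 * ?n) ^ ?N * (A0 + (\<Sum>b\<in>(Basis::'a set). A b))"
  have n1: "?n \<ge> 1" by (simp add: Suc_leI)
  have S0: "(\<Sum>b\<in>(Basis::'a set). A b) \<ge> 0" using A by (intro sum_nonneg) auto
  have bound: "norm (fourier \<phi> \<xi>) \<le> C * (1 / (1 + norm \<xi>) ^ ?N)" for \<xi>
  proof -
    have "(1 + norm \<xi>) ^ ?N * norm (fourier \<phi> \<xi>) \<le> C"
    proof (cases "norm \<xi> \<le> 1")
      case True
      have "1 + norm \<xi> \<le> 2 * ?n"
        using True n1 by linarith
      then have "(1 + norm \<xi>) ^ ?N \<le> (2 * ?n) ^ ?N"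
        by (intro power_mono) auto
      moreover have "norm (fourier \<phi> \<xi>) \<le> A0 + (\<Sum>b\<in>(Basis::'a set). A b)"
        using norm_fourier_le[of \<phi> \<xi>] S0 by (simp add: A0_def)
      ultimately show ?thesis
        unfolding C_def by (intro mult_mono) auto
    next
      case False
      have "\<exists>b\<in>Basis. norm \<xi> / ?n \<le> \<bar>\<xi> \<bullet> b\<bar>"
      proof (rule ccontr)
        assume "\<not> ?thesis"
        then have "(\<Sum>b\<in>Basis. \<bar>\<xi> \<bullet> b\<bar>) < (\<Sum>b\<in>(Basis::'a set). norm \<xi> / ?n)"
          by (intro sum_strict_mono) auto
        with norm_le_l1[of \<xi>] show False by simp
      qed
      then obtain b where b: "b \<in> Basis" "norm \<xi> / ?n \<le> \<bar>\<xi> \<bullet> b\<bar>" by blast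
      have "1 + norm \<xi> \<le> 2 * norm \<xi>" using False by simp
      also have "\<dots> \<le> 2 * (?n * \<bar>\<xi> \<bullet> b\<bar>)" using b(2) n1 by (simp add: field_simps)
      finally have "(1 + norm \<xi>) ^ ?N \<le> (2 * ?n * \<bar>\<xi> \<bullet> b\<bar>) ^ ?N"
        by (intro power_mono) (auto simp: mult.assoc)
      then have "(1 + norm \<xi>) ^ ?N * norm (fourier \<phi> \<xi>) \<le> (2 * ?n * \<bar>\<xi> \<bullet> b\<bar>) ^ ?N * norm (fourier \<phi> \<xi>)"
        by (rule mult_right_mono) simp
      also have "\<dots> = (2 * ?n) ^ ?N * (\<bar>\<xi> \<bullet> b\<bar> ^ ?N * norm (fourier \<phi> \<xi>))"
        by (simp add: power_mult_distrib)
      also have "\<dots> \<le> (2 * ?n) ^ ?N * (A0 + (\<Sum>b\<in>(Basis::'a set). A b))"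
      proof (rule mult_left_mono)
        have "A b \<le> (\<Sum>b\<in>(Basis::'a set). A b)"
          using A b(1) by (intro member_le_sum) auto
        then show "\<bar>\<xi> \<bullet> b\<bar> ^ ?N * norm (fourier \<phi> \<xi>) \<le> A0 + (\<Sum>b\<in>(Basis::'a set). A b)"
          using coord[OF b(1), of \<xi>] A(2) by linarith
      qed simp
      finally show ?thesis by (simp add: C_def)
    qed
    then show ?thesis by (simp add: field_simps add_pos_nonneg)
  qed
  have C0: "C \<ge> 0" using S0 A by (simp add: C_def)
  have meas: "fourier \<phi> \<in> borel_measurable lborel"
    using borel_measurable_integrable[OF integrable_schwartz[OF \<phi>]] by (simp add: measurable_fourier)
  show ?thesis
  proof (rule Bochner_Integration.integrable_bound[OF integrable_mult_right[OF integrable_polynomial_weight, of C] meas])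
    show "AE \<xi> in lborel. norm (fourier \<phi> \<xi>) \<le> norm (C * (1 / (1 + norm \<xi>) ^ ?N))"
      using bound C0 by (intro AE_I2) (simp add: abs_mult)
  qed
qed

section \<open>Gaussians are Schwartz functions\<close>

lemma real_polynomial_function_directional_derivative:
  fixes p :: "'a::real_normed_vector \<Rightarrow> real"
  assumes "real_polynomial_function p"
  obtains p' where "real_polynomial_function p'" "\<And>x. \<exists>D. (p has_derivative D) (at x) \<and> D b = p' x"
proof -
  have "\<exists>p'. real_polynomial_function p' \<and> (\<forall>x. \<exists>D. (p has_derivative D) (at x) \<and> D b = p' x)"
    using assms
  proof induction
    case (linear f)
    then show ?case
      by (intro exI[of _ "\<lambda>x. f b"]) (auto intro: bounded_linear_imp_has_derivative)
  next
    case (const c)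
    show ?case
      by (intro exI[of _ "\<lambda>x. 0"]) (auto intro!: exI[of _ "\<lambda>h. 0"])
  next
    case (add f g)
    then obtain f' g' where *: "real_polynomial_function f'" "real_polynomial_function g'"
      and f: "\<And>x. \<exists>D. (f has_derivative D) (at x) \<and> D b = f' x" and g: "\<And>x. \<exists>D. (g has_derivative D) (at x) \<and> D b = g' x"
      by blast
    have "\<exists>D. ((\<lambda>x. f x + g x) has_derivative D) (at x) \<and> D b = f' x + g' x" for x
    proof -
      obtain D E where "(f has_derivative D) (at x)" "D b = f' x" "(g has_derivative E) (at x)" "E b = g' x"
        using f g by blast
      then show ?thesis
        by (intro exI[of _ "\<lambda>h. D h + E h"]) (auto intro: has_derivative_add)
    qed
    with * show ?case by (intro exI[of _ "\<lambda>x. f' x + g' x"]) auto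
  next
    case (mult f g)
    then obtain f' g' where *: "real_polynomial_function f'" "real_polynomial_function g'"
      and f: "\<And>x. \<exists>D. (f has_derivative D) (at x) \<and> D b = f' x" and g: "\<And>x. \<exists>D. (g has_derivative D) (at x) \<and> D b = g' x"
      by blast
    have "\<exists>D. ((\<lambda>x. f x * g x) has_derivative D) (at x) \<and> D b = f x * g' x + f' x * g x" for x
    proof -
      obtain D E where "(f has_derivative D) (at x)" "D b = f' x" "(g has_derivative E) (at x)" "E b = g' x"
        using f g by blast
      then show ?thesis
        by (intro exI[of _ "\<lambda>h. f x * E h + D h * g x"]) (auto intro: has_derivative_mult)
    qed
    with * mult show ?case by (intro exI[of _ "\<lambda>x. f x * g' x + f' x * g x"]) auto
  qed
  then show ?thesis using that by blast
qed

lemma real_polynomial_function_growth: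
  fixes p :: "'a::real_normed_vector \<Rightarrow> real"
  assumes "real_polynomial_function p"
  shows "\<exists>C N. C \<ge> 0 \<and> (\<forall>x. \<bar>p x\<bar> \<le> C * (1 + norm x) ^ N)"
  using assms
proof induction
  case (linear f)
  then obtain K where K: "K \<ge> 0" "\<And>x. norm (f x) \<le> norm x * K" using bounded_linear.nonneg_bounded by blast
  have "\<bar>f x\<bar> \<le> K * (1 + norm x) ^ 1" for x
    using K(2)[of x] K(1) by (simp add: algebra_simps)
  with K(1) show ?case by blast
next
  case (const c)
  show ?case by (intro exI[of _ "\<bar>c\<bar>"] exI[of _ 0]) auto
next
  case (add f g)
  then obtain C N D M where f: "C \<ge> 0" "\<And>x. \<bar>f x\<bar> \<le> C * (1 + norm x) ^ N" and g: "D \<ge> 0" "\<And>x. \<bar>g x\<bar> \<le> D * (1 + norm x) ^ M"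
    by blast
  have "\<bar>f x + g x\<bar> \<le> (C + D) * (1 + norm x) ^ (N + M)" for x
  proof -
    have "C * (1 + norm x) ^ N \<le> C * (1 + norm x) ^ (N + M)" "D * (1 + norm x) ^ M \<le> D * (1 + norm x) ^ (N + M)"
      using f(1) g(1) by (auto intro!: mult_left_mono power_increasing)
    with f(2)[of x] g(2)[of x] show ?thesis by (simp add: distrib_right)
  qed
  with f(1) g(1) show ?case by (intro exI[of _ "C + D"] exI[of _ "N + M"]) auto
next
  case (mult f g)
  then obtain C N D M where f: "C \<ge> 0" "\<And>x. \<bar>f x\<bar> \<le> C * (1 + norm x) ^ N" and g: "D \<ge> 0" "\<And>x. \<bar>g x\<bar> \<le> D * (1 + norm x) ^ M"
    by blast
  have "\<bar>f x * g x\<bar> \<le> (C * D) * (1 + norm x) ^ (N + M)" for x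
  proof -
    have "\<bar>f x\<bar> * \<bar>g x\<bar> \<le> (C * (1 + norm x) ^ N) * (D * (1 + norm x) ^ M)"
      using f g by (intro mult_mono) auto
    then show ?thesis by (simp add: abs_mult power_add mult_ac)
  qed
  with f(1) g(1) show ?case by (intro exI[of _ "C * D"] exI[of _ "N + M"]) auto
qed

definition gaussian_times :: "('a::euclidean_space \<Rightarrow> real) \<Rightarrow> 'a \<Rightarrow> complex" where
  "gaussian_times p x = of_real (p x * exp (- (norm x)\<^sup>2))"

lemma gaussian_times_has_derivative:
  assumes "(p has_derivative D) (at x)"
  shows "(gaussian_times p has_derivative (\<lambda>h. of_real ((D h - 2 * (x \<bullet> h) * p x) * exp (- (norm x)\<^sup>2)))) (at x)"
proof -
  have "((\<lambda>x. p x * exp (- (x \<bullet> x))) has_derivative (\<lambda>h. (D h - 2 * (x \<bullet> h) * p x) * exp (- (x \<bullet> x)))) (at x)"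
    by (rule derivative_eq_intros assms refl)+ (auto simp: algebra_simps inner_commute)
  then have "((\<lambda>x. complex_of_real (p x * exp (- (x \<bullet> x)))) has_derivative (\<lambda>h. of_real ((D h - 2 * (x \<bullet> h) * p x) * exp (- (x \<bullet> x))))) (at x)"
    by (rule has_derivative_of_real)
  then show ?thesis by (simp add: gaussian_times_def[abs_def] power2_norm_eq_inner)
qed

text \<open>
  Polynomial multiples of the Gaussian are closed under directional derivatives; this is why the
  class is considered instead of the Gaussian alone.
\<close>

lemma iter_deriv_gaussian_times:
  fixes p :: "'a::euclidean_space \<Rightarrow> real"
  assumes "real_polynomial_function p"
  shows "\<exists>q. real_polynomial_function q \<and> iter_deriv bs (gaussian_times p) = gaussian_times q"
proof (induction bs)
  case (Cons b bs)
  then obtain q where q: "real_polynomial_function q" "iter_deriv bs (gaussian_times p) = gaussian_times q" by blast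
  obtain q' where q': "real_polynomial_function q'" "\<And>x. \<exists>D. (q has_derivative D) (at x) \<and> D b = q' x"
    by (rule real_polynomial_function_directional_derivative[OF q(1), of b]) blast
  have "frechet_derivative (gaussian_times q) (at x) b = gaussian_times (\<lambda>x. q' x + (- 2) * ((x \<bullet> b) * q x)) x" for x
  proof -
    obtain D where D: "(q has_derivative D) (at x)" "D b = q' x" using q'(2) by blast
    show ?thesis
      unfolding frechet_derivative_at[OF gaussian_times_has_derivative[OF D(1)], symmetric]
      by (simp add: gaussian_times_def D(2))
  qed
  moreover have "real_polynomial_function (\<lambda>x. q' x + (- 2) * ((x \<bullet> b) * q x))"
    by (intro real_polynomial_function.intros(2-4) real_polynomial_function.intros(1)[OF bounded_linear_inner_left] q(1) q'(1))
  ultimately show ?case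
    by (intro exI[of _ "\<lambda>x. q' x + (- 2) * ((x \<bullet> b) * q x)"]) (auto simp: q(2))
qed (use assms in auto)

lemma power_times_gaussian_le:
  fixes r :: real
  assumes "r \<ge> 0"
  shows "(1 + r) ^ M * exp (- r\<^sup>2) \<le> exp ((real M)\<^sup>2 / 4)"
proof -
  have "(1 + r) ^ M \<le> exp r ^ M"
    using assms exp_ge_add_one_self[of r] by (intro power_mono) auto
  also have "\<dots> = exp (real M * r)" by (simp add: exp_of_nat_mult)
  finally have "(1 + r) ^ M * exp (- r\<^sup>2) \<le> exp (real M * r) * exp (- r\<^sup>2)"
    by (rule mult_right_mono) simp
  also have "\<dots> = exp (real M * r - r\<^sup>2)" by (simp flip: exp_add)
  also have "\<dots> \<le> exp ((real M)\<^sup>2 / 4)"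
    using zero_le_power2[of "real M / 2 - r"] by (simp add: power2_diff power_divide)
  finally show ?thesis .
qed

lemma gaussian_times_schwartz:
  fixes p :: "'a::euclidean_space \<Rightarrow> real"
  assumes "real_polynomial_function p"
  shows "gaussian_times p \<in> schwartz"
  unfolding schwartz_def
proof (intro CollectI allI impI conjI)
  fix bs :: "'a list" and x :: 'a and k :: nat
  obtain q where q: "real_polynomial_function q" "iter_deriv bs (gaussian_times p) = gaussian_times q"
    using iter_deriv_gaussian_times[OF assms] by blast
  have "\<exists>D. (q has_derivative D) (at x)"
    using real_polynomial_function_directional_derivative[OF q(1), of 0] by metis
  then show "iter_deriv bs (gaussian_times p) differentiable (at x)"
    unfolding q(2) differentiable_def using gaussian_times_has_derivative by blast
  obtain C N where C: "C \<ge> 0" "\<And>x. \<bar>q x\<bar> \<le> C * (1 + norm x) ^ N"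
    using real_polynomial_function_growth[OF q(1)] by blast
  have "norm y ^ k * norm (gaussian_times q y) \<le> C * exp ((real (k + N))\<^sup>2 / 4)" for y
  proof -
    have "norm y ^ k * \<bar>q y\<bar> \<le> (1 + norm y) ^ k * (C * (1 + norm y) ^ N)"
      using C by (intro mult_mono power_mono) auto
    then have "norm y ^ k * \<bar>q y\<bar> * exp (- (norm y)\<^sup>2) \<le> (1 + norm y) ^ k * (C * (1 + norm y) ^ N) * exp (- (norm y)\<^sup>2)"
      by (rule mult_right_mono) simp
    also have "\<dots> = C * ((1 + norm y) ^ (k + N) * exp (- (norm y)\<^sup>2))"
      by (simp add: power_add)
    also have "\<dots> \<le> C * exp ((real (k + N))\<^sup>2 / 4)"
      using C(1) by (intro mult_left_mono power_times_gaussian_le) auto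
    finally show ?thesis by (simp add: gaussian_times_def norm_mult abs_mult mult_ac)
  qed
  then show "\<exists>C. \<forall>x. norm x ^ k * norm (iter_deriv bs (gaussian_times p) x) \<le> C"
    unfolding q(2) by blast
qed


section \<open>The normalization constant of the Riesz kernel\<close>

lemma riesz_normalization_constant:
  assumes s: "0 < s" "2 * s < real DIM('a::euclidean_space)"
  shows "riesz_normalization TYPE('a) s (riesz_constant TYPE('a) s)"
  unfolding riesz_normalization_def has_fourier_transform_def
proof (intro conjI ballI)
  \<comment> \<open>testing the pairing lemmas with this weight yields temperedness\<close>
  let ?w = "\<lambda>x::'a. 1 / complex_of_real ((1 + norm x) ^ (2 * DIM('a)))"
  have "integrable lborel (\<lambda>x::'a. complex_of_real (1 / (1 + norm x) ^ (2 * DIM('a))))"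
    by (intro integrable_of_real integrable_polynomial_weight)
  then have w: "integrable lborel ?w" by simp
  have w1: "norm (?w x) \<le> 1" for x :: 'a
  proof -
    have "1 \<le> (1 + norm x) ^ (2 * DIM('a))" by (intro one_le_power) simp
    moreover have "1 \<le> a \<Longrightarrow> 1 / a \<le> 1" for a :: real by simp
    ultimately have "1 / (1 + norm x) ^ (2 * DIM('a)) \<le> 1" by blast
    then show ?thesis by (simp add: norm_divide del: of_real_power of_real_add)
  qed
  show "tempered (\<lambda>x::'a. complex_of_real (riesz_constant TYPE('a) s * norm x powr (2 * s - real DIM('a))))"
    unfolding tempered_def
    using integrable_mult_right[OF riesz_potential_pairing(1)[OF s w w1], of "of_real (riesz_constant TYPE('a) s)"]
    by (intro exI[of _ "2 * DIM('a)"]) (simp add: mult.assoc)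
  show "tempered (\<lambda>\<xi>::'a. complex_of_real ((4 * pi\<^sup>2 * (norm \<xi>)\<^sup>2) powr (- s)))"
    unfolding tempered_def
    using riesz_symbol_pairing(1)[OF s w w1] by (intro exI[of _ "2 * DIM('a)"]) simp
  fix \<phi> :: "'a \<Rightarrow> complex" assume \<phi>: "\<phi> \<in> schwartz"
  obtain B where B: "\<And>x. norm (\<phi> x) \<le> B" by (rule schwartz_bounded[OF \<phi>]) blast
  show "(LINT x|lborel. of_real (riesz_constant TYPE('a) s * norm x powr (2 * s - real DIM('a))) * fourier \<phi> x)
      = (LINT \<xi>|lborel. of_real ((4 * pi\<^sup>2 * (norm \<xi>)\<^sup>2) powr (- s)) * \<phi> \<xi>)"
    by (rule riesz_fourier_pairing[OF s integrable_schwartz[OF \<phi>] B integrable_fourier_schwartz[OF \<phi>]])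
qed

lemma riesz_symbol_gaussian_nonzero:
  assumes s: "0 < s" "2 * s < real DIM('a::euclidean_space)"
  shows "(LINT \<xi>|lborel. of_real ((4 * pi\<^sup>2 * (norm (\<xi>::'a))\<^sup>2) powr (- s)) * gaussian_times (\<lambda>_. 1) \<xi>) \<noteq> 0"
proof
  let ?\<phi> = "gaussian_times (\<lambda>_. 1) :: 'a \<Rightarrow> complex"
  let ?f = "\<lambda>\<xi>::'a. (4 * pi\<^sup>2 * (norm \<xi>)\<^sup>2) powr (- s) * exp (- (norm \<xi>)\<^sup>2)"
  have \<phi>: "?\<phi> \<in> schwartz" by (rule gaussian_times_schwartz) auto
  obtain B where B: "\<And>x. norm (?\<phi> x) \<le> B" by (rule schwartz_bounded[OF \<phi>]) blast
  have eq: "of_real ((4 * pi\<^sup>2 * (norm \<xi>)\<^sup>2) powr (- s)) * ?\<phi> \<xi> = of_real (?f \<xi>)" for \<xi>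
    by (simp add: gaussian_times_def)
  have "integrable lborel (\<lambda>\<xi>. complex_of_real (?f \<xi>))"
    using riesz_symbol_pairing(1)[OF s integrable_schwartz[OF \<phi>] B] by (simp only: eq)
  then have int: "integrable lborel ?f"
    using integrable_Re[of lborel "\<lambda>\<xi>. complex_of_real (?f \<xi>)"] by simp
  assume "(LINT \<xi>|lborel. of_real ((4 * pi\<^sup>2 * (norm \<xi>)\<^sup>2) powr (- s)) * ?\<phi> \<xi>) = 0"
  then have "complex_of_real (LINT \<xi>|lborel. ?f \<xi>) = 0"
    unfolding eq by (simp only: integral_of_real[OF int])
  then have "(LINT \<xi>|lborel. ?f \<xi>) = 0" by (simp only: of_real_eq_0_iff)
  then have "AE \<xi> in lborel. ?f \<xi> = 0"
    using integral_nonneg_eq_0_iff_AE[OF int] by simp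
  then have "AE \<xi> in (lborel :: 'a measure). False"
    using AE_lborel_singleton[of "0::'a"] by eventually_elim auto
  then have "emeasure (lborel :: 'a measure) UNIV = 0"
    using AE_iff_measurable[of "UNIV :: 'a set" lborel "\<lambda>_. False"] by simp
  then show False by simp
qed

lemma riesz_normalization_iff:
  assumes s: "0 < s" "2 * s < real DIM('a::euclidean_space)"
  shows "riesz_normalization TYPE('a) s d \<longleftrightarrow> d = riesz_constant TYPE('a) s"
proof
  let ?\<phi> = "gaussian_times (\<lambda>_. 1) :: 'a \<Rightarrow> complex"
  let ?J = "LINT \<xi>|lborel. of_real ((4 * pi\<^sup>2 * (norm \<xi>)\<^sup>2) powr (- s)) * ?\<phi> \<xi>"
  let ?I = "LINT x|lborel. of_real (norm x powr (2 * s - real DIM('a))) * fourier ?\<phi> x"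
  have \<phi>: "?\<phi> \<in> schwartz" by (rule gaussian_times_schwartz) auto
  have pair: "of_real c * ?I = ?J" if "riesz_normalization TYPE('a) s c" for c
  proof -
    have "(LINT x|lborel. of_real (c * norm x powr (2 * s - real DIM('a))) * fourier ?\<phi> x) = ?J"
      using that \<phi> unfolding riesz_normalization_def has_fourier_transform_def by blast
    moreover have "(LINT x|lborel. of_real (c * norm x powr (2 * s - real DIM('a))) * fourier ?\<phi> x) = of_real c * ?I"
      by (subst integral_mult_right_zero[symmetric]) (simp add: mult.assoc)
    ultimately show ?thesis by simp
  qed
  assume "riesz_normalization TYPE('a) s d"
  then have "of_real d * ?I = of_real (riesz_constant TYPE('a) s) * ?I"
    using pair riesz_normalization_constant[OF s] by simp
  moreover have "?I \<noteq> 0"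
    using pair[OF riesz_normalization_constant[OF s]] riesz_symbol_gaussian_nonzero[OF s] by auto
  ultimately show "d = riesz_constant TYPE('a) s" by simp
qed (use riesz_normalization_constant[OF s] in simp)

section \<open>Behaviour of the kernel at the origin\<close>

lemma log_bessel_kernel_logarithmic_scale:
  fixes x :: "'a::euclidean_space"
  assumes "x \<noteq> 0"
  shows "log_bessel_kernel s lam x = (4 * pi) powr (- real DIM('a) / 2) *
    log_bessel_profile (real DIM('a) / 2) s lam (exp (- ln (1 / (norm x)\<^sup>2)) / 4)"
  using assms by (simp add: log_bessel_kernel_eq_profile ln_div)

lemma filterlim_ln_inverse_square_norm:
  "filterlim (\<lambda>x::'a::real_normed_vector. ln (1 / (norm x)\<^sup>2)) at_top (at 0)"
proof -
  have "filterlim (\<lambda>r::real. ln (1 / r\<^sup>2)) at_top (at_right 0)"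
    by real_asymp
  moreover have "filterlim (\<lambda>x::'a. norm x) (at_right 0) (at 0)"
    by (auto simp: filterlim_at eventually_at_filter intro!: tendsto_norm_zero always_eventually)
  ultimately show ?thesis by (rule filterlim_compose)
qed

lemma log_bessel_kernel_limit_subcritical:
  assumes "lam > 1" "s > 0" "2 * s < real DIM('a::euclidean_space)"
  shows "((\<lambda>x::'a. log_bessel_kernel s lam x * (ln (1 / (norm x)\<^sup>2) / norm x powr (2 * s - real DIM('a))))
     \<longlongrightarrow> riesz_constant TYPE('a) s) (at 0)"
proof -
  let ?\<nu> = "real DIM('a) / 2"
  let ?L = "\<lambda>x::'a. ln (1 / (norm x)\<^sup>2)"
  let ?c = "(4 * pi) powr (- ?\<nu>)"
  have lim: "((\<lambda>x. ?c * (log_bessel_profile ?\<nu> s lam (exp (- ?L x) / 4) * (?L x * exp (- (?L x * (?\<nu> - s)))))) \<longlongrightarrow>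
      ?c * (rGamma s * 4 powr (?\<nu> - s) * Gamma (?\<nu> - s))) (at 0)"
  proof (rule tendsto_mult[OF tendsto_const])
    have "s < ?\<nu>" using assms(3) by simp
    from filterlim_compose[OF log_bessel_profile_limit_subcritical[OF assms(1,2) this] filterlim_ln_inverse_square_norm]
    show "((\<lambda>x. log_bessel_profile ?\<nu> s lam (exp (- ?L x) / 4) * (?L x * exp (- (?L x * (?\<nu> - s))))) \<longlongrightarrow>
      rGamma s * 4 powr (?\<nu> - s) * Gamma (?\<nu> - s)) (at 0)" .
  qed
  have ev: "\<forall>\<^sub>F x in at 0. ?c * (log_bessel_profile ?\<nu> s lam (exp (- ?L x) / 4) * (?L x * exp (- (?L x * (?\<nu> - s)))))
      = log_bessel_kernel s lam x * (?L x / norm x powr (2 * s - real DIM('a)))"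
    unfolding eventually_at_filter
  proof (intro always_eventually allI impI)
    fix x :: 'a assume x: "x \<noteq> 0"
    have "?L x = - 2 * ln (norm x)" using x by (simp add: ln_div ln_realpow)
    then have "- (?L x * (?\<nu> - s)) = - ((2 * s - real DIM('a)) * ln (norm x))"
      by (simp only:) (simp add: field_simps)
    moreover have "1 / norm x powr (2 * s - real DIM('a)) = exp (- ((2 * s - real DIM('a)) * ln (norm x)))"
      using x by (simp add: powr_def exp_minus inverse_eq_divide)
    ultimately have "exp (- (?L x * (?\<nu> - s))) = 1 / norm x powr (2 * s - real DIM('a))"
      by (simp only:)
    then show "?c * (log_bessel_profile ?\<nu> s lam (exp (- ?L x) / 4) * (?L x * exp (- (?L x * (?\<nu> - s)))))
      = log_bessel_kernel s lam x * (?L x / norm x powr (2 * s - real DIM('a)))"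
      unfolding log_bessel_kernel_logarithmic_scale[OF x] by simp
  qed
  have c: "?c * (rGamma s * 4 powr (?\<nu> - s) * Gamma (?\<nu> - s)) = riesz_constant TYPE('a) s"
  proof -
    have "(2::real) powr (2 * s) = 4 powr s" by (simp flip: powr_powr)
    moreover have "rGamma s = 1 / Gamma s"
      by (simp add: Gamma_def inverse_eq_divide)
    moreover have "?c * 4 powr (?\<nu> - s) = 1 / (pi powr ?\<nu> * 4 powr s)"
      by (simp add: powr_mult powr_minus_divide powr_diff)
    moreover have "?c * (1 / Gamma s * 4 powr (?\<nu> - s) * Gamma (?\<nu> - s)) = ?c * 4 powr (?\<nu> - s) * (Gamma (?\<nu> - s) / Gamma s)"
      by simp
    ultimately show ?thesis
      by (simp only: riesz_constant_def) simp
  qed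
  show ?thesis using Lim_transform_eventually[OF lim ev] unfolding c .
qed

lemma log_bessel_kernel_limit_critical:
  assumes "lam > 1"
  shows "((\<lambda>x::'a::euclidean_space. log_bessel_kernel (real DIM('a) / 2) lam x * (1 / ln (ln (1 / norm x))))
     \<longlongrightarrow> 1 / ((4 * pi) powr (real DIM('a) / 2) * Gamma (real DIM('a) / 2))) (at 0)"
proof -
  let ?\<nu> = "real DIM('a) / 2"
  let ?L = "\<lambda>x::'a. ln (1 / (norm x)\<^sup>2)"
  let ?c = "(4 * pi) powr (- ?\<nu>)"
  have "((\<lambda>L. ln L / ln (L / 2)) \<longlongrightarrow> (1::real)) at_top" by real_asymp
  then have lim: "((\<lambda>x. ?c * (log_bessel_profile ?\<nu> ?\<nu> lam (exp (- ?L x) / 4) / ln (?L x) * (ln (?L x) / ln (?L x / 2)))) \<longlongrightarrow>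
      ?c * (rGamma ?\<nu> * 1)) (at 0)"
  proof (intro tendsto_mult[OF tendsto_const] tendsto_mult)
    have "0 < ?\<nu>" by simp
    from filterlim_compose[OF log_bessel_profile_limit_critical[OF assms this] filterlim_ln_inverse_square_norm]
    show "((\<lambda>x. log_bessel_profile ?\<nu> ?\<nu> lam (exp (- ?L x) / 4) / ln (?L x)) \<longlongrightarrow> rGamma ?\<nu>) (at 0)" .
  qed (rule filterlim_compose[OF _ filterlim_ln_inverse_square_norm])
  have ev: "\<forall>\<^sub>F x in at 0. ?c * (log_bessel_profile ?\<nu> ?\<nu> lam (exp (- ?L x) / 4) / ln (?L x) * (ln (?L x) / ln (?L x / 2)))
      = log_bessel_kernel ?\<nu> lam x * (1 / ln (ln (1 / norm x)))"
    using filterlim_at_top_dense[THEN iffD1, OF filterlim_ln_inverse_square_norm, rule_format, of 1] eventually_neq_at_within[of 0]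
  proof eventually_elim
    case (elim x)
    have "?L x / 2 = ln (1 / norm x)" using elim by (simp add: ln_div ln_realpow)
    moreover have "ln (?L x) \<noteq> 0" using elim(1) by simp
    ultimately show ?case
      unfolding log_bessel_kernel_logarithmic_scale[OF elim(2)] by simp
  qed
  have c: "?c * (rGamma ?\<nu> * 1) = 1 / ((4 * pi) powr ?\<nu> * Gamma ?\<nu>)"
  proof -
    have "rGamma ?\<nu> = 1 / Gamma ?\<nu>"
      by (simp add: Gamma_def inverse_eq_divide)
    then show ?thesis
      by (simp only: powr_minus_divide) simp
  qed
  show ?thesis using Lim_transform_eventually[OF lim ev] unfolding c .
qed

lemma log_bessel_kernel_limit_supercritical:
  assumes "lam > 1" "real DIM('a::euclidean_space) < 2 * s"
  defines "h \<equiv> \<lambda>p. Gamma (s + p - real DIM('a) / 2) / Gamma (s + p) * lam powr (real DIM('a) / 2 - s - p)"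
  shows "set_integrable lborel {0<..} h"
    and "((log_bessel_kernel s lam :: 'a \<Rightarrow> real) \<longlongrightarrow> 1 / (4 * pi) powr (real DIM('a) / 2) * (LBINT p:{0<..}. h p)) (at 0)"
    and "bounded ((log_bessel_kernel s lam :: 'a \<Rightarrow> real) ` (- {0}))"
proof -
  let ?\<nu> = "real DIM('a) / 2"
  let ?L = "\<lambda>x::'a. ln (1 / (norm x)\<^sup>2)"
  let ?c = "(4 * pi) powr (- ?\<nu>)"
  let ?q = "\<lambda>\<alpha>. indicator {s<..} \<alpha> * Gamma_quotient ?\<nu> lam \<alpha>"
  have \<nu>: "0 < ?\<nu>" "?\<nu> < s" using assms(2) by auto
  have shift: "?q (s + 1 * p) = indicator {0<..} p *\<^sub>R h p" for p
  proof -
    have 1: "rGamma (s + p) = 1 / Gamma (s + p)" by (simp add: Gamma_def inverse_eq_divide)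
    have 2: "- (s + p - ?\<nu>) = ?\<nu> - s - p" by simp
    show ?thesis
      unfolding mult_1 h_def Gamma_quotient_def 1 2 by (simp add: indicator_def)
  qed
  have q: "integrable lborel ?q" using assms(1) \<nu> by (rule integrable_Gamma_quotient)
  show "set_integrable lborel {0<..} h"
    unfolding set_integrable_def shift[symmetric] using q by (rule lborel_integrable_real_affine) simp
  have I: "(LBINT p:{0<..}. h p) = (LINT \<alpha>|lborel. ?q \<alpha>)"
    unfolding set_lebesgue_integral_def shift[symmetric]
    using lborel_integral_real_affine[of 1 ?q s] by simp
  have lim: "((\<lambda>x. ?c * log_bessel_profile ?\<nu> s lam (exp (- ?L x) / 4)) \<longlongrightarrow> ?c * (LINT \<alpha>|lborel. ?q \<alpha>)) (at 0)"
    by (rule tendsto_mult[OF tendsto_const filterlim_compose[OF log_bessel_profile_limit_supercritical[OF assms(1) \<nu>]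
          filterlim_ln_inverse_square_norm]])
  have ev: "\<forall>\<^sub>F x in at 0. ?c * log_bessel_profile ?\<nu> s lam (exp (- ?L x) / 4) = log_bessel_kernel s lam x"
    unfolding eventually_at_filter
    by (intro always_eventually allI impI) (simp add: log_bessel_kernel_logarithmic_scale)
  have c: "?c * (LINT \<alpha>|lborel. ?q \<alpha>) = 1 / (4 * pi) powr ?\<nu> * (LBINT p:{0<..}. h p)"
    unfolding I by (simp add: powr_minus_divide)
  show "((log_bessel_kernel s lam :: 'a \<Rightarrow> real) \<longlongrightarrow> 1 / (4 * pi) powr ?\<nu> * (LBINT p:{0<..}. h p)) (at 0)"
    using Lim_transform_eventually[OF lim ev] unfolding c .
  show "bounded ((log_bessel_kernel s lam :: 'a \<Rightarrow> real) ` (- {0}))"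
    unfolding bounded_iff
  proof (intro exI ballI)
    fix y assume "y \<in> (log_bessel_kernel s lam :: 'a \<Rightarrow> real) ` (- {0})"
    then obtain x :: 'a where x: "x \<noteq> 0" "y = log_bessel_kernel s lam x" by auto
    have "log_bessel_profile ?\<nu> s lam (exp (- ?L x) / 4) \<le> (LINT \<alpha>|lborel. ?q \<alpha>)"
      using assms(1) \<nu> by (intro log_bessel_profile_le) auto
    then have "?c * log_bessel_profile ?\<nu> s lam (exp (- ?L x) / 4) \<le> ?c * (LINT \<alpha>|lborel. ?q \<alpha>)"
      by (rule mult_left_mono) simp
    moreover have "0 \<le> ?c * log_bessel_profile ?\<nu> s lam (exp (- ?L x) / 4)"
      using \<nu> by (simp add: log_bessel_profile_nonneg)
    ultimately show "norm y \<le> ?c * (LINT \<alpha>|lborel. ?q \<alpha>)"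
      unfolding x(2) log_bessel_kernel_logarithmic_scale[OF x(1)] by simp
  qed
qed

theorem proposition1p3:
  fixes s lam :: real
  assumes "lam > 1" and "s > 0"
  shows
    "(real DIM('a::euclidean_space) > 2 * s \<longrightarrow>
       (let c = Gamma (real DIM('a) / 2 - s)
                  / (pi powr (real DIM('a) / 2) * 2 powr (2 * s) * Gamma s)
        in ((\<lambda>x::'a. log_bessel_kernel s lam x *
                (ln (1 / (norm x)\<^sup>2) / norm x powr (2 * s - real DIM('a)))) \<longlongrightarrow> c) (at 0)
           \<and> (\<forall>d. riesz_normalization TYPE('a) s d \<longleftrightarrow> d = c)))
     \<and> (real DIM('a) = 2 * s \<longrightarrow>
       ((\<lambda>x::'a. log_bessel_kernel (real DIM('a) / 2) lam x * (1 / ln (ln (1 / norm x))))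
          \<longlongrightarrow> 1 / ((4 * pi) powr (real DIM('a) / 2) * Gamma (real DIM('a) / 2))) (at 0))
     \<and> (real DIM('a) < 2 * s \<longrightarrow>
       (let h = (\<lambda>p. Gamma (s + p - real DIM('a) / 2) / Gamma (s + p)
                       * lam powr (real DIM('a) / 2 - s - p))
        in set_integrable lborel {0<..} h
           \<and> ((log_bessel_kernel s lam :: 'a \<Rightarrow> real)
                \<longlongrightarrow> 1 / (4 * pi) powr (real DIM('a) / 2) * (LBINT p:{0<..}. h p)) (at 0)
           \<and> bounded ((log_bessel_kernel s lam :: 'a \<Rightarrow> real) ` (- {0}))))"
proof (intro conjI impI)
  assume n: "real DIM('a) > 2 * s"
  show "let c = Gamma (real DIM('a) / 2 - s) / (pi powr (real DIM('a) / 2) * 2 powr (2 * s) * Gamma s)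
        in ((\<lambda>x::'a. log_bessel_kernel s lam x *
                (ln (1 / (norm x)\<^sup>2) / norm x powr (2 * s - real DIM('a)))) \<longlongrightarrow> c) (at 0)
           \<and> (\<forall>d. riesz_normalization TYPE('a) s d \<longleftrightarrow> d = c)"
    using log_bessel_kernel_limit_subcritical[OF assms n] riesz_normalization_iff[OF assms(2) n]
    unfolding Let_def riesz_constant_def by blast
next
  show "((\<lambda>x::'a. log_bessel_kernel (real DIM('a) / 2) lam x * (1 / ln (ln (1 / norm x))))
          \<longlongrightarrow> 1 / ((4 * pi) powr (real DIM('a) / 2) * Gamma (real DIM('a) / 2))) (at 0)"
    by (rule log_bessel_kernel_limit_critical[OF assms(1)])
next
  assume n: "real DIM('a) < 2 * s"
  show "let h = (\<lambda>p. Gamma (s + p - real DIM('a) / 2) / Gamma (s + p) * lam powr (real DIM('a) / 2 - s - p))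
        in set_integrable lborel {0<..} h
           \<and> ((log_bessel_kernel s lam :: 'a \<Rightarrow> real)
                \<longlongrightarrow> 1 / (4 * pi) powr (real DIM('a) / 2) * (LBINT p:{0<..}. h p)) (at 0)
           \<and> bounded ((log_bessel_kernel s lam :: 'a \<Rightarrow> real) ` (- {0}))"
    using log_bessel_kernel_limit_supercritical[OF assms(1) n] unfolding Let_def by blast
qed

end
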